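(* Let $\mathcal{V}=(V,E)$ be the infinite Vicsek graph, let $o=(0,0)\in V$, and let $\mu$ be the infinite volume limit measure of the Abelian sandpile model on $\mathcal{V}$. If $\eta:V\to\mathbb{N}$ is a sandpile sampled from $\mu$ and $\delta_o:V\to\mathbb{N}$ is the function with value $1$ at $o$ and $0$ everywhere else, then $$\mu(\eta+\delta_o\text{ stabilizes})=\frac34 .$$
   Context: $\mathbb{N}=\{0,1,2,\dots\}$. **Vicsek graphs.** $\mathcal{V}_0=(V_0,E_0)$ is the complete graph on $V_0=\{(0,0),(1,0),(0,1),(1,1)\}$. For $n\ge 1$ put $L=3^{n-1}$ and let $S_n=\{(0,0),(L,L),(2L,0),(0,2L),(2L,2L)\}$. Then $\mathcal{V}_n=(V_n,E_n)$ with $V_n=\bigcup_{a\in S_n}(a+V_{n-1})$ and $E_n=\bigcup_{a\in S_n}(a+E_{n-1})$, where $a+\{v,w\}=\{a+v,a+w\}$ for an edge $\{v,w\}$. The infinite Vicsek graph is $\mathcal{V}=(V,E)=(\bigcup_n V_n,\bigcup_n E_n)$. **Sandpiles on $\mathcal{V}_n$.** The sink of $\mathcal{V}_n$ is $s_n=(3^n,3^n)$. A sandpile on $\mathcal{V}_n$ is a function $\sigma:V_n\setminus\{s_n\}\to\mathbb{N}$; it is stable if $\sigma(v)<\deg_{\mathcal{V}_n}(v)$ for all $v\neq s_n$. Toppling $v\ne s_n$ removes $\deg_{\mathcal{V}_n}(v)$ particles from $v$ and adds one particle to each neighbour of $v$; particles sent to $s_n$ leave the system. A toppling at $v$ is legal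 if $\sigma(v)\ge\deg_{\mathcal{V}_n}(v)$. Every sandpile $\sigma$ can be turned by finitely many legal topplings into a unique stable sandpile $\sigma^\circ$. The sandpile Markov chain on stable sandpiles is $\sigma_{k+1}=(\sigma_k+\delta_{Y_{k+1}})^\circ$ with $Y_1,Y_2,\dots$ i.i.d. uniform on $V_n\setminus\{s_n\}$. $\mathcal{R}_n$ denotes the set of its recurrent states and $\mu_n$ the uniform distribution on $\mathcal{R}_n$. **Infinite volume limit.** The measures $\mu_n$ converge weakly to a probability measure $\mu$ on $\mathbb{N}^V$ (product $\sigma$-algebra), supported on stable configurations: for every finite $A\subset V$ and $\xi\in\mathbb{N}^A$, $\mu(\eta|_A=\xi)=\lim_{n\to\infty}\mu_n(\eta|_A=\xi)$ (for $n$ large enough that $A\subset V_n\setminus\{s_n\}$). This $\mu$ is the infinite volume limit measure. **Stabilization on $\mathcal{V}$.** On $\mathcal{V}$, topplings and stability are defined in the same way with $\deg_{\mathcal{V}}$ and no sink. A configuration $\sigma:V\to\mathbb{N}$ stabilizes if some finite sequence (possibly empty) of legal topplings transforms it into a stable configuration on $\mathcal{V}$. *)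

theory Defs
  imports "HOL-Probability.Probability"
begin

type_synonym vertex = "nat \<times> nat"

text \<open>Addition on \<^typ>\<open>vertex\<close> is componentwise.\<close>

definition vicsek_shifts :: "nat \<Rightarrow> vertex set" where
  "vicsek_shifts n =
     (let L = 3 ^ (n - 1) in {(0, 0), (L, L), (2 * L, 0), (0, 2 * L), (2 * L, 2 * L)})"

primrec vicsek_verts :: "nat \<Rightarrow> vertex set" where
  "vicsek_verts 0 = {(0, 0), (1, 0), (0, 1), (1, 1)}"
| "vicsek_verts (Suc n) = (\<Union>a\<in>vicsek_shifts (Suc n). (+) a ` vicsek_verts n)"

primrec vicsek_edges :: "nat \<Rightarrow> vertex set set" where
  "vicsek_edges 0 = {{v, w} | v w. v \<in> vicsek_verts 0 \<and> w \<in> vicsek_verts 0 \<and> v \<noteq> w}"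
| "vicsek_edges (Suc n) = (\<Union>a\<in>vicsek_shifts (Suc n). (\<lambda>e. (+) a ` e) ` vicsek_edges n)"

definition vicsek_V :: "vertex set" where
  "vicsek_V = (\<Union>n. vicsek_verts n)"

definition vicsek_E :: "vertex set set" where
  "vicsek_E = (\<Union>n. vicsek_edges n)"

definition vicsek_sink :: "nat \<Rightarrow> vertex" where
  "vicsek_sink n = (3 ^ n, 3 ^ n)"

definition deg :: "vertex set set \<Rightarrow> vertex \<Rightarrow> nat" where
  "deg E v = card {w. {v, w} \<in> E}"

text \<open>
  Below, \<open>E\<close> is the edge set of the whole graph and \<open>W\<close> is the set of its non-sink vertices (all
  vertices if there is no sink). A sandpile is an element of \<open>W \<rightarrow>\<^sub>E UNIV\<close>, that is, a function
  with value \<^const>\<open>undefined\<close> outside \<open>W\<close>. This is the convention of \<^const>\<open>PiM\<close>, so that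
  configurations on the infinite graph are exactly the points of the product space. Particles
  sent to the sink disappear because of the restriction to \<open>W\<close>, but edges to the sink count for
  the degree.
\<close>

definition stable :: "vertex set set \<Rightarrow> vertex set \<Rightarrow> (vertex \<Rightarrow> nat) \<Rightarrow> bool" where
  "stable E W \<sigma> \<longleftrightarrow> (\<forall>v\<in>W. \<sigma> v < deg E v)"

text \<open>The subtraction is used only for legal topplings, where it does not truncate.\<close>

definition topple :: "vertex set set \<Rightarrow> vertex set \<Rightarrow> vertex \<Rightarrow> (vertex \<Rightarrow> nat) \<Rightarrow> vertex \<Rightarrow> nat" where
  "topple E W v \<sigma> =
     (\<lambda>w\<in>W. if w = v then \<sigma> w - deg E v else if {v, w} \<in> E then \<sigma> w + 1 else \<sigma> w)"

definition legal_step ::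
    "vertex set set \<Rightarrow> vertex set \<Rightarrow> (vertex \<Rightarrow> nat) \<Rightarrow> (vertex \<Rightarrow> nat) \<Rightarrow> bool" where
  "legal_step E W \<sigma> \<tau> \<longleftrightarrow> (\<exists>v\<in>W. \<sigma> v \<ge> deg E v \<and> \<tau> = topple E W v \<sigma>)"

definition stabilizes_to ::
    "vertex set set \<Rightarrow> vertex set \<Rightarrow> (vertex \<Rightarrow> nat) \<Rightarrow> (vertex \<Rightarrow> nat) \<Rightarrow> bool" where
  "stabilizes_to E W \<sigma> \<tau> \<longleftrightarrow> (legal_step E W)\<^sup>*\<^sup>* \<sigma> \<tau> \<and> stable E W \<tau>"

definition stabilizes :: "vertex set set \<Rightarrow> vertex set \<Rightarrow> (vertex \<Rightarrow> nat) \<Rightarrow> bool" where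
  "stabilizes E W \<sigma> \<longleftrightarrow> (\<exists>\<tau>. stabilizes_to E W \<sigma> \<tau>)"

definition stabilization ::
    "vertex set set \<Rightarrow> vertex set \<Rightarrow> (vertex \<Rightarrow> nat) \<Rightarrow> vertex \<Rightarrow> nat" where
  "stabilization E W \<sigma> = (THE \<tau>. stabilizes_to E W \<sigma> \<tau>)"

definition add_particle :: "vertex set \<Rightarrow> vertex \<Rightarrow> (vertex \<Rightarrow> nat) \<Rightarrow> vertex \<Rightarrow> nat" where
  "add_particle W v \<sigma> = (\<lambda>w\<in>W. \<sigma> w + (if w = v then 1 else 0))"

definition vicsek_nonsink :: "nat \<Rightarrow> vertex set" where
  "vicsek_nonsink n = vicsek_verts n - {vicsek_sink n}"

definition stable_sandpiles :: "nat \<Rightarrow> (vertex \<Rightarrow> nat) set" where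
  "stable_sandpiles n =
     {\<sigma> \<in> vicsek_nonsink n \<rightarrow>\<^sub>E UNIV. stable (vicsek_edges n) (vicsek_nonsink n) \<sigma>}"

text \<open>The chain started from \<open>\<sigma>\<close> and driven by the sequence \<open>Y\<close>; indices of \<open>Y\<close> start at 0.\<close>

primrec sandpile_chain ::
    "nat \<Rightarrow> (vertex \<Rightarrow> nat) \<Rightarrow> (nat \<Rightarrow> vertex) \<Rightarrow> nat \<Rightarrow> vertex \<Rightarrow> nat" where
  "sandpile_chain n \<sigma> Y 0 = \<sigma>"
| "sandpile_chain n \<sigma> Y (Suc k) =
     stabilization (vicsek_edges n) (vicsek_nonsink n)
       (add_particle (vicsek_nonsink n) (Y k) (sandpile_chain n \<sigma> Y k))"

definition driving_measure :: "nat \<Rightarrow> (nat \<Rightarrow> vertex) measure" where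
  "driving_measure n = PiM UNIV (\<lambda>_. measure_pmf (pmf_of_set (vicsek_nonsink n)))"

text \<open>A state is recurrent if the chain started from it almost surely returns to it.\<close>

definition recurrent_sandpiles :: "nat \<Rightarrow> (vertex \<Rightarrow> nat) set" where
  "recurrent_sandpiles n =
     {\<sigma> \<in> stable_sandpiles n. AE Y in driving_measure n. \<exists>k\<ge>1. sandpile_chain n \<sigma> Y k = \<sigma>}"

definition vicsek_mu :: "nat \<Rightarrow> (vertex \<Rightarrow> nat) pmf" where
  "vicsek_mu n = pmf_of_set (recurrent_sandpiles n)"

text \<open>
  Only the values of \<open>\<xi>\<close> on \<open>A\<close> matter, and only those \<open>n\<close> with \<open>A \<subseteq> vicsek_nonsink n\<close>, which
  holds for all large \<open>n\<close>.
\<close>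

definition infinite_volume_limit :: "(vertex \<Rightarrow> nat) measure \<Rightarrow> bool" where
  "infinite_volume_limit \<mu> \<longleftrightarrow>
     prob_space \<mu> \<and>
     sets \<mu> = sets (PiM vicsek_V (\<lambda>_. count_space UNIV)) \<and>
     (\<forall>A \<xi>. finite A \<and> A \<subseteq> vicsek_V \<longrightarrow>
        (\<lambda>n. measure_pmf.prob (vicsek_mu n) {\<eta>. \<forall>v\<in>A. \<eta> v = \<xi> v})
          \<longlonglongrightarrow> measure \<mu> {\<eta> \<in> space \<mu>. \<forall>v\<in>A. \<eta> v = \<xi> v})"

end

theory Submission imports Defs
begin

text \<open>
  The Vicsek graph is a tree of copies of \<open>K\<^sub>4\<close> glued at vertices, and its only infinite branch is
  the diagonal: the blocks on \<open>(k, k), (k + 1, k), (k, k + 1), (k + 1, k + 1)\<close> for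
  \<open>k = 0, 1, 2, \<dots>\<close>, with finite branches hanging off them.  Everything rests on reducing the
  avalanche started at the origin to a Markov chain that walks along these diagonal blocks.

  \<^bold>\<open>Recurrent sandpiles.\<close>  A stable sandpile is recurrent iff it is allowed, that is, iff it has no
  forbidden subconfiguration (\<open>recurrent_iff_allowed\<close>).  Because the blocks meet in cut vertices,
  being allowed is a condition on each block separately: call \<open>\<sigma>(v) - deg(v) + 3\<close> the reduced
  height of \<open>v\<close>; then the reduced heights of the three vertices of a diagonal block other than
  its vertex \<open>(k + 1, k + 1)\<close> nearest to the sink must form one of the \<open>16\<close> recurrent sandpiles of
  \<open>K\<^sub>4\<close>, and they may be replaced by any other of the \<open>16\<close> without changing anything else
  (\<open>block_triple_recurrent\<close>, \<open>set_triple_recurrent\<close>).  Hence under \<open>\<mu>\<^sub>n\<close>, and in the limit under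
  \<open>\<mu>\<close>, the block triples along the diagonal are independent and uniform.

  \<^bold>\<open>The avalanche.\<close>  If \<open>m\<close> particles enter block \<open>k\<close> at \<open>(k, k)\<close>, the stabilization of that block
  alone sends some number of particles to \<open>(k + 1, k + 1)\<close>, where they enter the next block.  A
  toppling of the exit vertex sends one particle to each of the three others, which then all
  topple once and restore everything, by the burning argument; the same holds for the hanging
  branches.  So the rest of the graph has no influence on the number of particles passed on.
  Let \<open>carry k\<close> be the number of particles that enter block \<open>k\<close>, starting with \<open>carry 0 = 1\<close>.
  Then \<open>\<eta> + \<delta>\<^sub>o\<close> stabilizes iff \<open>carry\<close> reaches \<open>0\<close> (\<open>stabilizes_imp_extinct\<close>,
  \<open>extinct_imp_stabilizes\<close>).  Both directions avoid following the topplings: by the least action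
  principle it suffices to argue about finitely supported functions \<open>u\<close> for which
  \<open>\<eta> + \<delta>\<^sub>o - \<Delta>u\<close> is stable.

  \<^bold>\<open>The number 3/4.\<close>  Adding particles permutes the \<open>16\<close> recurrent sandpiles of \<open>K\<^sub>4\<close>, so on average
  a block passes on as many particles as it receives: \<open>carry\<close> is a martingale.  The group element
  of a particle at a vertex has order \<open>4\<close>, so a block that receives \<open>4\<close> particles passes on exactly
  \<open>4\<close>; the states \<open>0\<close> and \<open>4\<close> are absorbing and \<open>carry\<close> stays in \<open>{0, \<dots>, 4}\<close>.  Absorption is almost
  sure, and from \<open>1\<close> it happens at \<open>4\<close> with probability \<open>1/4\<close> and at \<open>0\<close> with probability \<open>3/4\<close>
  (\<open>carry_law_extinct\<close>).
\<close>

section \<open>Toppling on locally finite graphs\<close>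

definition nbrs :: "vertex set set \<Rightarrow> vertex \<Rightarrow> vertex set" where
  "nbrs E v = {w. {v, w} \<in> E}"

text \<open>The graph Laplacian with the sign that makes it positive: toppling each \<open>v\<close> exactly \<open>u v\<close> times
  changes a sandpile by \<open>- lap E u\<close>.  A sink is modelled by functions that vanish there.\<close>

definition lap :: "vertex set set \<Rightarrow> (vertex \<Rightarrow> int) \<Rightarrow> vertex \<Rightarrow> int" where
  "lap E f v = (\<Sum>w\<in>nbrs E v. f v - f w)"

text \<open>A number of topplings at each vertex that leads to heights below the degrees, whether or not the
  topplings can be ordered legally, and even if some heights become negative.\<close>

definition stabilizing :: "vertex set set \<Rightarrow> vertex set \<Rightarrow> (vertex \<Rightarrow> nat) \<Rightarrow> (vertex \<Rightarrow> nat) \<Rightarrow> bool" where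
  "stabilizing E W \<sigma> u \<longleftrightarrow>
     {v. u v \<noteq> 0} \<subseteq> W \<and> finite {v. u v \<noteq> 0} \<and>
     (\<forall>v\<in>W. int (\<sigma> v) - lap E (\<lambda>w. int (u w)) v < int (deg E v))"

lemma deg_eq_card_nbrs: "deg E v = card (nbrs E v)"
  by (simp add: deg_def nbrs_def)

lemma nbrs_sym: "w \<in> nbrs E v \<longleftrightarrow> v \<in> nbrs E w"
  by (simp add: nbrs_def insert_commute)

lemma lap_add: "lap E (\<lambda>w. f w + g w) v = lap E f v + lap E g v"
  by (simp add: lap_def sum.distrib[symmetric] algebra_simps)

lemma lap_diff: "lap E (\<lambda>w. f w - g w) v = lap E f v - lap E g v"
  by (simp add: lap_def sum_subtractf[symmetric] algebra_simps)

lemma lap_scale: "lap E (\<lambda>w. c * f w) v = c * lap E f v"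
  by (simp add: lap_def sum_distrib_left algebra_simps)

lemma support_subset: "(\<And>v. v \<notin> W \<Longrightarrow> x v = (0 :: nat)) \<Longrightarrow> {v. x v \<noteq> 0} \<subseteq> W"
  by (rule subsetI, rule ccontr) simp

locale locally_finite_graph =
  fixes E :: "vertex set set"
  assumes no_loop: "{v} \<notin> E"
    and finite_nbrs: "finite (nbrs E v)"
begin

lemma lap_indicator:
  "lap E (\<lambda>x. of_bool (x = v)) w =
     (if w = v then int (deg E v) else if {v, w} \<in> E then -1 else 0)"
proof (cases "w = v")
  case True
  have "(\<Sum>x\<in>nbrs E v. (1::int) - of_bool (x = v)) = (\<Sum>x\<in>nbrs E v. 1)"
    using no_loop by (intro sum.cong) (auto simp: nbrs_def)
  then show ?thesis
    using True by (simp add: lap_def deg_eq_card_nbrs)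
next
  case False
  have "(\<Sum>x\<in>nbrs E w. - (of_bool (x = v) :: int)) = (\<Sum>x\<in>nbrs E w \<inter> {v}. -1)"
    using finite_nbrs by (intro sum.mono_neutral_cong_right) auto
  also have "\<dots> = (if {v, w} \<in> E then -1 else 0)"
    by (auto simp: nbrs_def insert_commute)
  finally show ?thesis
    using False by (simp add: lap_def)
qed

lemma topple_eq:
  assumes "deg E v \<le> \<sigma> v" "w \<in> W"
  shows "int (topple E W v \<sigma> w) = int (\<sigma> w) - lap E (\<lambda>x. of_bool (x = v)) w"
  using assms by (auto simp: topple_def lap_indicator)

text \<open>The heart of the least action principle: at an unstable vertex, every stabilizing vector
  has at least one toppling to offer, since without it the height there could only grow.\<close>

lemma stabilizing_step:
  assumes u: "stabilizing E W \<sigma> u" and v: "v \<in> W" "deg E v \<le> \<sigma> v"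
  shows "0 < u v \<and> stabilizing E W (topple E W v \<sigma>) (u(v := u v - 1))"
proof
  show pos: "0 < u v"
  proof (rule ccontr)
    assume "\<not> 0 < u v"
    then have "lap E (\<lambda>w. int (u w)) v \<le> 0"
      unfolding lap_def by (intro sum_nonpos) auto
    then show False
      using u v unfolding stabilizing_def by force
  qed
  let ?u' = "u(v := u v - 1)"
  have "(\<lambda>w. int (?u' w)) = (\<lambda>w. int (u w) - of_bool (w = v))"
    using pos by auto
  then have lap': "lap E (\<lambda>w. int (?u' w)) x =
      lap E (\<lambda>w. int (u w)) x - lap E (\<lambda>w. of_bool (w = v)) x" for x
    by (simp only: lap_diff)
  have "{w. ?u' w \<noteq> 0} \<subseteq> {w. u w \<noteq> 0}"
    by auto
  then show "stabilizing E W (topple E W v \<sigma>) ?u'"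
    using u v unfolding stabilizing_def lap'
    by (auto simp: topple_eq simp del: fun_upd_apply intro: finite_subset)
qed

text \<open>Legal topplings can always be charged to \<open>u\<close>, so there are at most as many of them as \<open>u\<close> has in
  total.\<close>

lemma least_action:
  assumes "stabilizing E W \<sigma> u"
  shows "stabilizes E W \<sigma>"
  using assms
proof (induction "sum u {v. u v \<noteq> 0}" arbitrary: \<sigma> u rule: less_induct)
  case less
  show ?case
  proof (cases "stable E W \<sigma>")
    case True
    then show ?thesis
      by (auto simp: stabilizes_def stabilizes_to_def)
  next
    case False
    then obtain v where v: "v \<in> W" "deg E v \<le> \<sigma> v"
      by (auto simp: stable_def not_less)
    let ?u' = "u(v := u v - 1)"
    note st = stabilizing_step[OF less.prems v]
    have fin: "finite {v. u v \<noteq> 0}"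
      using less.prems by (simp add: stabilizing_def)
    have "sum ?u' {w. ?u' w \<noteq> 0} \<le> sum ?u' {w. u w \<noteq> 0}"
      using fin by (intro sum_mono2) auto
    also have "\<dots> < sum u {w. u w \<noteq> 0}"
      using fin st by (intro sum_strict_mono_ex1 bexI[of _ v]) auto
    finally have "stabilizes E W (topple E W v \<sigma>)"
      using less.hyps st by blast
    moreover have "legal_step E W \<sigma> (topple E W v \<sigma>)"
      using v by (auto simp: legal_step_def)
    ultimately show ?thesis
      unfolding stabilizes_def stabilizes_to_def by (meson converse_rtranclp_into_rtranclp)
  qed
qed

text \<open>The odometer of a legal sequence of topplings lies below every stabilizing vector.  With the
  preceding lemma this makes the odometer of a stabilization the least stabilizing vector, which
  gives the uniqueness of the stabilization without any commutation argument.\<close>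

lemma legal_odometer:
  assumes "(legal_step E W)\<^sup>*\<^sup>* \<sigma> \<tau>"
  shows "\<exists>u. {v. u v \<noteq> 0} \<subseteq> W \<and> finite {v. u v \<noteq> 0} \<and>
           (\<forall>w\<in>W. int (\<tau> w) = int (\<sigma> w) - lap E (\<lambda>x. int (u x)) w) \<and>
           (\<forall>u'. stabilizing E W \<sigma> u' \<longrightarrow> u \<le> u')"
  using assms
proof (induction rule: converse_rtranclp_induct)
  case base
  then show ?case
    by (intro exI[of _ "\<lambda>_. 0"]) (auto simp: lap_def le_fun_def)
next
  case (step \<sigma> \<sigma>')
  from step.IH obtain u where u: "{v. u v \<noteq> 0} \<subseteq> W" "finite {v. u v \<noteq> 0}"
    "\<And>w. w \<in> W \<Longrightarrow> int (\<tau> w) = int (\<sigma>' w) - lap E (\<lambda>x. int (u x)) w"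
    "\<And>u'. stabilizing E W \<sigma>' u' \<Longrightarrow> u \<le> u'"
    by blast
  from step.hyps obtain v where v: "v \<in> W" "deg E v \<le> \<sigma> v" "\<sigma>' = topple E W v \<sigma>"
    by (auto simp: legal_step_def)
  let ?u = "u(v := u v + 1)"
  have "(\<lambda>w. int (?u w)) = (\<lambda>w. int (u w) + of_bool (w = v))"
    by auto
  then have lap': "lap E (\<lambda>w. int (?u w)) x =
      lap E (\<lambda>w. int (u w)) x + lap E (\<lambda>w. of_bool (w = v)) x" for x
    by (simp only: lap_add)
  have sub: "{w. ?u w \<noteq> 0} \<subseteq> insert v {w. u w \<noteq> 0}"
    by auto
  have "?u \<le> u'" if "stabilizing E W \<sigma> u'" for u'
    using u(4) stabilizing_step[OF that v(1,2)] v(3)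
    by (fastforce simp: le_fun_def split: if_splits)
  moreover have "finite {w. ?u w \<noteq> 0}"
    using u(2) by (intro finite_subset[OF sub]) auto
  moreover have "int (\<tau> w) = int (\<sigma> w) - lap E (\<lambda>x. int (?u x)) w" if "w \<in> W" for w
    using u(3)[OF that] topple_eq[of v \<sigma> w W, OF v(2) that] by (simp only: lap' v(3))
  moreover have "{w. ?u w \<noteq> 0} \<subseteq> W"
    using sub u(1) v(1) by blast
  ultimately show ?case
    by blast
qed

lemma legal_steps_extensional:
  assumes "(legal_step E W)\<^sup>*\<^sup>* \<sigma> \<tau>" "\<sigma> \<in> extensional W"
  shows "\<tau> \<in> extensional W"
  using assms by (induction) (auto simp: legal_step_def topple_def)

lemma stabilizes_iff: "stabilizes E W \<sigma> \<longleftrightarrow> (\<exists>u. stabilizing E W \<sigma> u)"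
proof
  assume "stabilizes E W \<sigma>"
  then obtain \<tau> where \<tau>: "(legal_step E W)\<^sup>*\<^sup>* \<sigma> \<tau>" "stable E W \<tau>"
    by (auto simp: stabilizes_def stabilizes_to_def)
  from legal_odometer[OF \<tau>(1)] \<tau>(2) show "\<exists>u. stabilizing E W \<sigma> u"
    unfolding stabilizing_def stable_def by (metis of_nat_less_iff)
qed (auto intro: least_action)

lemma stabilizes_to_unique:
  assumes "\<sigma> \<in> extensional W" "stabilizes_to E W \<sigma> \<tau>" "stabilizes_to E W \<sigma> \<tau>'"
  shows "\<tau> = \<tau>'"
proof -
  have *: "\<exists>u. stabilizing E W \<sigma> u \<and> (\<forall>u'. stabilizing E W \<sigma> u' \<longrightarrow> u \<le> u') \<and>
             (\<forall>w\<in>W. int (\<tau> w) = int (\<sigma> w) - lap E (\<lambda>x. int (u x)) w)"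
    if "stabilizes_to E W \<sigma> \<tau>" for \<tau>
  proof -
    from that have \<tau>: "(legal_step E W)\<^sup>*\<^sup>* \<sigma> \<tau>" "stable E W \<tau>"
      by (auto simp: stabilizes_to_def)
    from legal_odometer[OF \<tau>(1)] \<tau>(2) show ?thesis
      unfolding stabilizing_def stable_def by (metis of_nat_less_iff)
  qed
  have "\<tau> w = \<tau>' w" if "w \<in> W" for w
    using *[OF assms(2)] *[OF assms(3)] that
    by (metis (no_types, lifting) of_nat_eq_iff order_antisym)
  then show ?thesis
    using assms legal_steps_extensional
    by (intro extensionalityI[of _ W]) (auto simp: stabilizes_to_def)
qed

lemma stabilization_eq:
  assumes "\<sigma> \<in> extensional W" "stabilizes_to E W \<sigma> \<tau>"
  shows "stabilization E W \<sigma> = \<tau>"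
  unfolding stabilization_def
proof (rule the_equality)
  show "\<rho> = \<tau>" if "stabilizes_to E W \<sigma> \<rho>" for \<rho>
    using stabilizes_to_unique[OF assms(1) that assms(2)] .
qed fact

end

definition add_particles :: "vertex set \<Rightarrow> (vertex \<Rightarrow> nat) \<Rightarrow> (vertex \<Rightarrow> nat) \<Rightarrow> vertex \<Rightarrow> nat" where
  "add_particles W c \<sigma> = (\<lambda>w\<in>W. \<sigma> w + c w)"

lemma add_particles_extensional: "add_particles W c \<sigma> \<in> extensional W"
  by (simp add: add_particles_def)

lemma add_particle_eq: "add_particle W v = add_particles W (\<lambda>w. of_bool (w = v))"
  by (auto simp: add_particle_def add_particles_def fun_eq_iff restrict_def)

lemma add_particles_add: "add_particles W c (add_particles W d \<sigma>) = add_particles W (\<lambda>w. c w + d w) \<sigma>"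
  by (auto simp: add_particles_def fun_eq_iff restrict_def)

text \<open>Additional particles never make a legal toppling illegal.  This is what makes adding particles one
  at a time, with stabilization in between, the same as adding them all at once.\<close>

lemma legal_steps_add_particles:
  assumes "(legal_step E W)\<^sup>*\<^sup>* \<sigma> \<tau>"
  shows "(legal_step E W)\<^sup>*\<^sup>* (add_particles W c \<sigma>) (add_particles W c \<tau>)"
  using assms
proof induction
  case (step \<tau> \<rho>)
  then obtain v where v: "v \<in> W" "deg E v \<le> \<tau> v" "\<rho> = topple E W v \<tau>"
    by (auto simp: legal_step_def)
  then have "add_particles W c \<rho> = topple E W v (add_particles W c \<tau>)"
    by (auto simp: add_particles_def topple_def fun_eq_iff restrict_def)
  then have "legal_step E W (add_particles W c \<tau>) (add_particles W c \<rho>)"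
    unfolding legal_step_def using v by (intro bexI[of _ v]) (auto simp: add_particles_def)
  with step.IH show ?case
    by simp
qed simp

text \<open>Dhar's criterion: there is no forbidden subconfiguration, that is, no nonempty finite set \<open>F\<close> in
  which every vertex has fewer particles than neighbours in \<open>F\<close>.\<close>

definition allowed :: "vertex set set \<Rightarrow> vertex set \<Rightarrow> (vertex \<Rightarrow> nat) \<Rightarrow> bool" where
  "allowed E W \<sigma> \<longleftrightarrow>
     (\<forall>F. finite F \<and> F \<noteq> {} \<and> F \<subseteq> W \<longrightarrow> (\<exists>v\<in>F. card (nbrs E v \<inter> F) \<le> \<sigma> v))"

lemma allowed_mono:
  assumes "allowed E W \<sigma>" "\<And>v. v \<in> W \<Longrightarrow> \<sigma> v \<le> \<tau> v"
  shows "allowed E W \<tau>"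
  using assms unfolding allowed_def by (meson order_trans subsetD)

text \<open>If \<open>F\<close> is forbidden after a toppling at \<open>v\<close>, then \<open>F - {v}\<close> is forbidden before it: going back, a
  neighbour of \<open>v\<close> loses one particle, but also the neighbour \<open>v\<close> in the set.\<close>

lemma (in locally_finite_graph) allowed_topple:
  assumes al: "allowed E W \<sigma>" and v: "v \<in> W" "deg E v \<le> \<sigma> v"
  shows "allowed E W (topple E W v \<sigma>)"
  unfolding allowed_def
proof (intro allI impI)
  fix F assume F: "finite F \<and> F \<noteq> {} \<and> F \<subseteq> W"
  show "\<exists>w\<in>F. card (nbrs E w \<inter> F) \<le> topple E W v \<sigma> w"
  proof (cases "F = {v}")
    case True
    then show ?thesis
      using no_loop by (auto simp: nbrs_def)
  next
    case False
    then have "finite (F - {v}) \<and> F - {v} \<noteq> {} \<and> F - {v} \<subseteq> W"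
      using F by auto
    then obtain w where w: "w \<in> F - {v}" "card (nbrs E w \<inter> (F - {v})) \<le> \<sigma> w"
      using al unfolding allowed_def by blast
    have "nbrs E w \<inter> F \<subseteq> (nbrs E w \<inter> (F - {v})) \<union> (if {v, w} \<in> E then {v} else {})"
      by (auto simp: nbrs_def insert_commute)
    then have "card (nbrs E w \<inter> F) \<le> card ((nbrs E w \<inter> (F - {v})) \<union> (if {v, w} \<in> E then {v} else {}))"
      using F by (intro card_mono) auto
    also have "\<dots> \<le> card (nbrs E w \<inter> (F - {v})) + (if {v, w} \<in> E then 1 else 0)"
      using card_Un_le[of "nbrs E w \<inter> (F - {v})" "if {v, w} \<in> E then {v} else {}"] by (auto split: if_splits)
    also have "\<dots> \<le> topple E W v \<sigma> w"
      using w F by (auto simp: topple_def)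
    finally show ?thesis
      using w by auto
  qed
qed

lemma (in locally_finite_graph) allowed_legal_steps:
  assumes "(legal_step E W)\<^sup>*\<^sup>* \<sigma> \<tau>" "allowed E W \<sigma>"
  shows "allowed E W \<tau>"
  using assms by induction (auto simp: legal_step_def intro: allowed_topple)

text \<open>At a maximum each neighbour outside the set of maximizers contributes at least \<open>1\<close>, because the
  values are integers.  Applied to the set \<open>F\<close> of all maximizers, this is how a forbidden
  subconfiguration is found.\<close>

lemma (in locally_finite_graph) lap_ge_at_max:
  assumes "f v = M" "F \<subseteq> {w. f w = M}" "\<And>w. w \<in> nbrs E v \<Longrightarrow> w \<notin> F \<Longrightarrow> f w < M"
    "\<And>w. w \<in> nbrs E v \<Longrightarrow> f w \<le> M"
  shows "int (deg E v) - int (card (nbrs E v \<inter> F)) \<le> lap E f v"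
proof -
  have "int (deg E v) - int (card (nbrs E v \<inter> F)) = (\<Sum>w\<in>nbrs E v. 1 - of_bool (w \<in> F))"
    using finite_nbrs by (simp add: deg_eq_card_nbrs sum_subtractf Int_def)
  also have "\<dots> \<le> lap E f v"
    unfolding lap_def using assms by (intro sum_mono) force
  finally show ?thesis .
qed

text \<open>Vertices outside \<open>W\<close> act as sinks.  The rank \<open>r\<close> decreases along some path to the sink; it
  encodes that the sink can be reached from everywhere.\<close>

locale sink_graph = locally_finite_graph +
  fixes W :: "vertex set" and r :: "vertex \<Rightarrow> nat"
  assumes finite_W: "finite W"
    and descend: "v \<in> W \<Longrightarrow> \<exists>w\<in>nbrs E v. w \<in> W \<longrightarrow> r w < r v"
begin

text \<open>A steep concave function of the rank: \<open>x = K\<^sup>M - K\<^bsup>M - r'\<^esup>\<close>, where \<open>r'\<close> is the rank raised by one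
  on \<open>W\<close> and \<open>0\<close> elsewhere, so that \<open>x\<close> vanishes outside \<open>W\<close>.  A neighbour of lower rank contributes at
  least \<open>K - 1\<close> times as much to the Laplacian as any other neighbour can take away, so \<open>K\<close> larger than
  the degrees suffices.\<close>

lemma superharmonic_exists:
  "\<exists>x :: vertex \<Rightarrow> nat. (\<forall>v. v \<notin> W \<longrightarrow> x v = 0) \<and> (\<forall>v\<in>W. 1 \<le> lap E (\<lambda>w. int (x w)) v)"
proof -
  define K where "K = Suc (\<Sum>v\<in>W. deg E v)"
  define M where "M = Suc (\<Sum>v\<in>W. r v)"
  define r' where "r' v = (if v \<in> W then Suc (r v) else 0)" for v
  define x where "x v = K ^ M - K ^ (M - r' v)" for v
  have K: "deg E v < K" if "v \<in> W" for v
    unfolding K_def using member_le_sum[of v W "deg E"] that finite_W by auto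
  have M: "r' v \<le> M" for v
    unfolding M_def r'_def using member_le_sum[of v W r] finite_W by auto
  have K0: "0 < K"
    by (simp add: K_def)
  have x: "int (x v) = int K ^ M - int K ^ (M - r' v)" for v
    unfolding x_def using K0 by (subst of_nat_diff) (auto intro!: power_increasing)
  have "1 \<le> lap E (\<lambda>w. int (x w)) v" if v: "v \<in> W" for v
  proof -
    obtain w0 where w0: "w0 \<in> nbrs E v" "r' w0 < r' v"
      using descend[OF v] v by (auto simp: r'_def split: if_splits)
    let ?k = "int K ^ (M - r' v)"
    have "1 \<le> ?k"
      using K0 by simp
    also have "?k = int K * ?k - (int K - 1) * ?k"
      by (simp add: algebra_simps)
    also have "\<dots> \<le> int K * ?k - int (deg E v) * ?k"
      using K[OF v] by (intro diff_left_mono mult_right_mono) auto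
    also have "int K * ?k = int K ^ (Suc (M - r' v))"
      by simp
    also have "\<dots> \<le> int K ^ (M - r' w0)"
      using w0 M[of v] K0 by (intro power_increasing) auto
    also have "\<dots> \<le> (\<Sum>w\<in>nbrs E v. int K ^ (M - r' w))"
      using w0 finite_nbrs by (intro member_le_sum) auto
    also have "(\<Sum>w\<in>nbrs E v. int K ^ (M - r' w)) - int (deg E v) * ?k = lap E (\<lambda>w. int (x w)) v"
      by (simp add: lap_def x sum_subtractf deg_eq_card_nbrs)
    finally show ?thesis
      by simp
  qed
  moreover have "x v = 0" if "v \<notin> W" for v
    using that by (simp add: x_def r'_def)
  ultimately show ?thesis
    by blast
qed

lemma scaled_superharmonic:
  obtains x :: "vertex \<Rightarrow> nat" where "\<And>v. v \<notin> W \<Longrightarrow> x v = 0"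
    "\<And>v. v \<in> W \<Longrightarrow> int B \<le> lap E (\<lambda>w. int (x w)) v"
proof -
  obtain x where x: "\<And>v. v \<notin> W \<Longrightarrow> x v = 0" "\<And>v. v \<in> W \<Longrightarrow> 1 \<le> lap E (\<lambda>w. int (x w)) v"
    using superharmonic_exists by blast
  have "int B \<le> lap E (\<lambda>w. int (B * x w)) v" if "v \<in> W" for v
    using x(2)[OF that] mult_left_mono[of 1 "lap E (\<lambda>w. int (x w)) v" "int B"] by (simp add: lap_scale)
  then show thesis
    using that[of "\<lambda>v. B * x v"] x(1) by simp
qed

lemma stabilizes_finite: "stabilizes E W \<sigma>"
proof -
  obtain x where x: "\<And>v. v \<notin> W \<Longrightarrow> x v = 0"
    "\<And>v. v \<in> W \<Longrightarrow> int (Suc (sum \<sigma> W)) \<le> lap E (\<lambda>w. int (x w)) v"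
    using scaled_superharmonic[of "Suc (sum \<sigma> W)"] by blast
  have "{v. x v \<noteq> 0} \<subseteq> W"
    using x(1) by (rule support_subset)
  moreover from this have "finite {v. x v \<noteq> 0}"
    by (rule finite_subset) (rule finite_W)
  moreover have "int (\<sigma> v) - lap E (\<lambda>w. int (x w)) v < int (deg E v)" if "v \<in> W" for v
  proof -
    have "\<sigma> v \<le> sum \<sigma> W"
      using finite_W that by (intro member_le_sum) auto
    then have "int (\<sigma> v) < int (Suc (sum \<sigma> W))"
      by linarith
    with x(2)[OF that] show ?thesis
      by linarith
  qed
  ultimately have "stabilizing E W \<sigma> x"
    unfolding stabilizing_def by blast
  then show ?thesis
    by (rule least_action)
qed

lemma stabilizes_to_stabilization:
  assumes "\<sigma> \<in> extensional W"
  shows "stabilizes_to E W \<sigma> (stabilization E W \<sigma>)"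
  using stabilizes_finite[of \<sigma>] stabilization_eq[OF assms] unfolding stabilizes_def by auto

text \<open>A generalization of the burning test from one firing of the sink to an arbitrary \<open>x\<close> with
  nonnegative Laplacian.  The vector \<open>x\<close> stabilizes \<open>\<sigma> + \<Delta>x\<close> to \<open>\<sigma>\<close>, so the odometer \<open>u\<close> is at most
  \<open>x\<close>; if \<open>x - u\<close> were not \<open>0\<close>, the set where it is maximal would be a forbidden subconfiguration of
  \<open>\<sigma>\<close>.\<close>

lemma burning:
  assumes \<sigma>: "\<sigma> \<in> extensional W" "stable E W \<sigma>" "allowed E W \<sigma>"
    and \<tau>: "\<tau> \<in> extensional W" "\<And>v. v \<in> W \<Longrightarrow> int (\<tau> v) = int (\<sigma> v) + lap E (\<lambda>w. int (x w)) v"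
    and x: "\<And>v. v \<notin> W \<Longrightarrow> x v = 0"
  shows "stabilizes_to E W \<tau> \<sigma>"
proof -
  define \<rho> where "\<rho> = stabilization E W \<tau>"
  have \<rho>: "(legal_step E W)\<^sup>*\<^sup>* \<tau> \<rho>" "stable E W \<rho>"
    using stabilizes_to_stabilization[OF \<tau>(1)] by (auto simp: \<rho>_def stabilizes_to_def)
  have supp: "{v. x v \<noteq> 0} \<subseteq> W"
    using x by (rule support_subset)
  have "stabilizing E W \<tau> x"
    using \<sigma>(2) \<tau>(2) finite_subset[OF supp finite_W] supp by (auto simp: stabilizing_def stable_def)
  then obtain u where u: "u \<le> x" "\<And>w. w \<in> W \<Longrightarrow> int (\<rho> w) = int (\<tau> w) - lap E (\<lambda>x. int (u x)) w"
    using legal_odometer[OF \<rho>(1)] by blast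
  define z where "z v = int (x v) - int (u v)" for v
  have ux: "u v \<le> x v" for v
    using u(1) by (rule le_funD)
  then have z0: "0 \<le> z v" for v
    by (simp add: z_def)
  have zout: "z v = 0" if "v \<notin> W" for v
    using x[OF that] ux[of v] by (simp add: z_def)
  have \<rho>z: "int (\<rho> v) = int (\<sigma> v) + lap E z v" if "v \<in> W" for v
  proof -
    have "lap E z v = lap E (\<lambda>w. int (x w)) v - lap E (\<lambda>w. int (u w)) v"
      unfolding z_def by (rule lap_diff)
    then show ?thesis
      using that u(2) \<tau>(2) by simp
  qed
  have "z v = 0" for v
  proof (rule ccontr)
    assume "z v \<noteq> 0"
    define M where "M = Max (z ` W)"
    define F where "F = {w \<in> W. z w = M}"
    have vW: "v \<in> W"
      using zout[of v] \<open>z v \<noteq> 0\<close> by blast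
    have "M \<in> z ` W"
      unfolding M_def using finite_W vW by (intro Max_in) auto
    have le: "z w \<le> M" if "w \<in> W" for w
      unfolding M_def using that finite_W by auto
    have "0 < M"
      using le[OF vW] z0[of v] \<open>z v \<noteq> 0\<close> by simp
    then have le': "z w \<le> M" for w
      using le zout by (cases "w \<in> W") auto
    have "finite F \<and> F \<noteq> {} \<and> F \<subseteq> W"
      using \<open>M \<in> z ` W\<close> finite_W by (auto simp: F_def)
    then obtain w where w: "w \<in> F" "card (nbrs E w \<inter> F) \<le> \<sigma> w"
      using \<sigma>(3) unfolding allowed_def by blast
    have "z y < M" if "y \<notin> F" for y
    proof (cases "y \<in> W")
      case True
      then show ?thesis using le[of y] that by (auto simp: F_def)
    next
      case False
      then show ?thesis using zout \<open>0 < M\<close> by simp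
    qed
    then have "int (deg E w) - int (card (nbrs E w \<inter> F)) \<le> lap E z w"
      using w le' by (intro lap_ge_at_max[where M = M]) (auto simp: F_def)
    then have "int (deg E w) \<le> int (\<rho> w)"
      using w \<rho>z[of w] by (simp add: F_def)
    then show False
      using w \<rho>(2) by (auto simp: F_def stable_def)
  qed
  then have "\<rho> w = \<sigma> w" if "w \<in> W" for w
    using \<rho>z[OF that] by (simp add: lap_def)
  then have "\<rho> = \<sigma>"
    using legal_steps_extensional[OF \<rho>(1) \<tau>(1)] \<sigma>(1) by (intro extensionalityI[of _ W]) auto
  then show ?thesis
    using \<rho> by (simp add: stabilizes_to_def)
qed

end

section \<open>Recurrence for the sandpile chain of a graph with sink\<close>

text \<open>If a word does not occur, then it is not a prefix and does not occur in the remainder, which is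
  independent of the prefix and has the original law.  So the probability \<open>b\<close> that it never
  occurs satisfies \<open>b \<le> (1 - a) b\<close>, where \<open>a > 0\<close> is the probability of the word as a prefix.\<close>

lemma word_occurs_AE:
  fixes p :: "'a pmf" and xs :: "'a list"
  assumes xs: "set xs \<subseteq> set_pmf p"
  shows "AE Y in PiM UNIV (\<lambda>_::nat. measure_pmf p). \<exists>i. \<forall>j<length xs. Y (i + j) = xs ! j"
proof -
  define M where "M = PiM UNIV (\<lambda>_::nat. measure_pmf p)"
  interpret sequence_space "measure_pmf p"
    by unfold_locales
  interpret MP: pair_prob_space M M
    unfolding M_def by unfold_locales
  have sp: "space M = UNIV"
    by (simp add: M_def space_PiM)
  have eq_sets: "{Y. Y i = c} \<in> sets M" for i c
  proof -
    have "(\<lambda>Y. Y i) -` {c} \<inter> space M \<in> sets M"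
      unfolding M_def by (rule measurable_sets[OF measurable_component_singleton]) auto
    then show ?thesis
      by (simp add: sp vimage_def)
  qed
  have pred: "Measurable.pred M (\<lambda>Y. Y i = c)" for i c
    using eq_sets[of i c] by (simp add: pred_def sp)
  let ?l = "length xs"
  define A where "A = {Y \<in> space M. \<forall>j\<in>{..<?l}. Y j \<in> {xs ! j}}"
  define B where "B = {Y. \<forall>i. \<not> (\<forall>j\<in>{..<?l}. Y (i + j) = xs ! j)}"
  have A: "A \<in> sets M"
    unfolding A_def using pred by (auto intro!: pred_intros_finite simp: pred_def)
  have "Measurable.pred M (\<lambda>Y. \<forall>i. \<not> (\<forall>j\<in>{..<?l}. Y (i + j) = xs ! j))"
    by (intro pred_intros_countable pred_intros_logic pred_intros_finite pred) simp
  then have B: "B \<in> sets M"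
    by (simp add: pred_def sp B_def)
  have "emeasure M A = (\<Prod>j\<in>{..<?l}. emeasure (measure_pmf p) {xs ! j})"
    unfolding A_def M_def by (rule emeasure_PiM_Collect) auto
  also have "\<dots> = ennreal (\<Prod>j\<in>{..<?l}. pmf p (xs ! j))"
    by (simp add: emeasure_pmf_single prod_ennreal)
  finally have "measure M A = (\<Prod>j\<in>{..<?l}. pmf p (xs ! j))"
    by (simp add: measure_def prod_nonneg)
  also have "\<dots> > 0"
    using xs by (intro prod_pos) (auto simp: pmf_positive_iff)
  finally have A_pos: "0 < measure M A" .
  have M_eq: "M = distr (M \<Otimes>\<^sub>M M) M (\<lambda>(x, y). comb_seq ?l x y)"
    unfolding M_def by (rule PiM_comb_seq[symmetric])
  have meas: "(\<lambda>(x, y). comb_seq ?l x y) \<in> M \<Otimes>\<^sub>M M \<rightarrow>\<^sub>M M"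
    unfolding M_def by (rule measurable_comb_seq)
  have "measure M B = measure (distr (M \<Otimes>\<^sub>M M) M (\<lambda>(x, y). comb_seq ?l x y)) B"
    using M_eq by simp
  also have "\<dots> = measure (M \<Otimes>\<^sub>M M) ((\<lambda>(x, y). comb_seq ?l x y) -` B \<inter> space (M \<Otimes>\<^sub>M M))"
    using B meas by (intro measure_distr) auto
  also have "\<dots> \<le> measure (M \<Otimes>\<^sub>M M) ((space M - A) \<times> B)"
  proof (rule MP.finite_measure_mono)
    show "(\<lambda>(x, y). comb_seq ?l x y) -` B \<inter> space (M \<Otimes>\<^sub>M M) \<subseteq> (space M - A) \<times> B"
    proof clarify
      fix x y
      assume xy: "comb_seq ?l x y \<in> B"
      then have no: "\<exists>j<?l. comb_seq ?l x y (i + j) \<noteq> xs ! j" for i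
        by (auto simp: B_def)
      have "x \<notin> A"
        using no[of 0] by (auto simp: A_def comb_seq_less)
      moreover have "y \<in> B"
      proof -
        have "comb_seq ?l x y (i + ?l + j) = y (i + j)" for i j
          using comb_seq_add[of ?l x y "i + j"] by (simp add: ac_simps)
        then show ?thesis
          using no[of "_ + ?l"] by (auto simp: B_def Bex_def)
      qed
      ultimately show "x \<in> space M - A \<and> y \<in> B"
        by (simp add: sp)
    qed
  qed (intro pair_measureI sets.Diff sets.top A B)
  also have "\<dots> = measure M (space M - A) * measure M B"
    unfolding measure_def using A B
    by (subst MP.M1.emeasure_pair_measure_Times) (auto simp: enn2real_mult)
  also have "measure M (space M - A) = 1 - measure M A"
    using A by (rule MP.M1.prob_compl)
  finally have "measure M A * measure M B \<le> 0"
    by (simp add: algebra_simps)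
  then have "measure M B = 0"
    using A_pos by (simp add: mult_le_0_iff measure_le_0_iff)
  then have "emeasure M B = 0"
    by (simp add: MP.M1.emeasure_eq_measure)
  then have "AE Y in M. Y \<notin> B"
    using B by (intro AE_not_in null_setsI)
  then show ?thesis
    unfolding M_def B_def by (simp add: Ball_def)
qed

lemma prefix_not_null:
  fixes p :: "'a pmf" and xs :: "'a list"
  assumes xs: "set xs \<subseteq> set_pmf p"
  shows "\<not> (AE Y in PiM UNIV (\<lambda>_::nat. measure_pmf p). map Y [0..<length xs] \<noteq> xs)"
proof
  assume AE: "AE Y in PiM UNIV (\<lambda>_::nat. measure_pmf p). map Y [0..<length xs] \<noteq> xs"
  define M where "M = PiM UNIV (\<lambda>_::nat. measure_pmf p)"
  interpret sequence_space "measure_pmf p"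
    by unfold_locales
  let ?l = "length xs"
  define A where "A = {Y \<in> space M. \<forall>j\<in>{..<?l}. Y j \<in> {xs ! j}}"
  have "emeasure M A = (\<Prod>j\<in>{..<?l}. emeasure (measure_pmf p) {xs ! j})"
    unfolding A_def M_def by (rule emeasure_PiM_Collect) auto
  also have "\<dots> = ennreal (\<Prod>j\<in>{..<?l}. pmf p (xs ! j))"
    by (simp add: emeasure_pmf_single prod_ennreal)
  also have "\<dots> \<noteq> 0"
  proof -
    have "0 < (\<Prod>j\<in>{..<?l}. pmf p (xs ! j))"
      using xs by (intro prod_pos) (auto simp: pmf_positive_iff)
    then show ?thesis
      by (simp add: ennreal_eq_0_iff not_le)
  qed
  finally have "emeasure M A \<noteq> 0" .
  moreover have "A = {Y \<in> space M. \<not> map Y [0..<?l] \<noteq> xs}"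
  proof -
    have "map Y [0..<?l] = xs \<longleftrightarrow> (\<forall>j\<in>{..<?l}. Y j \<in> {xs ! j})" for Y
      using list_eq_iff_nth_eq[of "map Y [0..<?l]" xs] by auto
    then show ?thesis
      unfolding A_def by simp
  qed
  moreover obtain N where "N \<in> null_sets M" "{Y \<in> space M. \<not> map Y [0..<?l] \<noteq> xs} \<subseteq> N"
    using AE unfolding M_def[symmetric] eventually_ae_filter by (elim bexE)
  ultimately show False
    using emeasure_mono[of A N M] by (simp add: null_sets_def)
qed

definition drive :: "vertex set set \<Rightarrow> vertex set \<Rightarrow> (vertex \<Rightarrow> nat) \<Rightarrow> vertex list \<Rightarrow> vertex \<Rightarrow> nat" where
  "drive E W = foldl (\<lambda>\<sigma> v. stabilization E W (add_particle W v \<sigma>))"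

lemma drive_Nil [simp]: "drive E W \<sigma> [] = \<sigma>"
  by (simp add: drive_def)

lemma drive_append: "drive E W \<sigma> (xs @ ys) = drive E W (drive E W \<sigma> xs) ys"
  by (simp add: drive_def)

lemma sandpile_chain_eq_drive:
  "sandpile_chain n \<sigma> Y k = drive (vicsek_edges n) (vicsek_nonsink n) \<sigma> (map Y [0..<k])"
  by (induction k) (simp_all add: drive_def)

lemma word_with_counts:
  fixes c :: "'a \<Rightarrow> nat"
  assumes "finite W" "\<And>v. v \<notin> W \<Longrightarrow> c v = 0"
  shows "\<exists>xs. set xs \<subseteq> W \<and> count_list xs = c"
proof -
  have fin: "finite {v. 0 < c v}"
    using support_subset[of W c] assms by (intro finite_subset[OF _ assms(1)]) auto
  obtain xs where xs: "mset xs = Abs_multiset c"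
    using ex_mset by blast
  then have "count_list xs v = c v" for v
    using fin by (simp add: count_mset[symmetric])
  moreover from this have "set xs \<subseteq> W"
    using assms(2) by (metis count_list_0_iff subsetI)
  ultimately show ?thesis
    by blast
qed

context sink_graph
begin

definition states :: "(vertex \<Rightarrow> nat) set" where
  "states = {\<sigma> \<in> extensional W. stable E W \<sigma>}"

lemma finite_states: "finite states"
proof -
  have "states \<subseteq> PiE W (\<lambda>v. {..<deg E v})"
    by (auto simp: states_def stable_def PiE_def Pi_def)
  then show ?thesis
    by (rule finite_subset) (simp add: finite_PiE finite_W)
qed

lemma drive_stabilizes:
  assumes "\<sigma> \<in> states"
  shows "stabilizes_to E W (add_particles W (count_list xs) \<sigma>) (drive E W \<sigma> xs)"
proof (induction xs rule: rev_induct)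
  case Nil
  have "add_particles W (\<lambda>w. 0) \<sigma> = \<sigma>"
    using assms by (simp add: add_particles_def states_def extensional_restrict)
  then show ?case
    using assms by (simp add: stabilizes_to_def states_def)
next
  case (snoc v xs)
  let ?\<rho> = "add_particle W v (drive E W \<sigma> xs)"
  have "(legal_step E W)\<^sup>*\<^sup>* (add_particle W v (add_particles W (count_list xs) \<sigma>)) ?\<rho>"
    using snoc unfolding add_particle_eq
    by (intro legal_steps_add_particles) (simp add: stabilizes_to_def)
  moreover have "add_particle W v (add_particles W (count_list xs) \<sigma>) = add_particles W (count_list (xs @ [v])) \<sigma>"
    by (auto simp: add_particle_eq add_particles_add intro!: arg_cong[of _ _ "\<lambda>c. add_particles W c \<sigma>"])
  moreover have "stabilizes_to E W ?\<rho> (stabilization E W ?\<rho>)"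
    by (intro stabilizes_to_stabilization) (simp add: add_particle_eq add_particles_extensional)
  moreover have "drive E W \<sigma> (xs @ [v]) = stabilization E W ?\<rho>"
    by (simp add: drive_def)
  ultimately show ?case
    unfolding stabilizes_to_def by (metis rtranclp_trans)
qed

lemma drive_states: "\<sigma> \<in> states \<Longrightarrow> drive E W \<sigma> xs \<in> states"
  using drive_stabilizes[of \<sigma> xs] legal_steps_extensional add_particles_extensional
  by (fastforce simp: states_def stabilizes_to_def)

lemma drive_allowed:
  assumes "\<sigma> \<in> states" "allowed E W \<sigma>"
  shows "allowed E W (drive E W \<sigma> xs)"
proof -
  have "allowed E W (add_particles W (count_list xs) \<sigma>)"
    using assms(2) by (rule allowed_mono) (simp add: add_particles_def)
  then show ?thesis
    using drive_stabilizes[OF assms(1), of xs] allowed_legal_steps by (auto simp: stabilizes_to_def)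
qed

text \<open>Choose \<open>x\<close> with Laplacian so large that \<open>\<sigma> + \<Delta>x \<ge> \<tau>\<close>.  Adding the difference to \<open>\<tau>\<close> gives
  \<open>\<sigma> + \<Delta>x\<close>, which stabilizes to \<open>\<sigma>\<close> by the burning lemma.\<close>

lemma drive_reaches_allowed:
  assumes \<tau>: "\<tau> \<in> states" and \<sigma>: "\<sigma> \<in> states" "allowed E W \<sigma>"
  obtains xs where "set xs \<subseteq> W" "drive E W \<tau> xs = \<sigma>"
proof -
  obtain x where x: "\<And>v. v \<notin> W \<Longrightarrow> x v = 0"
    "\<And>v. v \<in> W \<Longrightarrow> int (sum \<tau> W) \<le> lap E (\<lambda>w. int (x w)) v"
    using scaled_superharmonic[of "sum \<tau> W"] by blast
  define c where "c v = (if v \<in> W then nat (int (\<sigma> v) + lap E (\<lambda>w. int (x w)) v - int (\<tau> v)) else 0)" for v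
  obtain xs where xs: "set xs \<subseteq> W" "count_list xs = c"
    using word_with_counts[OF finite_W, of c] by (auto simp: c_def)
  have "stabilizes_to E W (add_particles W c \<tau>) \<sigma>"
  proof (rule burning)
    fix v assume v: "v \<in> W"
    have "\<tau> v \<le> sum \<tau> W"
      using finite_W v by (intro member_le_sum) auto
    with x(2)[OF v] have "int (\<tau> v) \<le> lap E (\<lambda>w. int (x w)) v"
      by linarith
    then show "int (add_particles W c \<tau> v) = int (\<sigma> v) + lap E (\<lambda>w. int (x w)) v"
      using v by (simp add: add_particles_def c_def)
  qed (use \<sigma> x in \<open>auto simp: states_def add_particles_extensional\<close>)
  then have "drive E W \<tau> xs = \<sigma>"
    using drive_stabilizes[OF \<tau>, of xs] xs(2) stabilizes_to_unique add_particles_extensional by blast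
  with xs(1) show thesis
    using that by blast
qed

lemma deg_pos: "v \<in> W \<Longrightarrow> 0 < deg E v"
  using descend[of v] finite_nbrs[of v] by (auto simp: deg_eq_card_nbrs card_gt_0_iff)

lemma max_stable_allowed:
  "(\<lambda>v\<in>W. deg E v - 1) \<in> states" "allowed E W (\<lambda>v\<in>W. deg E v - 1)"
proof -
  show "(\<lambda>v\<in>W. deg E v - 1) \<in> states"
    using deg_pos by (auto simp: states_def stable_def)
  show "allowed E W (\<lambda>v\<in>W. deg E v - 1)"
    unfolding allowed_def
  proof (intro allI impI)
    fix F assume F: "finite F \<and> F \<noteq> {} \<and> F \<subseteq> W"
    define v where "v = arg_min_on r F"
    have v: "v \<in> F" "\<And>w. w \<in> F \<Longrightarrow> r v \<le> r w"
      using F arg_min_if_finite(1)[of F r] arg_min_least[of F _ r] by (auto simp: v_def)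
    then obtain w where w: "w \<in> nbrs E v" "w \<in> W \<longrightarrow> r w < r v"
      using descend[of v] F by blast
    then have "w \<notin> F"
      using v F by (meson leD subsetD)
    then have "nbrs E v \<inter> F \<subset> nbrs E v"
      using w by auto
    then have "card (nbrs E v \<inter> F) < deg E v"
      unfolding deg_eq_card_nbrs using finite_nbrs by (intro psubset_card_mono)
    then show "\<exists>v\<in>F. card (nbrs E v \<inter> F) \<le> (\<lambda>v\<in>W. deg E v - 1) v"
      using v(1) F by (intro bexI[of _ v]) auto
  qed
qed

text \<open>One word that visits \<open>\<sigma>\<close> from every starting state: treat the finitely many states in turn and
  append, for each of them, a word that leads from where it has got by then to \<open>\<sigma>\<close>.\<close>

lemma universal_word:
  assumes \<sigma>: "\<sigma> \<in> states" "allowed E W \<sigma>"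
  obtains xs where "set xs \<subseteq> W"
    "\<And>\<tau>. \<tau> \<in> states \<Longrightarrow> \<exists>k\<le>length xs. drive E W \<tau> (take k xs) = \<sigma>"
proof -
  have "\<exists>xs. set xs \<subseteq> W \<and> (\<forall>\<tau>\<in>S. \<exists>k\<le>length xs. drive E W \<tau> (take k xs) = \<sigma>)"
    if "finite S" "S \<subseteq> states" for S
    using that
  proof (induction S)
    case empty
    then show ?case by (intro exI[of _ "[]"]) auto
  next
    case (insert \<tau> S)
    then obtain xs where xs: "set xs \<subseteq> W" "\<And>\<tau>. \<tau> \<in> S \<Longrightarrow> \<exists>k\<le>length xs. drive E W \<tau> (take k xs) = \<sigma>"
      by auto
    obtain ys where ys: "set ys \<subseteq> W" "drive E W (drive E W \<tau> xs) ys = \<sigma>"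
      using drive_reaches_allowed[OF drive_states \<sigma>] insert.prems by blast
    have "\<exists>k\<le>length (xs @ ys). drive E W \<rho> (take k (xs @ ys)) = \<sigma>" if "\<rho> \<in> insert \<tau> S" for \<rho>
    proof (cases "\<rho> \<in> S")
      case True
      then obtain k where "k \<le> length xs" "drive E W \<rho> (take k xs) = \<sigma>"
        using xs(2) by blast
      then show ?thesis by (intro exI[of _ k]) simp
    next
      case False
      then show ?thesis
        using that ys(2) by (intro exI[of _ "length (xs @ ys)"]) (simp add: drive_append)
    qed
    then show ?case
      using xs(1) ys(1) by (intro exI[of _ "xs @ ys"]) auto
  qed
  from this[OF finite_states order_refl] that show thesis
    by blast
qed

text \<open>An allowed \<open>\<sigma>\<close> is visited whenever its universal word occurs in the driving sequence, hence
  almost surely.  Conversely, allowed sandpiles can be reached from everywhere and never left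
  again, so from a sandpile that is not allowed there is a positive probability of no return.\<close>

theorem recurrent_iff_allowed:
  assumes \<sigma>: "\<sigma> \<in> states" and ne: "W \<noteq> {}"
  shows "(AE Y in PiM UNIV (\<lambda>_::nat. measure_pmf (pmf_of_set W)).
            \<exists>k\<ge>1. drive E W \<sigma> (map Y [0..<k]) = \<sigma>) \<longleftrightarrow> allowed E W \<sigma>"
proof
  assume al: "allowed E W \<sigma>"
  obtain xs where xs: "set xs \<subseteq> W"
    "\<And>\<tau>. \<tau> \<in> states \<Longrightarrow> \<exists>k\<le>length xs. drive E W \<tau> (take k xs) = \<sigma>"
    using universal_word[OF \<sigma> al] by blast
  obtain v where v: "v \<in> W"
    using ne by blast
  \<comment> \<open>The extra letter \<open>v\<close> makes the time of the visit positive.\<close>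
  have "AE Y in PiM UNIV (\<lambda>_::nat. measure_pmf (pmf_of_set W)).
          \<exists>i. \<forall>j<length (v # xs). Y (i + j) = (v # xs) ! j"
    using xs(1) v ne finite_W by (intro word_occurs_AE) auto
  then show "AE Y in PiM UNIV (\<lambda>_::nat. measure_pmf (pmf_of_set W)).
          \<exists>k\<ge>1. drive E W \<sigma> (map Y [0..<k]) = \<sigma>"
  proof (rule eventually_mono)
    fix Y assume "\<exists>i. \<forall>j<length (v # xs). Y (i + j) = (v # xs) ! j"
    then obtain i where i: "\<And>j. j < length (v # xs) \<Longrightarrow> Y (i + j) = (v # xs) ! j"
      by blast
    let ?\<tau> = "drive E W \<sigma> (map Y [0..<Suc i])"
    obtain k where k: "k \<le> length xs" "drive E W ?\<tau> (take k xs) = \<sigma>"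
      using xs(2)[OF drive_states[OF \<sigma>]] by blast
    have "map Y [Suc i..<Suc i + k] = take k xs"
      using k(1) i[of "Suc _"] by (auto simp: list_eq_iff_nth_eq simp del: upt_Suc)
    moreover have "map Y [0..<Suc i + k] = map Y [0..<Suc i] @ map Y [Suc i..<Suc i + k]"
      using upt_add_eq_append[of 0 "Suc i" k] by (simp del: upt_Suc)
    ultimately have "drive E W \<sigma> (map Y [0..<Suc i + k]) = \<sigma>"
      using k(2) by (simp only: drive_append)
    then show "\<exists>k\<ge>1. drive E W \<sigma> (map Y [0..<k]) = \<sigma>"
      by (intro exI[of _ "Suc i + k"]) auto
  qed
next
  assume AE: "AE Y in PiM UNIV (\<lambda>_::nat. measure_pmf (pmf_of_set W)).
                \<exists>k\<ge>1. drive E W \<sigma> (map Y [0..<k]) = \<sigma>"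
  show "allowed E W \<sigma>"
  proof (rule ccontr)
    assume not_al: "\<not> allowed E W \<sigma>"
    let ?P = "\<lambda>xs. set xs \<subseteq> W \<and> allowed E W (drive E W \<sigma> xs)"
    have "\<exists>xs. ?P xs"
      using drive_reaches_allowed[OF \<sigma> max_stable_allowed] max_stable_allowed(2) by metis
    \<comment> \<open>A shortest word into the allowed sandpiles cannot pass through \<open>\<sigma>\<close> again.\<close>
    then obtain xs where xs: "?P xs" and min: "\<And>ys. ?P ys \<Longrightarrow> length xs \<le> length ys"
      using ex_has_least_nat[of ?P _ length] by blast
    have no_return: "drive E W \<sigma> (take k xs) \<noteq> \<sigma>" if "1 \<le> k" "k \<le> length xs" for k
    proof
      assume "drive E W \<sigma> (take k xs) = \<sigma>"
      then have "drive E W \<sigma> (drop k xs) = drive E W \<sigma> xs"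
        by (metis append_take_drop_id drive_append)
      then have "?P (drop k xs)"
        using xs by (auto dest: in_set_dropD)
      from min[OF this] that show False
        by auto
    qed
    have "set xs \<subseteq> set_pmf (pmf_of_set W)"
      using xs ne finite_W by auto
    moreover have "AE Y in PiM UNIV (\<lambda>_::nat. measure_pmf (pmf_of_set W)). map Y [0..<length xs] \<noteq> xs"
      using AE
    proof (rule eventually_mono)
      fix Y assume "\<exists>k\<ge>1. drive E W \<sigma> (map Y [0..<k]) = \<sigma>"
      then obtain k where k: "1 \<le> k" "drive E W \<sigma> (map Y [0..<k]) = \<sigma>"
        by blast
      show "map Y [0..<length xs] \<noteq> xs"
      proof
        assume eq: "map Y [0..<length xs] = xs"
        show False
        proof (cases "k \<le> length xs")
          case True
          then have "map Y [0..<k] = take k xs"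
            by (subst eq[symmetric]) (simp add: take_map)
          then show False
            using no_return[OF k(1) True] k(2) by simp
        next
          case False
          then have "map Y [0..<k] = xs @ map Y [length xs..<k]"
            using upt_add_eq_append[of 0 "length xs" "k - length xs"] eq by simp
          then have "allowed E W \<sigma>"
            using k(2) xs drive_allowed[OF drive_states[OF \<sigma>]] by (metis drive_append)
          then show False
            using not_al by blast
        qed
      qed
    qed
    ultimately show False
      using prefix_not_null by blast
  qed
qed

end

section \<open>Geometry of the Vicsek graphs\<close>

declare vicsek_verts.simps(2) [simp del] vicsek_edges.simps(2) [simp del]

lemma vicsek_shifts_Suc:
  "vicsek_shifts (Suc n) =
     {(0, 0), (3 ^ n, 3 ^ n), (2 * 3 ^ n, 0), (0, 2 * 3 ^ n), (2 * 3 ^ n, 2 * 3 ^ n)}"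
  by (simp add: vicsek_shifts_def Let_def)

lemma vicsek_verts_le: "(x, y) \<in> vicsek_verts n \<Longrightarrow> x \<le> 3 ^ n \<and> y \<le> 3 ^ n"
proof (induction n arbitrary: x y)
  case (Suc n)
  then show ?case
    by (fastforce simp: vicsek_shifts_Suc vicsek_verts.simps(2))
qed auto

lemma vicsek_verts_SucI: "a \<in> vicsek_shifts (Suc n) \<Longrightarrow> v \<in> vicsek_verts n \<Longrightarrow> a + v \<in> vicsek_verts (Suc n)"
  by (auto simp: vicsek_verts.simps(2))

lemma vicsek_verts_SucE:
  assumes "v \<in> vicsek_verts (Suc n)"
  obtains a v' where "a \<in> vicsek_shifts (Suc n)" "v' \<in> vicsek_verts n" "v = a + v'"
  using assms by (auto simp: vicsek_verts.simps(2))

lemma vicsek_corners: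
  "(0, 0) \<in> vicsek_verts n" "(3 ^ n, 0) \<in> vicsek_verts n"
  "(0, 3 ^ n) \<in> vicsek_verts n" "(3 ^ n, 3 ^ n) \<in> vicsek_verts n"
proof (induction n)
  case (Suc n)
  {
    case 1
    show ?case using vicsek_verts_SucI[of "(0, 0)" n "(0, 0)"] Suc by (simp add: vicsek_shifts_Suc)
  next
    case 2
    show ?case using vicsek_verts_SucI[of "(2 * 3 ^ n, 0)" n "(3 ^ n, 0)"] Suc by (simp add: vicsek_shifts_Suc)
  next
    case 3
    show ?case using vicsek_verts_SucI[of "(0, 2 * 3 ^ n)" n "(0, 3 ^ n)"] Suc by (simp add: vicsek_shifts_Suc)
  next
    case 4
    show ?case using vicsek_verts_SucI[of "(2 * 3 ^ n, 2 * 3 ^ n)" n "(3 ^ n, 3 ^ n)"] Suc by (simp add: vicsek_shifts_Suc)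
  }
qed auto

lemma vicsek_edgesE:
  assumes "e \<in> vicsek_edges n"
  obtains v w where "e = {v, w}" "v \<noteq> w" "v \<in> vicsek_verts n" "w \<in> vicsek_verts n"
  using assms
proof (induction n arbitrary: e thesis)
  case 0
  then show ?case
    by (simp only: vicsek_edges.simps(1)) blast
next
  case (Suc n)
  from Suc.prems(2) obtain a e' where a: "a \<in> vicsek_shifts (Suc n)" and e': "e' \<in> vicsek_edges n" "e = (+) a ` e'"
    by (auto simp: vicsek_edges.simps(2))
  obtain v w where "e' = {v, w}" "v \<noteq> w" "v \<in> vicsek_verts n" "w \<in> vicsek_verts n"
    using Suc.IH[OF _ e'(1)] by blast
  then show ?case
    using a e'(2) vicsek_verts_SucI by (intro Suc.prems(1)[of "a + v" "a + w"]) auto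
qed

lemma vicsek_edge_ends:
  assumes "{v, w} \<in> vicsek_edges n"
  shows "v \<noteq> w" "v \<in> vicsek_verts n" "w \<in> vicsek_verts n"
  using vicsek_edgesE[OF assms] by (auto simp: doubleton_eq_iff)

lemma vicsek_edge_SucI:
  assumes "a \<in> vicsek_shifts (Suc n)" "{v, w} \<in> vicsek_edges n"
  shows "{a + v, a + w} \<in> vicsek_edges (Suc n)"
proof -
  have "(+) a ` {v, w} \<in> (\<lambda>e. (+) a ` e) ` vicsek_edges n"
    using assms(2) by (rule imageI)
  then show ?thesis
    unfolding vicsek_edges.simps(2) using assms(1) by (intro UN_I[of a]) simp_all
qed

lemma vicsek_edge_SucE:
  assumes "{v, w} \<in> vicsek_edges (Suc n)"
  obtains a v' w' where "a \<in> vicsek_shifts (Suc n)" "{v', w'} \<in> vicsek_edges n" "v = a + v'" "w = a + w'"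
proof -
  obtain a e where a: "a \<in> vicsek_shifts (Suc n)" and e: "e \<in> vicsek_edges n" "{v, w} = (+) a ` e"
    using assms by (auto simp: vicsek_edges.simps(2))
  from e(1) obtain p q where pq: "e = {p, q}"
    by (rule vicsek_edgesE)
  then have "v = a + p \<and> w = a + q \<or> v = a + q \<and> w = a + p"
    using e(2) by (auto simp: doubleton_eq_iff)
  then show thesis
    using that[OF a, of p q] that[OF a, of q p] e(1) pq by (auto simp: insert_commute)
qed

lemma vicsek_verts_mono: "m \<le> n \<Longrightarrow> vicsek_verts m \<subseteq> vicsek_verts n"
proof (erule lift_Suc_mono_le[of vicsek_verts, rotated])
  show "vicsek_verts n \<subseteq> vicsek_verts (Suc n)" for n
    using vicsek_verts_SucI[of "(0, 0)" n] by (auto simp: vicsek_shifts_Suc)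
qed

lemma vicsek_edges_mono: "m \<le> n \<Longrightarrow> vicsek_edges m \<subseteq> vicsek_edges n"
proof (erule lift_Suc_mono_le[of vicsek_edges, rotated])
  show "vicsek_edges n \<subseteq> vicsek_edges (Suc n)" for n
  proof
    fix e assume e: "e \<in> vicsek_edges n"
    then obtain v w where "e = {v, w}"
      by (rule vicsek_edgesE)
    then show "e \<in> vicsek_edges (Suc n)"
      using vicsek_edge_SucI[of "(0, 0)" n v w] e
      by (cases v; cases w) (simp add: vicsek_shifts_Suc)
  qed
qed

lemma finite_vicsek_verts: "finite (vicsek_verts n)"
proof (induction n)
  case (Suc n)
  have "finite (vicsek_shifts (Suc n))"
    by (simp add: vicsek_shifts_Suc)
  then show ?case
    unfolding vicsek_verts.simps(2) using Suc by (intro finite_UN_I finite_imageI)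
qed simp

lemma vicsek_nonsink_Suc: "vicsek_nonsink n \<subseteq> vicsek_nonsink (Suc n)"
proof
  fix v assume v: "v \<in> vicsek_nonsink n"
  obtain x y where xy: "v = (x, y)"
    by (cases v)
  have "x \<le> 3 ^ n"
    using v vicsek_verts_le[of x y n] xy by (simp add: vicsek_nonsink_def)
  moreover have "(3 :: nat) ^ n < 3 ^ Suc n"
    by simp
  ultimately have "v \<noteq> vicsek_sink (Suc n)"
    using xy unfolding vicsek_sink_def by auto
  then show "v \<in> vicsek_nonsink (Suc n)"
    using v vicsek_verts_mono[OF le_SucI[OF order_refl[of n]]] unfolding vicsek_nonsink_def by blast
qed

lemma vicsek_nonsink_mono: "m \<le> n \<Longrightarrow> vicsek_nonsink m \<subseteq> vicsek_nonsink n"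
  by (rule lift_Suc_mono_le[of vicsek_nonsink]) (rule vicsek_nonsink_Suc)

lemma vicsek_verts_subset_nonsink: "vicsek_verts n \<subseteq> vicsek_nonsink (Suc n)"
proof
  fix v assume v: "v \<in> vicsek_verts n"
  obtain x y where xy: "v = (x, y)"
    by (cases v)
  have "x \<le> 3 ^ n"
    using v vicsek_verts_le[of x y n] xy by simp
  moreover have "(3 :: nat) ^ n < 3 ^ Suc n"
    by simp
  ultimately have "v \<noteq> vicsek_sink (Suc n)"
    using xy unfolding vicsek_sink_def by auto
  then show "v \<in> vicsek_nonsink (Suc n)"
    using v vicsek_verts_mono[OF le_SucI[OF order_refl[of n]]] unfolding vicsek_nonsink_def by blast
qed

lemma vicsek_V_eq: "vicsek_V = (\<Union>n. vicsek_nonsink n)"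
  using vicsek_verts_subset_nonsink unfolding vicsek_V_def vicsek_nonsink_def by blast

lemma finite_subset_nonsink:
  assumes "finite A" "A \<subseteq> vicsek_V"
  obtains N where "\<And>n. N \<le> n \<Longrightarrow> A \<subseteq> vicsek_nonsink n"
proof -
  have "\<exists>N. A \<subseteq> vicsek_nonsink N"
    using assms
  proof (induction A)
    case (insert v A)
    then obtain N where N: "A \<subseteq> vicsek_nonsink N"
      by auto
    from insert.prems obtain M where M: "v \<in> vicsek_nonsink M"
      by (auto simp: vicsek_V_eq)
    show ?case
      using N M vicsek_nonsink_mono[of N "max N M"] vicsek_nonsink_mono[of M "max N M"]
      by (intro exI[of _ "max N M"]) auto
  qed auto
  then show thesis
    using that vicsek_nonsink_mono by (meson order_trans)
qed

text \<open>The other four copies of \<open>V\<^sub>n\<close> inside \<open>V\<^bsub>n + 1\<^esub>\<close> meet the first one at most in its sink.\<close>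

lemma nbrs_Suc:
  assumes v: "v \<in> vicsek_nonsink n"
  shows "nbrs (vicsek_edges (Suc n)) v = nbrs (vicsek_edges n) v"
proof
  show "nbrs (vicsek_edges n) v \<subseteq> nbrs (vicsek_edges (Suc n)) v"
    using vicsek_edges_mono[of n "Suc n"] by (auto simp: nbrs_def)
  show "nbrs (vicsek_edges (Suc n)) v \<subseteq> nbrs (vicsek_edges n) v"
  proof
    fix w assume "w \<in> nbrs (vicsek_edges (Suc n)) v"
    then have "{v, w} \<in> vicsek_edges (Suc n)"
      by (simp add: nbrs_def)
    then obtain a v' w' where a: "a \<in> vicsek_shifts (Suc n)" "{v', w'} \<in> vicsek_edges n" "v = a + v'" "w = a + w'"
      by (rule vicsek_edge_SucE)
    have le: "fst v \<le> 3 ^ n \<and> snd v \<le> 3 ^ n"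
      using vicsek_verts_le[of "fst v" "snd v" n] v by (simp add: vicsek_nonsink_def)
    have ne: "\<not> (fst v = 3 ^ n \<and> snd v = 3 ^ n)"
      using v by (auto simp: vicsek_nonsink_def vicsek_sink_def prod_eq_iff)
    have sum: "fst v = fst a + fst v'" "snd v = snd a + snd v'"
      using a(3) by simp_all
    have pos: "(0 :: nat) < 3 ^ n"
      by simp
    have "a \<noteq> (3 ^ n, 3 ^ n)" "a \<noteq> (2 * 3 ^ n, 0)" "a \<noteq> (0, 2 * 3 ^ n)" "a \<noteq> (2 * 3 ^ n, 2 * 3 ^ n)"
      using sum le ne pos by (fastforce simp del: zero_less_power)+
    then have "a = (0, 0)"
      using a(1) by (simp add: vicsek_shifts_Suc)
    then have "v = v'" "w = w'"
      using a(3,4) by (simp_all add: prod_eq_iff)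
    then show "w \<in> nbrs (vicsek_edges n) v"
      using a(2) by (simp add: nbrs_def)
  qed
qed

lemma nbrs_vicsek_E:
  assumes v: "v \<in> vicsek_nonsink n"
  shows "nbrs vicsek_E v = nbrs (vicsek_edges n) v"
proof -
  have "nbrs (vicsek_edges (n + k)) v = nbrs (vicsek_edges n) v" for k
  proof (induction k)
    case (Suc k)
    have "v \<in> vicsek_nonsink (n + k)"
      using v vicsek_nonsink_mono[of n "n + k"] by auto
    from nbrs_Suc[OF this] Suc show ?case
      by (simp only: add_Suc_right)
  qed simp
  then have *: "nbrs (vicsek_edges m) v = nbrs (vicsek_edges n) v" if "n \<le> m" for m
    using that by (metis le_add_diff_inverse)
  have "nbrs (vicsek_edges m) v \<subseteq> nbrs (vicsek_edges n) v" for m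
  proof (cases "n \<le> m")
    case True
    then show ?thesis using * by blast
  next
    case False
    then show ?thesis
      using vicsek_edges_mono[of m n] by (auto simp: nbrs_def)
  qed
  moreover have "nbrs vicsek_E v = (\<Union>m. nbrs (vicsek_edges m) v)"
    by (auto simp: nbrs_def vicsek_E_def)
  ultimately show ?thesis
    by blast
qed

lemma deg_vicsek_E: "v \<in> vicsek_nonsink n \<Longrightarrow> deg vicsek_E v = deg (vicsek_edges n) v"
  by (simp add: deg_eq_card_nbrs nbrs_vicsek_E)

lemma lap_vicsek_E: "v \<in> vicsek_nonsink n \<Longrightarrow> lap vicsek_E f v = lap (vicsek_edges n) f v"
  by (simp add: lap_def nbrs_vicsek_E)

lemma nbrs_vicsek_edges_subset: "nbrs (vicsek_edges n) v \<subseteq> vicsek_verts n"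
  unfolding nbrs_def using vicsek_edge_ends(3) by blast

lemma nbrs_vicsek_E_outside:
  assumes "v \<notin> vicsek_V"
  shows "nbrs vicsek_E v = {}"
  using assms vicsek_edge_ends(2) unfolding nbrs_def vicsek_E_def vicsek_V_def by blast

interpretation VG: locally_finite_graph "vicsek_edges n" for n
proof
  show "{v} \<notin> vicsek_edges n" for v
    using vicsek_edge_ends(1)[of v v n] by auto
  show "finite (nbrs (vicsek_edges n) v)" for v
    using finite_vicsek_verts nbrs_vicsek_edges_subset by (rule finite_subset[rotated])
qed

interpretation VI: locally_finite_graph vicsek_E
proof
  show "{v} \<notin> vicsek_E" for v
    using VG.no_loop by (auto simp: vicsek_E_def)
  show "finite (nbrs vicsek_E v)" for v
  proof (cases "v \<in> vicsek_V")
    case True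
    then obtain n where "v \<in> vicsek_nonsink n"
      unfolding vicsek_V_eq by blast
    then show ?thesis
      using VG.finite_nbrs[of n v] by (simp add: nbrs_vicsek_E)
  qed (simp add: nbrs_vicsek_E_outside)
qed

text \<open>Every copy is joined to the centre \<open>(3\<^sup>n, 3\<^sup>n)\<close> through the corner that it shares with the central
  copy.\<close>

lemma vicsek_connected:
  "v \<in> vicsek_verts n \<Longrightarrow> w \<in> vicsek_verts n \<Longrightarrow> (v, w) \<in> {(v, w). {v, w} \<in> vicsek_edges n}\<^sup>*"
proof (induction n arbitrary: v w)
  case 0
  then have "{v, w} \<in> vicsek_edges 0" if "v \<noteq> w"
    using that unfolding vicsek_edges.simps(1) by blast
  then show ?case
    by (cases "v = w") (auto simp del: vicsek_edges.simps)
next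
  case (Suc n)
  let ?R = "{(v, w). {v, w} \<in> vicsek_edges (Suc n)}"
  let ?L = "3 ^ n :: nat"
  have shift: "(a + v, a + w) \<in> ?R\<^sup>*"
    if a: "a \<in> vicsek_shifts (Suc n)" and vw: "v \<in> vicsek_verts n" "w \<in> vicsek_verts n" for a v w
    using Suc.IH[OF vw]
  proof induction
    case (step x y)
    have "{a + x, a + y} \<in> vicsek_edges (Suc n)"
      using step.hyps(2) by (intro vicsek_edge_SucI[OF a]) simp
    then show ?case
      by (intro rtrancl_into_rtrancl[OF step.IH]) simp
  qed simp
  have sym: "sym (?R\<^sup>*)"
    by (intro sym_rtrancl symI) (auto simp: insert_commute)
  have centre: "(v, (?L, ?L)) \<in> ?R\<^sup>*" if vS: "v \<in> vicsek_verts (Suc n)" for v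
  proof -
    obtain a v' where a: "a \<in> vicsek_shifts (Suc n)" and v': "v' \<in> vicsek_verts n" "v = a + v'"
      using vS by (rule vicsek_verts_SucE)
    have mid: "((?L, ?L) + c, (?L, ?L)) \<in> ?R\<^sup>*" if "c \<in> vicsek_verts n" for c
      using shift[of "(?L, ?L)" c "(0, 0)"] that vicsek_corners[of n] by (simp add: vicsek_shifts_Suc)
    consider "a = (0, 0)" | "a = (?L, ?L)" | "a = (2 * ?L, 0)" | "a = (0, 2 * ?L)" | "a = (2 * ?L, 2 * ?L)"
      using a by (auto simp: vicsek_shifts_Suc)
    then show ?thesis
    proof cases
      case 1
      then show ?thesis
        using shift[OF a v'(1) vicsek_corners(4)] v'(2) by simp
    next
      case 2
      then show ?thesis
        using mid v' by simp
    next
      case 3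
      then have "(v, (2 * ?L, ?L)) \<in> ?R\<^sup>*"
        using shift[OF a v'(1) vicsek_corners(3)] v'(2) by simp
      moreover have "((2 * ?L, ?L), (?L, ?L)) \<in> ?R\<^sup>*"
        using mid[OF vicsek_corners(2)] by (simp add: mult_2)
      ultimately show ?thesis
        by (rule rtrancl_trans)
    next
      case 4
      then have "(v, (?L, 2 * ?L)) \<in> ?R\<^sup>*"
        using shift[OF a v'(1) vicsek_corners(2)] v'(2) by simp
      moreover have "((?L, 2 * ?L), (?L, ?L)) \<in> ?R\<^sup>*"
        using mid[OF vicsek_corners(3)] by (simp add: mult_2)
      ultimately show ?thesis
        by (rule rtrancl_trans)
    next
      case 5
      then have "(v, (2 * ?L, 2 * ?L)) \<in> ?R\<^sup>*"
        using shift[OF a v'(1) vicsek_corners(1)] v'(2) by simp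
      moreover have "((2 * ?L, 2 * ?L), (?L, ?L)) \<in> ?R\<^sup>*"
        using mid[OF vicsek_corners(4)] by (simp add: mult_2)
      ultimately show ?thesis
        by (rule rtrancl_trans)
    qed
  qed
  show ?case
    using centre[OF Suc.prems(1)] symD[OF sym centre[OF Suc.prems(2)]] by (rule rtrancl_trans)
qed

definition sink_dist :: "nat \<Rightarrow> vertex \<Rightarrow> nat" where
  "sink_dist n v = (LEAST k. (v, vicsek_sink n) \<in> {(v, w). {v, w} \<in> vicsek_edges n} ^^ k)"

lemma vicsek_sink_vert: "vicsek_sink n \<in> vicsek_verts n"
  by (simp add: vicsek_sink_def vicsek_corners)

interpretation VS: sink_graph "vicsek_edges n" "vicsek_nonsink n" "sink_dist n" for n
proof
  show "finite (vicsek_nonsink n)"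
    by (simp add: vicsek_nonsink_def finite_vicsek_verts)
  fix v assume v: "v \<in> vicsek_nonsink n"
  let ?R = "{(v, w). {v, w} \<in> vicsek_edges n}"
  have "\<exists>k. (v, vicsek_sink n) \<in> ?R ^^ k"
    using vicsek_connected[of v n "vicsek_sink n"] v vicsek_sink_vert
    by (intro rtrancl_imp_relpow) (auto simp: vicsek_nonsink_def)
  then have k: "(v, vicsek_sink n) \<in> ?R ^^ sink_dist n v"
    unfolding sink_dist_def by (rule LeastI_ex)
  have "sink_dist n v \<noteq> 0"
  proof
    assume "sink_dist n v = 0"
    with k have "v = vicsek_sink n"
      by simp
    with v show False
      by (simp add: vicsek_nonsink_def)
  qed
  then obtain d where d: "sink_dist n v = Suc d"
    using not0_implies_Suc by blast
  with k obtain w where w: "(v, w) \<in> ?R" "(w, vicsek_sink n) \<in> ?R ^^ d"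
    using relpow_Suc_D2[of v "vicsek_sink n" d ?R] by auto
  have "sink_dist n w \<le> d"
    unfolding sink_dist_def using w(2) by (rule Least_le)
  then show "\<exists>w\<in>nbrs (vicsek_edges n) v. w \<in> vicsek_nonsink n \<longrightarrow> sink_dist n w < sink_dist n v"
    using w(1) d by (intro bexI[of _ w]) (auto simp: nbrs_def)
qed

lemma vicsek_nonsink_origin: "(0, 0) \<in> vicsek_nonsink n"
  by (simp add: vicsek_nonsink_def vicsek_sink_def vicsek_corners)

lemma recurrent_sandpiles_eq:
  "recurrent_sandpiles n =
     {\<sigma> \<in> extensional (vicsek_nonsink n).
        stable (vicsek_edges n) (vicsek_nonsink n) \<sigma> \<and> allowed (vicsek_edges n) (vicsek_nonsink n) \<sigma>}"
proof -
  have "vicsek_nonsink n \<noteq> {}"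
    using vicsek_nonsink_origin by blast
  moreover have "stable_sandpiles n = VS.states n"
    by (auto simp: stable_sandpiles_def VS.states_def PiE_def)
  ultimately show ?thesis
    using VS.recurrent_iff_allowed[of _ n]
    unfolding recurrent_sandpiles_def driving_measure_def sandpile_chain_eq_drive VS.states_def by blast
qed

lemma finite_recurrent: "finite (recurrent_sandpiles n)"
  using VS.finite_states by (rule finite_subset[rotated]) (auto simp: recurrent_sandpiles_eq VS.states_def)

lemma recurrent_nonempty: "recurrent_sandpiles n \<noteq> {}"
  using VS.max_stable_allowed[of n] unfolding recurrent_sandpiles_eq VS.states_def by blast

text \<open>The diagonal blocks, which carry the flow of particles from the origin to infinity, and the set of
  all their vertices.\<close>

definition block :: "nat \<Rightarrow> vertex set" where
  "block k = {(k, k), (Suc k, k), (k, Suc k), (Suc k, Suc k)}"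

definition spine :: "vertex set" where
  "spine = {(x, y). x \<le> Suc y \<and> y \<le> Suc x}"

lemma block_shift: "block (c + k) = (+) (c, c) ` block k"
  by (simp add: block_def)

lemma diagonal_shift:
  assumes "k < 3 ^ Suc n"
  obtains c k' where "(c, c) \<in> vicsek_shifts (Suc n)" "k = c + k'" "k' < 3 ^ n"
proof -
  let ?L = "3 ^ n :: nat"
  consider "k < ?L" | "?L \<le> k" "k < 2 * ?L" | "2 * ?L \<le> k"
    by linarith
  then show thesis
  proof cases
    case 1
    then show ?thesis using that[of 0 k] by (simp add: vicsek_shifts_Suc)
  next
    case 2
    then show ?thesis using that[of ?L "k - ?L"] by (simp add: vicsek_shifts_Suc)
  next
    case 3
    then show ?thesis using that[of "2 * ?L" "k - 2 * ?L"] assms by (simp add: vicsek_shifts_Suc)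
  qed
qed

lemma block_complete:
  "k < 3 ^ n \<Longrightarrow> v \<in> block k \<Longrightarrow> w \<in> block k \<Longrightarrow> v \<noteq> w \<Longrightarrow> {v, w} \<in> vicsek_edges n"
proof (induction n arbitrary: k v w)
  case 0
  then show ?case
    by (simp add: block_def) blast
next
  case (Suc n)
  obtain c k' where c: "(c, c) \<in> vicsek_shifts (Suc n)" "k = c + k'" "k' < 3 ^ n"
    using Suc.prems(1) by (rule diagonal_shift)
  obtain v' w' where vw: "v' \<in> block k'" "w' \<in> block k'" "v = (c, c) + v'" "w = (c, c) + w'"
    using Suc.prems(2,3) unfolding c(2) block_shift by blast
  then have "v' \<noteq> w'"
    using Suc.prems(4) by blast
  from vicsek_edge_SucI[OF c(1) Suc.IH[OF c(3) vw(1,2) this]] vw(3,4) show ?case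
    by simp
qed

text \<open>The branches hanging off the diagonal are described by the map \<open>\<pi>\<close> that sends each vertex to
  the vertex of a diagonal block at which its branch is attached.  The three copies on the
  diagonal inherit it from \<open>V\<^sub>n\<close>; each of the two other copies is attached to a corner of the
  central copy as a whole, and is mapped to wherever that corner is.\<close>

lemma vicsek_retraction_exists:
  "\<exists>\<pi>. (\<forall>v\<in>vicsek_verts n. \<pi> v \<in> spine \<inter> vicsek_verts n) \<and>
       (\<forall>x y. (x, y) \<in> spine \<and> x \<le> 3 ^ n \<and> y \<le> 3 ^ n \<longrightarrow> \<pi> (x, y) = (x, y)) \<and>
       (\<forall>v w. {v, w} \<in> vicsek_edges n \<longrightarrow> (\<exists>k<3 ^ n. v \<in> block k \<and> w \<in> block k) \<or> \<pi> v = \<pi> w)"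
proof (induction n)
  case 0
  show ?case
  proof (intro exI[of _ "\<lambda>v. v"] conjI ballI allI impI disjI1)
    show "\<exists>k<3 ^ 0. v \<in> block k \<and> w \<in> block k" if "{v, w} \<in> vicsek_edges 0" for v w
      using vicsek_edge_ends(2,3)[OF that] by (auto simp: block_def)
  qed (auto simp: spine_def)
next
  case (Suc n)
  let ?L = "3 ^ n :: nat"
  from Suc obtain \<pi> where
    \<pi>: "\<And>v. v \<in> vicsek_verts n \<Longrightarrow> \<pi> v \<in> spine \<inter> vicsek_verts n"
    and fix_\<pi>: "\<And>x y. (x, y) \<in> spine \<Longrightarrow> x \<le> ?L \<Longrightarrow> y \<le> ?L \<Longrightarrow> \<pi> (x, y) = (x, y)"
    and edge: "\<And>v w. {v, w} \<in> vicsek_edges n \<Longrightarrow> (\<exists>k<?L. v \<in> block k \<and> w \<in> block k) \<or> \<pi> v = \<pi> w"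
    by blast
  have L: "0 < ?L"
    by simp
  have fix0: "\<pi> (0, 0) = (0, 0)" and fixL: "\<pi> (?L, ?L) = (?L, ?L)"
    by (auto intro!: fix_\<pi> simp: spine_def)
  define \<rho> where "\<rho> = (\<lambda>(x, y).
    if x \<le> ?L \<and> y \<le> ?L then \<pi> (x, y)
    else if ?L \<le> x \<and> x \<le> 2 * ?L \<and> ?L \<le> y \<and> y \<le> 2 * ?L then (?L, ?L) + \<pi> (x - ?L, y - ?L)
    else if 2 * ?L \<le> x \<and> 2 * ?L \<le> y then (2 * ?L, 2 * ?L) + \<pi> (x - 2 * ?L, y - 2 * ?L)
    else if 2 * ?L \<le> x then (?L, ?L) + \<pi> (?L, 0)
    else (?L, ?L) + \<pi> (0, ?L))"
  have copy: "\<rho> (a + v) = (if a = (2 * ?L, 0) then (?L, ?L) + \<pi> (?L, 0)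
                           else if a = (0, 2 * ?L) then (?L, ?L) + \<pi> (0, ?L) else a + \<pi> v)"
    if a: "a \<in> vicsek_shifts (Suc n)" and v: "v \<in> vicsek_verts n" for a v
  proof -
    obtain x y where xy: "v = (x, y)" "x \<le> ?L" "y \<le> ?L"
      using v vicsek_verts_le by (cases v) blast
    consider "a = (0, 0)" | "a = (?L, ?L)" | "a = (2 * ?L, 0)" | "a = (0, 2 * ?L)" | "a = (2 * ?L, 2 * ?L)"
      using a by (auto simp: vicsek_shifts_Suc)
    then show ?thesis
    proof cases
      case 1
      then show ?thesis using xy L by (simp add: \<rho>_def plus_prod_def)
    next
      case 2
      then show ?thesis
        using xy L fix0 fixL by (cases "x = 0 \<and> y = 0") (auto simp: \<rho>_def plus_prod_def)
    next
      case 3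
      then show ?thesis
        using xy L by (cases "x = 0 \<and> y = ?L") (auto simp: \<rho>_def plus_prod_def)
    next
      case 4
      then show ?thesis
        using xy L by (cases "x = ?L \<and> y = 0") (auto simp: \<rho>_def plus_prod_def)
    next
      case 5
      then show ?thesis
        using xy L fix0 fixL by (cases "x = 0 \<and> y = 0") (auto simp: \<rho>_def plus_prod_def)
    qed
  qed
  have spine_shift: "(c, c) + v \<in> spine" if "v \<in> spine" for c v
    using that by (auto simp: spine_def)
  show ?case
  proof (intro exI[of _ \<rho>] conjI ballI allI impI)
    fix v assume "v \<in> vicsek_verts (Suc n)"
    then obtain a v' where a: "a \<in> vicsek_shifts (Suc n)" and v': "v' \<in> vicsek_verts n" "v = a + v'"
      by (rule vicsek_verts_SucE)
    have "\<exists>c u. (c, c) \<in> vicsek_shifts (Suc n) \<and> u \<in> vicsek_verts n \<and> \<rho> v = (c, c) + \<pi> u"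
    proof (cases "a = (2 * ?L, 0) \<or> a = (0, 2 * ?L)")
      case True
      then show ?thesis
        using copy[OF a v'(1)] vicsek_corners(2,3)[of n] v'(2) by (auto simp: vicsek_shifts_Suc)
    next
      case False
      then obtain c where "a = (c, c)"
        using a by (auto simp: vicsek_shifts_Suc)
      then show ?thesis
        using copy[OF a v'(1)] a v' False by (intro exI[of _ c] exI[of _ v']) auto
    qed
    then obtain c u where "(c, c) \<in> vicsek_shifts (Suc n)" "u \<in> vicsek_verts n" "\<rho> v = (c, c) + \<pi> u"
      by blast
    then show "\<rho> v \<in> spine \<inter> vicsek_verts (Suc n)"
      using \<pi>[of u] spine_shift vicsek_verts_SucI by auto
  next
    fix x y :: nat
    assume xy: "(x, y) \<in> spine \<and> x \<le> 3 ^ Suc n \<and> y \<le> 3 ^ Suc n"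
    then have sp: "x \<le> Suc y" "y \<le> Suc x"
      by (auto simp: spine_def)
    consider "x \<le> ?L \<and> y \<le> ?L" | "\<not> (x \<le> ?L \<and> y \<le> ?L)" "?L \<le> x \<and> x \<le> 2 * ?L \<and> ?L \<le> y \<and> y \<le> 2 * ?L"
      | "\<not> (x \<le> ?L \<and> y \<le> ?L)" "\<not> (?L \<le> x \<and> x \<le> 2 * ?L \<and> ?L \<le> y \<and> y \<le> 2 * ?L)" "2 * ?L \<le> x \<and> 2 * ?L \<le> y"
      using sp by linarith
    then show "\<rho> (x, y) = (x, y)"
    proof cases
      case 1
      then show ?thesis using xy fix_\<pi>[of x y] by (simp add: \<rho>_def)
    next
      case 2
      then have "\<pi> (x - ?L, y - ?L) = (x - ?L, y - ?L)"
        using sp by (intro fix_\<pi>) (auto simp: spine_def)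
      then show ?thesis using 2 by (auto simp: \<rho>_def)
    next
      case 3
      then have "\<pi> (x - 2 * ?L, y - 2 * ?L) = (x - 2 * ?L, y - 2 * ?L)"
        using sp xy by (intro fix_\<pi>) (auto simp: spine_def)
      then show ?thesis using 3 by (auto simp: \<rho>_def)
    qed
  next
    fix v w assume "{v, w} \<in> vicsek_edges (Suc n)"
    then obtain a v' w' where a: "a \<in> vicsek_shifts (Suc n)"
      and e: "{v', w'} \<in> vicsek_edges n" "v = a + v'" "w = a + w'"
      by (rule vicsek_edge_SucE)
    note ends = vicsek_edge_ends(2,3)[OF e(1)]
    show "(\<exists>k<3 ^ Suc n. v \<in> block k \<and> w \<in> block k) \<or> \<rho> v = \<rho> w"
    proof (cases "a = (2 * ?L, 0) \<or> a = (0, 2 * ?L) \<or> \<pi> v' = \<pi> w'")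
      case True
      then show ?thesis
        using copy[OF a ends(1)] copy[OF a ends(2)] e(2,3) by auto
    next
      case False
      then obtain c where c: "a = (c, c)" "c \<le> 2 * ?L"
        using a by (auto simp: vicsek_shifts_Suc)
      from False edge[OF e(1)] obtain k where k: "k < ?L" "v' \<in> block k" "w' \<in> block k"
        by blast
      have "c + k < 3 ^ Suc n"
        using k(1) c(2) by simp
      moreover have "v \<in> block (c + k)" "w \<in> block (c + k)"
        using k e(2,3) c(1) by (auto simp: block_shift)
      ultimately show ?thesis
        by blast
    qed
  qed
qed

definition spine_retraction :: "nat \<Rightarrow> (vertex \<Rightarrow> vertex) \<Rightarrow> bool" where
  "spine_retraction n \<pi> \<longleftrightarrow>
     (\<forall>v\<in>vicsek_verts n. \<pi> v \<in> spine \<inter> vicsek_verts n) \<and>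
     (\<forall>v\<in>spine \<inter> vicsek_verts n. \<pi> v = v) \<and>
     (\<forall>v w. {v, w} \<in> vicsek_edges n \<longrightarrow> (\<exists>k<3 ^ n. v \<in> block k \<and> w \<in> block k) \<or> \<pi> v = \<pi> w)"

lemma spine_retraction_exists: "\<exists>\<pi>. spine_retraction n \<pi>"
proof -
  obtain \<pi> where \<pi>: "\<forall>v\<in>vicsek_verts n. \<pi> v \<in> spine \<inter> vicsek_verts n"
    "\<And>x y. (x, y) \<in> spine \<Longrightarrow> x \<le> 3 ^ n \<Longrightarrow> y \<le> 3 ^ n \<Longrightarrow> \<pi> (x, y) = (x, y)"
    "\<forall>v w. {v, w} \<in> vicsek_edges n \<longrightarrow> (\<exists>k<3 ^ n. v \<in> block k \<and> w \<in> block k) \<or> \<pi> v = \<pi> w"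
    using vicsek_retraction_exists[of n] by blast
  have "\<pi> v = v" if "v \<in> spine \<inter> vicsek_verts n" for v
    using \<pi>(2)[of "fst v" "snd v"] vicsek_verts_le[of "fst v" "snd v" n] that by simp
  with \<pi>(1,3) show ?thesis
    unfolding spine_retraction_def by blast
qed

lemma block_spine: "block k \<subseteq> spine"
  by (auto simp: block_def spine_def)

lemma block_ge: "v \<in> block k \<Longrightarrow> k \<le> fst v \<and> k \<le> snd v"
  by (auto simp: block_def)

lemma sink_spine: "vicsek_sink n \<in> spine"
  by (simp add: vicsek_sink_def spine_def)

lemma block_in_verts: "k < 3 ^ n \<Longrightarrow> block k \<subseteq> vicsek_verts n"
proof
  fix v assume k: "k < 3 ^ n" and v: "v \<in> block k"
  have "\<exists>w\<in>block k. v \<noteq> w"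
    by (cases "v = (k, k)") (auto simp: block_def)
  then obtain w where "w \<in> block k" "v \<noteq> w"
    by blast
  from block_complete[OF k v this] show "v \<in> vicsek_verts n"
    by (rule vicsek_edge_ends(2))
qed

section \<open>The complete graph on four vertices\<close>

type_synonym triple = "int \<times> int \<times> int"

text \<open>The complete graph on a source, two side vertices and a sink; triples list source and sides.
  Each set of \<open>j\<close> vertices must contain one with at least \<open>j - 1\<close> particles, which is Dhar's criterion
  here.\<close>

definition k4_recurrent :: "triple set" where
  "k4_recurrent = {(a, b, c). a \<in> {0..2} \<and> b \<in> {0..2} \<and> c \<in> {0..2} \<and>
     (1 \<le> a \<or> 1 \<le> b) \<and> (1 \<le> a \<or> 1 \<le> c) \<and> (1 \<le> b \<or> 1 \<le> c) \<and> (2 \<le> a \<or> 2 \<le> b \<or> 2 \<le> c)}"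

text \<open>The heights after \<open>m\<close> particles have been added to the source and the three vertices have
  toppled \<open>x\<close>, \<open>y\<close> and \<open>z\<close> times.\<close>

fun k4_residual :: "triple \<Rightarrow> int \<Rightarrow> triple \<Rightarrow> triple" where
  "k4_residual (a, b, c) m (x, y, z) = (a + m - (3 * x - y - z), b - (3 * y - x - z), c - (3 * z - x - y))"

fun k4_stable :: "triple \<Rightarrow> bool" where
  "k4_stable (a, b, c) \<longleftrightarrow> a \<le> 2 \<and> b \<le> 2 \<and> c \<le> 2"

fun k4_mass :: "triple \<Rightarrow> int" where
  "k4_mass (x, y, z) = x + y + z"

fun k4_round :: "triple \<Rightarrow> int \<Rightarrow> triple \<Rightarrow> triple" where
  "k4_round t m (x, y, z) = (case k4_residual t m (x, y, z) of
     (a, b, c) \<Rightarrow> (x + of_bool (2 < a), y + of_bool (2 < b), z + of_bool (2 < c)))"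

text \<open>Topple all unstable vertices simultaneously, four times.  Every toppling sends one particle to the
  sink, and at most four arrive there when \<open>m \<le> 4\<close>, so four rounds are enough.\<close>

definition k4_odometer :: "triple \<Rightarrow> int \<Rightarrow> triple" where
  "k4_odometer t m = k4_round t m (k4_round t m (k4_round t m (k4_round t m (0, 0, 0))))"

text \<open>The number of particles that reach the sink is the total number of topplings.  The default value
  \<open>0\<close> off the recurrent triples makes \<open>0\<close> absorbing and keeps the values in \<open>{0, \<dots>, 4}\<close> for all
  triples.\<close>

definition k4_out :: "triple \<Rightarrow> int \<Rightarrow> int" where
  "k4_out t m = (if t \<in> k4_recurrent then k4_mass (k4_odometer t m) else 0)"

definition k4_recurrent_list :: "triple list" where
  "k4_recurrent_list =
     [(0, 1, 2), (0, 2, 1), (0, 2, 2), (1, 0, 2), (1, 1, 2), (1, 2, 0), (1, 2, 1), (1, 2, 2),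
      (2, 0, 1), (2, 0, 2), (2, 1, 0), (2, 1, 1), (2, 1, 2), (2, 2, 0), (2, 2, 1), (2, 2, 2)]"

lemma k4_recurrent_eq: "k4_recurrent = set k4_recurrent_list"
proof
  have "list_all (\<lambda>t. t \<in> k4_recurrent) k4_recurrent_list"
    by (simp only: k4_recurrent_list_def list.pred_inject) (intro conjI TrueI; simp add: k4_recurrent_def)
  then show "set k4_recurrent_list \<subseteq> k4_recurrent"
    unfolding list_all_iff by blast
  have "list_all (\<lambda>a. list_all (\<lambda>b. list_all (\<lambda>c. (a, b, c) \<in> k4_recurrent \<longrightarrow>
      (a, b, c) \<in> set k4_recurrent_list) [0, 1, 2]) [0, 1, 2]) [0, 1, 2]"
    by (simp only: list.pred_inject)
      (intro conjI TrueI; simp add: k4_recurrent_def k4_recurrent_list_def)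
  then have *: "(a, b, c) \<in> set k4_recurrent_list"
    if "(a, b, c) \<in> k4_recurrent" "a \<in> set [0, 1, 2]" "b \<in> set [0, 1, 2]" "c \<in> set [0, 1, 2]" for a b c
    using that unfolding list_all_iff by blast
  show "k4_recurrent \<subseteq> set k4_recurrent_list"
  proof
    fix t assume t: "t \<in> k4_recurrent"
    obtain a b c where abc: "t = (a, b, c)"
      by (cases t)
    then have "a \<in> {0..2}" "b \<in> {0..2}" "c \<in> {0..2}"
      using t by (simp_all add: k4_recurrent_def)
    then have "a \<in> set [0, 1, 2]" "b \<in> set [0, 1, 2]" "c \<in> set [0, 1, 2]"
      by auto
    with t show "t \<in> set k4_recurrent_list"
      unfolding abc by (rule *)
  qed
qed

lemma card_k4_recurrent: "card k4_recurrent = 16" "finite k4_recurrent"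
  by (simp_all add: k4_recurrent_eq k4_recurrent_list_def)

fun k4_nonneg :: "triple \<Rightarrow> bool" where
  "k4_nonneg (a, b, c) \<longleftrightarrow> 0 \<le> a \<and> 0 \<le> b \<and> 0 \<le> c"

lemma k4_odometer_table:
  assumes "t \<in> k4_recurrent" "m \<in> {0, 1, 2, 3, 4}"
  shows "k4_stable (k4_residual t m (k4_odometer t m))" "k4_nonneg (k4_odometer t m)"
    "k4_mass (k4_odometer t m) \<in> {0, 1, 2, 3, 4}"
proof -
  have "list_all (\<lambda>t. list_all (\<lambda>m.
      k4_stable (k4_residual t m (k4_odometer t m)) \<and> k4_nonneg (k4_odometer t m) \<and>
      k4_mass (k4_odometer t m) \<in> {0, 1, 2, 3, 4}) [0, 1, 2, 3, 4]) k4_recurrent_list"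
    by (simp only: k4_recurrent_list_def list.pred_inject) (intro conjI; simp add: k4_odometer_def)
  moreover have "t \<in> set k4_recurrent_list" "m \<in> set [0, 1, 2, 3, 4]"
    using assms by (simp_all add: k4_recurrent_eq)
  ultimately show "k4_stable (k4_residual t m (k4_odometer t m))" "k4_nonneg (k4_odometer t m)"
    "k4_mass (k4_odometer t m) \<in> {0, 1, 2, 3, 4}"
    unfolding list_all_iff by blast+
qed

lemma k4_out_rows:
  "map (\<lambda>m. map (\<lambda>t. k4_mass (k4_odometer t m)) k4_recurrent_list) [0, 1, 2, 3, 4] =
     [[0, 0, 0, 0, 0, 0, 0, 0, 0, 0, 0, 0, 0, 0, 0, 0],
      [0, 0, 0, 0, 0, 0, 0, 0, 1, 2, 1, 1, 3, 2, 3, 3],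
      [0, 0, 0, 2, 3, 2, 3, 3, 1, 2, 1, 1, 4, 2, 4, 4],
      [3, 3, 3, 2, 4, 2, 4, 4, 1, 4, 1, 1, 4, 4, 4, 4],
      [4, 4, 4, 4, 4, 4, 4, 4, 4, 4, 4, 4, 4, 4, 4, 4]]"
  by (simp only: k4_recurrent_list_def list.map list.inject refl simp_thms)
    (intro conjI; simp add: k4_odometer_def)

lemma card_k4_out:
  "card {t \<in> k4_recurrent. k4_out t m = j} =
     count_list (map (\<lambda>t. k4_mass (k4_odometer t m)) k4_recurrent_list) j"
proof -
  have "distinct k4_recurrent_list"
    by (simp add: k4_recurrent_list_def)
  moreover have "{t \<in> k4_recurrent. k4_out t m = j} =
      set (filter (\<lambda>t. k4_mass (k4_odometer t m) = j) k4_recurrent_list)"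
    by (auto simp: k4_out_def k4_recurrent_eq)
  ultimately have "card {t \<in> k4_recurrent. k4_out t m = j} =
      length (filter (\<lambda>t. k4_mass (k4_odometer t m) = j) k4_recurrent_list)"
    using distinct_card[OF distinct_filter] by simp
  also have "length (filter (\<lambda>t. f t = j) xs) = count_list (map f xs) j" for f :: "triple \<Rightarrow> int" and xs
    by (induction xs) auto
  finally show ?thesis .
qed

text \<open>The transition counts of the particle flow: row \<open>m\<close> says how many of the \<open>16\<close> triples send
  \<open>0, \<dots>, 4\<close> particles to the sink when \<open>m\<close> are put into the source.  The mean of row \<open>m\<close> is \<open>m\<close>.\<close>

lemma k4_out_table:
  "map (\<lambda>m. map (\<lambda>j. card {t \<in> k4_recurrent. k4_out t m = j}) [0, 1, 2, 3, 4]) [0, 1, 2, 3, 4] =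
     [[16, 0, 0, 0, 0], [8, 3, 2, 3, 0], [3, 3, 4, 3, 3], [0, 3, 2, 3, 8], [0, 0, 0, 0, 16]]"
  unfolding card_k4_out list.map
  by (simp only: k4_out_rows[unfolded list.map list.inject]) simp

text \<open>The least action principle again, for the simultaneous topplings and with possibly more
  particles at the source.\<close>

lemma k4_odometer_least:
  assumes "k4_stable (k4_residual (a, b, c) m' (x, y, z))" "m \<le> m'" "0 \<le> x" "0 \<le> y" "0 \<le> z"
  shows "k4_mass (k4_odometer (a, b, c) m) \<le> x + y + z"
proof -
  have step: "\<exists>p' q' r'. k4_round (a, b, c) m (p, q, r) = (p', q', r') \<and> p' \<le> x \<and> q' \<le> y \<and> r' \<le> z"
    if "p \<le> x" "q \<le> y" "r \<le> z" for p q r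
    using assms(1,2) that by auto
  define u where "u = k4_round (a, b, c) m"
  obtain p1 q1 r1 where 1: "u (0, 0, 0) = (p1, q1, r1)" "p1 \<le> x" "q1 \<le> y" "r1 \<le> z"
    using step[of 0 0 0] assms unfolding u_def by blast
  obtain p2 q2 r2 where 2: "u (p1, q1, r1) = (p2, q2, r2)" "p2 \<le> x" "q2 \<le> y" "r2 \<le> z"
    using step[OF 1(2-4)] unfolding u_def by blast
  obtain p3 q3 r3 where 3: "u (p2, q2, r2) = (p3, q3, r3)" "p3 \<le> x" "q3 \<le> y" "r3 \<le> z"
    using step[OF 2(2-4)] unfolding u_def by blast
  obtain p4 q4 r4 where 4: "u (p3, q3, r3) = (p4, q4, r4)" "p4 \<le> x" "q4 \<le> y" "r4 \<le> z"
    using step[OF 3(2-4)] unfolding u_def by blast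
  have "k4_odometer (a, b, c) m = (p4, q4, r4)"
    by (simp only: k4_odometer_def flip: u_def) (simp add: 1 2 3 4)
  then show ?thesis
    using 4 by simp
qed

text \<open>The set where \<open>(x, y, z)\<close> attains a negative minimum would be a forbidden subconfiguration.
  This allows comparison with the topplings in a large graph, where \<open>x\<close>, \<open>y\<close> and \<open>z\<close> are counted
  relative to the exit vertex of the block and have no sign a priori.\<close>

lemma k4_stabilizing_nonneg:
  assumes t: "(a, b, c) \<in> k4_recurrent" and st: "k4_stable (k4_residual (a, b, c) m (x, y, z))" and m: "0 \<le> m"
  shows "0 \<le> x \<and> 0 \<le> y \<and> 0 \<le> z"
proof -
  have t': "1 \<le> a \<or> 1 \<le> b" "1 \<le> a \<or> 1 \<le> c" "1 \<le> b \<or> 1 \<le> c" "2 \<le> a \<or> 2 \<le> b \<or> 2 \<le> c"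
    "0 \<le> a" "0 \<le> b" "0 \<le> c"
    using t by (auto simp: k4_recurrent_def)
  have st': "a + m - (3 * x - y - z) \<le> 2" "b - (3 * y - x - z) \<le> 2" "c - (3 * z - x - y) \<le> 2"
    using st by auto
  show ?thesis
  proof (rule ccontr)
    assume neg: "\<not> (0 \<le> x \<and> 0 \<le> y \<and> 0 \<le> z)"
    \<comment> \<open>The seven possible sets of minimizers, each with its own part of the criterion.\<close>
    consider "x < y" "x < z" | "y < x" "y < z" | "z < x" "z < y"
      | "x = y" "x < z" | "x = z" "x < y" | "y = z" "y < x" | "x = y" "x = z"
      by linarith
    then show False
    proof cases
      case 1 then show False using neg st' t' m by linarith
    next
      case 2 then show False using neg st' t' m by linarith
    next
      case 3 then show False using neg st' t' m by linarith
    next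
      case 4 then show False using neg st' t'(1) m by linarith
    next
      case 5 then show False using neg st' t'(2) m by linarith
    next
      case 6 then show False using neg st' t'(3) m by linarith
    next
      case 7 then show False using neg st' t'(4) m by linarith
    qed
  qed
qed

lemma k4_out_le:
  assumes t: "(a, b, c) \<in> k4_recurrent" and st: "k4_stable (k4_residual (a, b, c) m' (x, y, z))"
    and m: "0 \<le> m" "m \<le> m'"
  shows "k4_out (a, b, c) m \<le> x + y + z"
  using k4_odometer_least[OF st m(2)] k4_stabilizing_nonneg[OF t st] t m by (simp add: k4_out_def)

lemma k4_out_zero: "k4_out t 0 = 0"
proof (cases "t \<in> k4_recurrent")
  case True
  obtain a b c where abc: "t = (a, b, c)"
    by (cases t)
  then have "a \<le> 2" "b \<le> 2" "c \<le> 2"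
    using True by (simp_all add: k4_recurrent_def)
  then have "k4_out (a, b, c) 0 \<le> 0 + 0 + 0"
    using True abc by (intro k4_out_le[where m' = 0]) auto
  moreover have "0 \<le> k4_out t 0"
    using k4_odometer_table(3)[OF True, of 0] True by (auto simp: k4_out_def)
  ultimately show ?thesis
    using abc by simp
qed (simp add: k4_out_def)

section \<open>The law of the particle flow along the diagonal\<close>

text \<open>The law at time \<open>k\<close> of the Markov chain on \<open>{0, \<dots>, 4}\<close> that starts in \<open>1\<close> and has the transition
  counts above.\<close>

primrec carry_law :: "nat \<Rightarrow> int \<Rightarrow> real" where
  "carry_law 0 = (\<lambda>j. of_bool (j = 1))"
| "carry_law (Suc k) =
     (\<lambda>j. \<Sum>i\<in>{0, 1, 2, 3, 4}. carry_law k i * (card {t \<in> k4_recurrent. k4_out t i = j} / 16))"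

lemma carry_law_step:
  "16 * carry_law (Suc k) 0 = 16 * carry_law k 0 + 8 * carry_law k 1 + 3 * carry_law k 2"
  "16 * carry_law (Suc k) 1 = 3 * carry_law k 1 + 3 * carry_law k 2 + 3 * carry_law k 3"
  "16 * carry_law (Suc k) 2 = 2 * carry_law k 1 + 4 * carry_law k 2 + 2 * carry_law k 3"
  "16 * carry_law (Suc k) 3 = 3 * carry_law k 1 + 3 * carry_law k 2 + 3 * carry_law k 3"
  "16 * carry_law (Suc k) 4 = 3 * carry_law k 2 + 8 * carry_law k 3 + 16 * carry_law k 4"
proof -
  note table = k4_out_table[unfolded list.map list.inject]
  show "16 * carry_law (Suc k) 0 = 16 * carry_law k 0 + 8 * carry_law k 1 + 3 * carry_law k 2"
    "16 * carry_law (Suc k) 1 = 3 * carry_law k 1 + 3 * carry_law k 2 + 3 * carry_law k 3"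
    "16 * carry_law (Suc k) 2 = 2 * carry_law k 1 + 4 * carry_law k 2 + 2 * carry_law k 3"
    "16 * carry_law (Suc k) 3 = 3 * carry_law k 1 + 3 * carry_law k 2 + 3 * carry_law k 3"
    "16 * carry_law (Suc k) 4 = 3 * carry_law k 2 + 8 * carry_law k 3 + 16 * carry_law k 4"
    by (simp_all add: table)
qed

declare carry_law.simps(2) [simp del]

text \<open>The last two parts are conservation of total mass and the martingale property.\<close>

lemma carry_law_invariants:
  "0 \<le> carry_law k 0" "0 \<le> carry_law k 1" "0 \<le> carry_law k 2" "0 \<le> carry_law k 3" "0 \<le> carry_law k 4"
  "carry_law k 0 + carry_law k 1 + carry_law k 2 + carry_law k 3 + carry_law k 4 = 1"
  "carry_law k 1 + 2 * carry_law k 2 + 3 * carry_law k 3 + 4 * carry_law k 4 = 1"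
proof (induction k)
  case (Suc k)
  note * = carry_law_step[of k] Suc
  {
    case 1 show ?case using * by linarith
  next
    case 2 show ?case using * by linarith
  next
    case 3 show ?case using * by linarith
  next
    case 4 show ?case using * by linarith
  next
    case 5 show ?case using * by linarith
  next
    case 6 show ?case using * by linarith
  next
    case 7 show ?case using * by linarith
  }
qed simp_all

text \<open>The mass on the transient states \<open>1, 2, 3\<close> decays geometrically: a step keeps at most \<open>10/16\<close> of
  it, the worst state being \<open>2\<close>.  The limit then follows from the martingale property.\<close>

lemma carry_law_extinct: "(\<lambda>k. carry_law k 0) \<longlonglongrightarrow> 3 / 4"
proof -
  define q where "q k = carry_law k 1 + carry_law k 2 + carry_law k 3" for k
  have q_le: "q k \<le> (10 / 16) ^ k" for k
  proof (induction k)
    case (Suc k)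
    have "16 * q (Suc k) \<le> 10 * q k"
      unfolding q_def distrib_left carry_law_step using carry_law_invariants(2,4)[of k] by linarith
    then have "q (Suc k) \<le> 10 / 16 * q k"
      by simp
    also have "\<dots> \<le> (10 / 16) ^ Suc k"
      using Suc by simp
    finally show ?case .
  qed (simp add: q_def)
  have "(\<lambda>k. (10 / 16 :: real) ^ k) \<longlonglongrightarrow> 0"
    by (intro LIMSEQ_power_zero) simp
  from tendsto_diff[OF tendsto_const this, of "3 / 4"]
  have lower: "(\<lambda>k. 3 / 4 - (10 / 16 :: real) ^ k) \<longlonglongrightarrow> 3 / 4"
    by simp
  show ?thesis
  proof (rule tendsto_sandwich[OF _ _ lower tendsto_const])
    show "\<forall>\<^sub>F k in sequentially. 3 / 4 - (10 / 16) ^ k \<le> carry_law k 0"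
    proof (intro always_eventually allI)
      show "3 / 4 - (10 / 16) ^ k \<le> carry_law k 0" for k
        using q_le[of k] carry_law_invariants[of k] unfolding q_def by linarith
    qed
    show "\<forall>\<^sub>F k in sequentially. carry_law k 0 \<le> 3 / 4"
    proof (intro always_eventually allI)
      show "carry_law k 0 \<le> 3 / 4" for k
        using carry_law_invariants[of k] by linarith
    qed
  qed
qed

text \<open>The degree is \<open>3\<close> in the last block before the sink, and the remaining \<open>deg v - 3\<close> edges lead to parts
  of the graph that can burn only after \<open>v\<close>; in an allowed sandpile, \<open>v\<close> holds that many particles
  for them.\<close>

definition reduced_height :: "(vertex \<Rightarrow> nat) \<Rightarrow> vertex \<Rightarrow> int" where
  "reduced_height \<sigma> v = int (\<sigma> v) - int (deg vicsek_E v) + 3"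

definition block_triple :: "(vertex \<Rightarrow> nat) \<Rightarrow> nat \<Rightarrow> triple" where
  "block_triple \<sigma> k =
     (reduced_height \<sigma> (k, k), reduced_height \<sigma> (Suc k, k), reduced_height \<sigma> (k, Suc k))"

text \<open>The number of particles that enter the successive diagonal blocks.\<close>

primrec carry :: "(vertex \<Rightarrow> nat) \<Rightarrow> nat \<Rightarrow> int" where
  "carry \<sigma> 0 = 1"
| "carry \<sigma> (Suc k) = k4_out (block_triple \<sigma> k) (carry \<sigma> k)"

lemma carry_range: "carry \<sigma> k \<in> {0, 1, 2, 3, 4}"
proof (induction k)
  case (Suc k)
  then show ?case
    using k4_odometer_table(3)[OF _ Suc] unfolding carry.simps k4_out_def by simp
qed simp

text \<open>The vertices of a diagonal block other than its exit \<open>(k + 1, k + 1)\<close>, which belongs to the next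
  block.\<close>

definition slots :: "nat \<Rightarrow> vertex set" where
  "slots k = {(k, k), (Suc k, k), (k, Suc k)}"

lemma block_slots: "block k = insert (Suc k, Suc k) (slots k)" "(Suc k, Suc k) \<notin> slots k"
  by (auto simp: block_def slots_def)

lemma card_block: "card (block k) = 4" "finite (block k)"
  by (simp_all add: block_def)

lemma slots_nonsink: "k < 3 ^ n \<Longrightarrow> slots k \<subseteq> vicsek_nonsink n"
proof
  fix v assume k: "k < 3 ^ n" and v: "v \<in> slots k"
  have "{v, (Suc k, Suc k)} \<in> vicsek_edges n"
    using v by (intro block_complete[OF k]) (auto simp: block_def slots_def)
  then have "v \<in> vicsek_verts n"
    by (rule vicsek_edge_ends)
  moreover have "v \<noteq> vicsek_sink n"
    using k v by (auto simp: slots_def vicsek_sink_def)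
  ultimately show "v \<in> vicsek_nonsink n"
    by (simp add: vicsek_nonsink_def)
qed

lemma spine_nonsink:
  assumes "v \<in> vicsek_nonsink n" "v \<in> spine"
  obtains k where "k < 3 ^ n" "v \<in> slots k"
proof -
  obtain x y where xy: "v = (x, y)"
    by (cases v)
  have le: "x \<le> 3 ^ n" "y \<le> 3 ^ n"
    using assms(1) vicsek_verts_le[of x y n] xy by (auto simp: vicsek_nonsink_def)
  have "\<not> (x = 3 ^ n \<and> y = 3 ^ n)"
    using assms(1) xy by (auto simp: vicsek_nonsink_def vicsek_sink_def)
  then have "min x y < 3 ^ n"
    using le by linarith
  moreover have "v \<in> slots (min x y)"
    using assms(2) xy by (auto simp: spine_def slots_def min_def)
  ultimately show thesis
    using that by blast
qed

lemma block_nbrs: "k < 3 ^ n \<Longrightarrow> v \<in> block k \<Longrightarrow> block k - {v} \<subseteq> nbrs (vicsek_edges n) v"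
  using block_complete[of k n v] by (auto simp: nbrs_def)

lemma slots_in_block: "v \<in> slots k \<Longrightarrow> v \<in> block j \<Longrightarrow> j = k \<or> Suc j = k \<and> v = (k, k)"
  by (auto simp: slots_def block_def)

lemma deg_ge_3: "k < 3 ^ n \<Longrightarrow> v \<in> block k \<Longrightarrow> 3 \<le> deg (vicsek_edges n) v"
  using card_mono[OF VG.finite_nbrs block_nbrs] card_block[of k] by (fastforce simp: deg_eq_card_nbrs)

lemma k4_recurrent_subset:
  assumes "(h x, h y, h z) \<in> k4_recurrent" "distinct [x, y, z]" "S \<subseteq> {x, y, z}" "S \<noteq> {}"
  shows "\<exists>v\<in>S. int (card S) - 1 \<le> h v"
proof -
  have "0 \<le> h x" "0 \<le> h y" "0 \<le> h z" "1 \<le> h x \<or> 1 \<le> h y" "1 \<le> h x \<or> 1 \<le> h z" "1 \<le> h y \<or> 1 \<le> h z"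
    "2 \<le> h x \<or> 2 \<le> h y \<or> 2 \<le> h z"
    using assms(1) by (auto simp: k4_recurrent_def)
  note h = this
  have card: "card {x, y} = 2" "card {x, z} = 2" "card {y, z} = 2" "card {x, y, z} = 3"
    using assms(2) by simp_all
  consider "S = {x}" | "S = {y}" | "S = {z}" | "S = {x, y}" | "S = {x, z}" | "S = {y, z}" | "S = {x, y, z}"
    using assms(3,4) by auto
  then show ?thesis
  proof cases
    case 1 then show ?thesis using h(1) by simp
  next
    case 2 then show ?thesis using h(2) by simp
  next
    case 3 then show ?thesis using h(3) by simp
  next
    case 4 then show ?thesis using h(4) card(1) by simp
  next
    case 5 then show ?thesis using h(5) card(2) by simp
  next
    case 6 then show ?thesis using h(6) card(3) by simp
  next
    case 7 then show ?thesis using h(7) card(4) by simp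
  qed
qed

lemma k4_recurrentI:
  assumes "distinct [x, y, z]" "\<And>v. v \<in> {x, y, z} \<Longrightarrow> h v \<le> 2"
    and fsc: "\<And>S. S \<subseteq> {x, y, z} \<Longrightarrow> S \<noteq> {} \<Longrightarrow> \<exists>v\<in>S. int (card S) - 1 \<le> h v"
  shows "(h x, h y, h z) \<in> k4_recurrent"
proof -
  have "0 \<le> h x" "0 \<le> h y" "0 \<le> h z"
    using fsc[of "{x}"] fsc[of "{y}"] fsc[of "{z}"] by simp_all
  moreover have "1 \<le> h x \<or> 1 \<le> h y" "1 \<le> h x \<or> 1 \<le> h z" "1 \<le> h y \<or> 1 \<le> h z"
    using fsc[of "{x, y}"] fsc[of "{x, z}"] fsc[of "{y, z}"] assms(1) by simp_all
  moreover have "2 \<le> h x \<or> 2 \<le> h y \<or> 2 \<le> h z"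
    using fsc[of "{x, y, z}"] assms(1) by simp
  moreover have "h x \<le> 2" "h y \<le> 2" "h z \<le> 2"
    using assms(2) by auto
  ultimately show ?thesis
    unfolding k4_recurrent_def by simp
qed

text \<open>If the triple of block \<open>k\<close> is not recurrent, take a set \<open>S\<close> of vertices of the block that violates
  the criterion, and add to it everything that is separated from the sink by \<open>S\<close>.  Added vertices have
  all their neighbours in the enlarged set \<open>F\<close>, and a vertex of \<open>S\<close> has all its neighbours in \<open>F\<close>
  except those in the block outside \<open>S\<close>.  So \<open>F\<close> is a forbidden subconfiguration.\<close>

lemma block_triple_recurrent:
  assumes al: "allowed (vicsek_edges n) (vicsek_nonsink n) \<sigma>"
    and st: "stable (vicsek_edges n) (vicsek_nonsink n) \<sigma>" and k: "k < 3 ^ n"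
  shows "block_triple \<sigma> k \<in> k4_recurrent"
  unfolding block_triple_def
proof (rule k4_recurrentI[of "(k, k)" "(Suc k, k)" "(k, Suc k)" "reduced_height \<sigma>"])
  note sub = slots_nonsink[OF k]
  show "reduced_height \<sigma> v \<le> 2" if "v \<in> {(k, k), (Suc k, k), (k, Suc k)}" for v
  proof -
    have "v \<in> vicsek_nonsink n"
      using sub that by (auto simp: slots_def)
    then show ?thesis
      using st by (auto simp: reduced_height_def deg_vicsek_E stable_def)
  qed
  fix S :: "vertex set" assume S: "S \<subseteq> {(k, k), (Suc k, k), (k, Suc k)}" "S \<noteq> {}"
  then have S_slots: "S \<subseteq> slots k"
    by (simp add: slots_def)
  show "\<exists>v\<in>S. int (card S) - 1 \<le> reduced_height \<sigma> v"
  proof -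
    obtain \<pi> where \<pi>: "spine_retraction n \<pi>"
      using spine_retraction_exists by blast
    then have edge: "(\<exists>k<3 ^ n. v \<in> block k \<and> w \<in> block k) \<or> \<pi> v = \<pi> w"
      if "{v, w} \<in> vicsek_edges n" for v w
      using that unfolding spine_retraction_def by blast
    have fix_block: "\<pi> v = v" if "v \<in> block j" "j < 3 ^ n" for v j
      using \<pi> that block_spine[of j] block_in_verts[of j n] unfolding spine_retraction_def by blast
    \<comment> \<open>The part of the diagonal cut off from the sink by \<open>S\<close>: nothing beyond \<open>S\<close> itself, unless
  \<open>S\<close> contains the entrance of the block.\<close>
    define S' where "S' = S \<union> (if (k, k) \<in> S then \<Union>j<k. block j else {})"
    define F where "F = {v \<in> vicsek_verts n. \<pi> v \<in> S'}"
    have "vicsek_sink n \<notin> S'"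
      using S_slots k by (auto simp: S'_def vicsek_sink_def slots_def block_def split: if_splits)
    moreover have "\<pi> (vicsek_sink n) = vicsek_sink n"
      using \<pi> sink_spine vicsek_sink_vert unfolding spine_retraction_def by blast
    ultimately have F_sub: "F \<subseteq> vicsek_nonsink n"
      by (auto simp: F_def vicsek_nonsink_def)
    have S_F: "S \<subseteq> F"
    proof
      fix v assume v: "v \<in> S"
      then have "v \<in> block k" "v \<in> vicsek_verts n"
        using S_slots sub by (auto simp: block_slots vicsek_nonsink_def)
      then show "v \<in> F"
        using fix_block[OF _ k] v by (auto simp: F_def S'_def)
    qed
    have leave: "v \<in> S \<and> w \<in> block k - S" if v: "v \<in> F" and w: "w \<in> nbrs (vicsek_edges n) v" "w \<notin> F" for v w
    proof -
      have e: "{v, w} \<in> vicsek_edges n"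
        using w(1) by (simp add: nbrs_def)
      have wV: "w \<in> vicsek_verts n"
        using vicsek_edge_ends(3)[OF e] .
      have "\<pi> v \<noteq> \<pi> w"
        using v w(2) wV by (auto simp: F_def)
      with edge[OF e] obtain j where j: "j < 3 ^ n" "v \<in> block j" "w \<in> block j"
        by blast
      then have vS: "v \<in> S'" and wS: "w \<notin> S'"
        using v w(2) wV fix_block by (auto simp: F_def)
      show ?thesis
      proof (cases "v \<in> S")
        case True
        then have "j = k \<or> Suc j = k \<and> v = (k, k)"
          using S_slots j(2) slots_in_block by blast
        then have "j = k"
          using True wS j(3) by (auto simp: S'_def)
        then show ?thesis
          using True wS j(3) by (auto simp: S'_def)
      next
        case False
        then obtain i where i: "(k, k) \<in> S" "i < k" "v \<in> block i"
          using vS by (auto simp: S'_def split: if_splits)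
        then have "v \<noteq> (k, k)"
          using False by blast
        then have "j < k"
          using i(2,3) j(2) by (auto simp: block_def)
        then show ?thesis
          using i(1) j(3) wS by (auto simp: S'_def)
      qed
    qed
    have finF: "finite F"
      using F_sub VS.finite_W by (rule finite_subset)
    then obtain v where v: "v \<in> F" "card (nbrs (vicsek_edges n) v \<inter> F) \<le> \<sigma> v"
      using al F_sub S_F S(2) unfolding allowed_def by blast
    have vW: "v \<in> vicsek_nonsink n"
      using v(1) F_sub by blast
    have split: "deg (vicsek_edges n) v =
        card (nbrs (vicsek_edges n) v \<inter> F) + card (nbrs (vicsek_edges n) v - F)"
      unfolding deg_eq_card_nbrs using VG.finite_nbrs[of n v] card_Int_Diff by blast
    have "v \<in> S"
    proof (rule ccontr)
      assume "v \<notin> S"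
      then have "nbrs (vicsek_edges n) v - F = {}"
        using leave[OF v(1)] by blast
      then have "card (nbrs (vicsek_edges n) v - F) = 0"
        by (simp only: card.empty)
      moreover have "\<sigma> v < deg (vicsek_edges n) v"
        using st vW by (simp add: stable_def)
      ultimately show False
        using split v(2) by linarith
    qed
    have S_block: "S \<subseteq> block k"
      using S_slots by (auto simp: block_slots)
    have "card (nbrs (vicsek_edges n) v - F) \<le> card (block k - S)"
      using leave[OF v(1)] card_block by (intro card_mono) auto
    also have "\<dots> = 4 - card S"
      using card_Diff_subset[OF finite_subset[OF S_block card_block(2)] S_block] card_block(1)[of k] by simp
    finally have "int (card S) - 1 \<le> reduced_height \<sigma> v"
      using split v(2) card_mono[OF card_block(2) S_block] card_block(1)[of k]
      unfolding reduced_height_def deg_vicsek_E[OF vW] by linarith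
    then show ?thesis
      using \<open>v \<in> S\<close> by blast
  qed
qed simp

text \<open>Given a set \<open>F\<close>, look at the last block of the diagonal that it meets: the exit of that block is
  not in \<open>F\<close>, so some vertex of \<open>F\<close> in the block has enough particles even when all its
  neighbours outside the block are in \<open>F\<close>.\<close>

lemma allowed_from_triples:
  assumes off: "allowed (vicsek_edges n) (vicsek_nonsink n - spine) \<sigma>"
    and T: "\<And>k. k < 3 ^ n \<Longrightarrow> block_triple \<sigma> k \<in> k4_recurrent"
  shows "allowed (vicsek_edges n) (vicsek_nonsink n) \<sigma>"
  unfolding allowed_def
proof (intro allI impI)
  fix F assume F: "finite F \<and> F \<noteq> {} \<and> F \<subseteq> vicsek_nonsink n"
  show "\<exists>v\<in>F. card (nbrs (vicsek_edges n) v \<inter> F) \<le> \<sigma> v"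
  proof (cases "F \<inter> spine = {}")
    case True
    then show ?thesis
      using off F unfolding allowed_def by (metis Diff_eq Int_subset_iff disjoint_eq_subset_Compl)
  next
    case False
    define K where "K = {k. k < 3 ^ n \<and> F \<inter> slots k \<noteq> {}}"
    have "K \<noteq> {}"
      using False F spine_nonsink unfolding K_def by (smt (verit) Int_iff all_not_in_conv mem_Collect_eq subsetD)
    moreover have "finite K"
      by (simp add: K_def)
    ultimately obtain k where k: "k < 3 ^ n" "F \<inter> slots k \<noteq> {}" and max: "\<And>j. j \<in> K \<Longrightarrow> j \<le> k"
      using Max_in[of K] Max_ge[of K] unfolding K_def by blast
    define S where "S = F \<inter> slots k"
    have "\<exists>v\<in>S. int (card S) - 1 \<le> reduced_height \<sigma> v"
      using T[OF k(1)] k(2) unfolding block_triple_def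
      by (intro k4_recurrent_subset[of "reduced_height \<sigma>" "(k, k)" "(Suc k, k)" "(k, Suc k)"])
        (auto simp: S_def slots_def)
    then obtain v where v: "v \<in> S" "int (card S) - 1 \<le> reduced_height \<sigma> v"
      by blast
    have root: "(Suc k, Suc k) \<notin> F"
    proof
      assume r: "(Suc k, Suc k) \<in> F"
      then have "(Suc k, Suc k) \<noteq> (3 ^ n, 3 ^ n)"
        using F by (auto simp: vicsek_nonsink_def vicsek_sink_def)
      then have "Suc k < 3 ^ n"
        using k(1) by auto
      then have "Suc k \<in> K"
        using r by (auto simp: K_def slots_def)
      then show False
        using max[of "Suc k"] by simp
    qed
    have vk: "v \<in> block k" "v \<in> vicsek_nonsink n"
      using v(1) F by (auto simp: S_def block_slots)
    have S_block: "S \<subseteq> block k"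
      by (auto simp: S_def block_slots)
    have "card S + card (block k - S) = 4"
      using card_Diff_subset[OF finite_subset[OF S_block card_block(2)] S_block]
        card_mono[OF card_block(2) S_block] card_block(1)[of k] by linarith
    moreover have "card (block k - S) \<le> card (nbrs (vicsek_edges n) v - F)"
    proof (rule card_mono)
      show "block k - S \<subseteq> nbrs (vicsek_edges n) v - F"
        using block_nbrs[OF k(1) vk(1)] v(1) root by (auto simp: S_def block_slots)
    qed (simp add: VG.finite_nbrs)
    moreover have "deg (vicsek_edges n) v =
        card (nbrs (vicsek_edges n) v \<inter> F) + card (nbrs (vicsek_edges n) v - F)"
      unfolding deg_eq_card_nbrs using VG.finite_nbrs[of n v] card_Int_Diff by blast
    ultimately have "card (nbrs (vicsek_edges n) v \<inter> F) \<le> \<sigma> v"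
      using v(2) unfolding reduced_height_def deg_vicsek_E[OF vk(2)] by linarith
    then show ?thesis
      using v(1) by (auto simp: S_def)
  qed
qed

definition set_triple :: "(vertex \<Rightarrow> nat) \<Rightarrow> nat \<Rightarrow> triple \<Rightarrow> vertex \<Rightarrow> nat" where
  "set_triple \<sigma> k t = (case t of (a, b, c) \<Rightarrow>
     \<sigma>((k, k) := nat (a + int (deg vicsek_E (k, k)) - 3),
       (Suc k, k) := nat (b + int (deg vicsek_E (Suc k, k)) - 3),
       (k, Suc k) := nat (c + int (deg vicsek_E (k, Suc k)) - 3)))"

lemma set_triple_outside: "v \<notin> slots k \<Longrightarrow> set_triple \<sigma> k t v = \<sigma> v"
  by (auto simp: set_triple_def slots_def split: prod.split)

lemma set_triple_set_triple: "set_triple (set_triple \<sigma> k t) k t' = set_triple \<sigma> k t'"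
  by (auto simp: set_triple_def fun_eq_iff split: prod.split)

lemma set_triple_block_triple: "set_triple \<sigma> k (block_triple \<sigma> k) = \<sigma>"
  by (auto simp: set_triple_def block_triple_def reduced_height_def fun_eq_iff)

lemma block_triple_set_triple_other:
  assumes "j \<noteq> k"
  shows "block_triple (set_triple \<sigma> k t) j = block_triple \<sigma> j"
proof -
  have "(j, j) \<notin> slots k" "(Suc j, j) \<notin> slots k" "(j, Suc j) \<notin> slots k"
    using assms by (auto simp: slots_def)
  then show ?thesis
    by (simp add: block_triple_def reduced_height_def set_triple_outside)
qed

lemma deg_vicsek_E_ge_3: "v \<in> slots k \<Longrightarrow> 3 \<le> deg vicsek_E v"
proof -
  assume v: "v \<in> slots k"
  have k: "k < 3 ^ k"
    by (rule power_gt_expt) simp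
  show "3 \<le> deg vicsek_E v"
    using deg_ge_3[OF k, of v] deg_vicsek_E[of v k] slots_nonsink[OF k] v by (auto simp: block_slots)
qed

lemma block_triple_set_triple:
  assumes "t \<in> k4_recurrent"
  shows "block_triple (set_triple \<sigma> k t) k = t"
proof -
  have "3 \<le> deg vicsek_E (k, k)" "3 \<le> deg vicsek_E (Suc k, k)" "3 \<le> deg vicsek_E (k, Suc k)"
    by (auto intro!: deg_vicsek_E_ge_3 simp: slots_def)
  moreover obtain a b c where t: "t = (a, b, c)"
    by (cases t)
  moreover have "0 \<le> a" "0 \<le> b" "0 \<le> c"
    using assms t by (simp_all add: k4_recurrent_def)
  ultimately show ?thesis
    by (simp add: block_triple_def set_triple_def reduced_height_def)
qed

text \<open>By \<open>block_triple_recurrent\<close> and \<open>allowed_from_triples\<close>, being allowed is a condition on each triple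
  of the diagonal separately, together with a condition that involves no vertex of the diagonal blocks.\<close>

lemma set_triple_recurrent:
  assumes \<sigma>: "\<sigma> \<in> recurrent_sandpiles n" and t: "t \<in> k4_recurrent" and k: "k < 3 ^ n"
  shows "set_triple \<sigma> k t \<in> recurrent_sandpiles n"
proof -
  let ?\<rho> = "set_triple \<sigma> k t"
  have al: "allowed (vicsek_edges n) (vicsek_nonsink n) \<sigma>"
    and st: "stable (vicsek_edges n) (vicsek_nonsink n) \<sigma>" and ext: "\<sigma> \<in> extensional (vicsek_nonsink n)"
    using \<sigma> by (auto simp: recurrent_sandpiles_eq)
  have "?\<rho> \<in> extensional (vicsek_nonsink n)"
    unfolding extensional_def
  proof (intro CollectI allI impI)
    fix v assume v: "v \<notin> vicsek_nonsink n"
    then have "v \<notin> slots k"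
      using slots_nonsink[OF k] by blast
    from set_triple_outside[OF this] show "?\<rho> v = undefined"
      using extensional_arb[OF ext v] by (rule trans)
  qed
  moreover have "stable (vicsek_edges n) (vicsek_nonsink n) ?\<rho>"
    unfolding stable_def
  proof
    fix v assume v: "v \<in> vicsek_nonsink n"
    show "?\<rho> v < deg (vicsek_edges n) v"
    proof (cases "v \<in> slots k")
      case False
      then have "?\<rho> v = \<sigma> v"
        by (rule set_triple_outside)
      moreover have "\<sigma> v < deg (vicsek_edges n) v"
        using st v unfolding stable_def by blast
      ultimately show ?thesis
        by (simp only:)
    next
      case True
      obtain a b c where abc: "t = (a, b, c)"
        by (cases t)
      then have le: "a \<le> 2" "b \<le> 2" "c \<le> 2"
        using t by (simp_all add: k4_recurrent_def)
      note deg = deg_vicsek_E_ge_3[OF True] deg_vicsek_E[OF v]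
      consider "v = (k, k)" | "v = (Suc k, k)" | "v = (k, Suc k)"
        using True by (auto simp: slots_def)
      then show ?thesis
        using deg le by cases (simp_all add: set_triple_def abc)
    qed
  qed
  moreover have "allowed (vicsek_edges n) (vicsek_nonsink n) ?\<rho>"
  proof (rule allowed_from_triples)
    have "allowed (vicsek_edges n) (vicsek_nonsink n - spine) \<sigma>"
      using al unfolding allowed_def by blast
    then show "allowed (vicsek_edges n) (vicsek_nonsink n - spine) ?\<rho>"
    proof (rule allowed_mono)
      fix v assume "v \<in> vicsek_nonsink n - spine"
      moreover have "slots k \<subseteq> spine"
        by (auto simp: slots_def spine_def)
      ultimately have "v \<notin> slots k"
        by blast
      from set_triple_outside[OF this] show "\<sigma> v \<le> ?\<rho> v"
        by (rule eq_refl[OF sym])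
    qed
    show "block_triple ?\<rho> j \<in> k4_recurrent" if "j < 3 ^ n" for j
      using block_triple_set_triple[OF t] block_triple_set_triple_other[of j k] t
        block_triple_recurrent[OF al st that] by (cases "j = k") auto
  qed
  ultimately show ?thesis
    by (simp add: recurrent_sandpiles_eq)
qed

lemma carry_cong: "(\<And>i. i < k \<Longrightarrow> block_triple \<sigma> i = block_triple \<tau> i) \<Longrightarrow> carry \<sigma> k = carry \<tau> k"
  by (induction k) auto

lemma carry_set_triple: "carry (set_triple \<sigma> k t) k = carry \<sigma> k"
  by (rule carry_cong) (simp add: block_triple_set_triple_other)

lemma recurrent_block_triple:
  "\<sigma> \<in> recurrent_sandpiles n \<Longrightarrow> k < 3 ^ n \<Longrightarrow> block_triple \<sigma> k \<in> k4_recurrent"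
  using block_triple_recurrent[of n \<sigma> k] by (simp add: recurrent_sandpiles_eq)

text \<open>\<open>carry \<sigma> k\<close> depends only on the blocks before block \<open>k\<close>, so overwriting the triple of block \<open>k\<close> is a
  bijection between the recurrent sandpiles with any two prescribed triples there.  This is the
  independence and uniformity of the next triple.\<close>

lemma card_carry_triple:
  assumes k: "k < 3 ^ n" and t: "t \<in> k4_recurrent"
  shows "card {\<sigma> \<in> recurrent_sandpiles n. carry \<sigma> k = i} =
     16 * card {\<sigma> \<in> recurrent_sandpiles n. carry \<sigma> k = i \<and> block_triple \<sigma> k = t}"
proof -
  let ?A = "\<lambda>t. {\<sigma> \<in> recurrent_sandpiles n. carry \<sigma> k = i \<and> block_triple \<sigma> k = t}"
  have same: "card (?A t') = card (?A t)" if t': "t' \<in> k4_recurrent" for t'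
  proof (rule bij_betw_same_card)
    show "bij_betw (\<lambda>\<sigma>. set_triple \<sigma> k t) (?A t') (?A t)"
      using t t' k
      by (intro bij_betw_byWitness[of _ "\<lambda>\<sigma>. set_triple \<sigma> k t'"])
        (auto simp: set_triple_set_triple set_triple_block_triple set_triple_recurrent
          carry_set_triple block_triple_set_triple)
  qed
  have "{\<sigma> \<in> recurrent_sandpiles n. carry \<sigma> k = i} = (\<Union>t'\<in>k4_recurrent. ?A t')"
    using recurrent_block_triple[OF _ k] by auto
  also have "card \<dots> = (\<Sum>t'\<in>k4_recurrent. card (?A t'))"
    using card_k4_recurrent finite_recurrent by (intro card_UN_disjoint) auto
  also have "\<dots> = (\<Sum>t'\<in>k4_recurrent. card (?A t))"
    by (intro sum.cong same) auto
  finally show ?thesis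
    by (simp add: card_k4_recurrent)
qed

lemma carry_law_finite:
  "k \<le> 3 ^ n \<Longrightarrow>
     real (card {\<sigma> \<in> recurrent_sandpiles n. carry \<sigma> k = j}) = carry_law k j * card (recurrent_sandpiles n)"
proof (induction k arbitrary: j)
  case 0
  then show ?case
    by auto
next
  case (Suc k)
  let ?R = "recurrent_sandpiles n"
  let ?A = "\<lambda>(i, t). {\<sigma> \<in> ?R. carry \<sigma> k = i \<and> block_triple \<sigma> k = t}"
  let ?I = "SIGMA i:{0, 1, 2, 3, 4}. {t \<in> k4_recurrent. k4_out t i = j}"
  have k: "k < 3 ^ n" "k \<le> 3 ^ n"
    using Suc.prems by auto
  have fin: "finite {t \<in> k4_recurrent. k4_out t i = j}" for i
    using card_k4_recurrent(2) by simp
  have "{\<sigma> \<in> ?R. carry \<sigma> (Suc k) = j} = (\<Union>p\<in>?I. ?A p)"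
    using carry_range[of _ k] recurrent_block_triple[OF _ k(1)] by fastforce
  also have "card \<dots> = (\<Sum>p\<in>?I. card (?A p))"
    using finite_recurrent fin by (intro card_UN_disjoint finite_SigmaI) auto
  also have "real \<dots> = (\<Sum>p\<in>?I. real (card (?A p)))"
    by simp
  also have "\<dots> = (\<Sum>(i, t)\<in>?I. carry_law k i * card ?R / 16)"
  proof (intro sum.cong refl)
    fix p assume "p \<in> ?I"
    then obtain i t where p: "p = (i, t)" "t \<in> k4_recurrent"
      by blast
    show "real (card (?A p)) = (case p of (i, t) \<Rightarrow> carry_law k i * card ?R / 16)"
      using card_carry_triple[OF k(1) p(2), of i] Suc.IH[OF k(2), of i] p(1) by simp
  qed
  also have "\<dots> = (\<Sum>i\<in>{0, 1, 2, 3, 4}. \<Sum>t\<in>{t \<in> k4_recurrent. k4_out t i = j}. carry_law k i * card ?R / 16)"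
    using fin by (subst sum.Sigma) auto
  also have "\<dots> = carry_law (Suc k) j * card ?R"
    unfolding carry_law.simps(2) sum_distrib_right by (intro sum.cong) auto
  finally show ?case .
qed

lemma prob_carry:
  assumes "k \<le> 3 ^ n"
  shows "measure_pmf.prob (vicsek_mu n) {\<eta>. carry \<eta> k = j} = carry_law k j"
proof -
  have "0 < card (recurrent_sandpiles n)"
    using finite_recurrent recurrent_nonempty by (simp add: card_gt_0_iff)
  then show ?thesis
    using carry_law_finite[OF assms, of j] unfolding vicsek_mu_def
    by (subst measure_pmf_of_set) (auto simp: finite_recurrent recurrent_nonempty Int_def)
qed

section \<open>Stabilization on the infinite graph\<close>

lemma nbrs_off_spine:
  assumes "spine_retraction n \<pi>" "w \<in> nbrs (vicsek_edges n) v" "v \<notin> spine \<or> w \<notin> spine"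
  shows "\<pi> w = \<pi> v"
  using assms block_spine unfolding spine_retraction_def nbrs_def by (metis mem_Collect_eq subsetD)

lemma nbrs_of_slot:
  assumes k: "k < 3 ^ n" and v: "v \<in> slots k"
  shows "nbrs (vicsek_edges n) v \<inter> spine =
    (block k - {v}) \<union> (if v = (k, k) \<and> k \<noteq> 0 then slots (k - 1) else {})"
    (is "_ = _ \<union> ?prev")
proof
  have vk: "v \<in> block k"
    using v by (simp add: block_slots)
  show "nbrs (vicsek_edges n) v \<inter> spine \<subseteq> (block k - {v}) \<union> ?prev"
  proof
    fix w assume w: "w \<in> nbrs (vicsek_edges n) v \<inter> spine"
    then have e: "{v, w} \<in> vicsek_edges n"
      by (simp add: nbrs_def)
    obtain \<pi> where \<pi>: "spine_retraction n \<pi>"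
      using spine_retraction_exists by blast
    have "\<pi> v = v" "\<pi> w = w"
      using \<pi> w vicsek_edge_ends(2,3)[OF e] vk block_spine unfolding spine_retraction_def by blast+
    then have "\<pi> v \<noteq> \<pi> w"
      using vicsek_edge_ends(1)[OF e] by simp
    then obtain j where j: "v \<in> block j" "w \<in> block j"
      using \<pi> e unfolding spine_retraction_def by blast
    consider "j = k" | "Suc j = k" "v = (k, k)"
      using slots_in_block[OF v j(1)] by blast
    then show "w \<in> (block k - {v}) \<union> ?prev"
      using j(2) vicsek_edge_ends(1)[OF e] by cases (auto simp: block_slots)
  qed
  have "slots (k - 1) \<subseteq> nbrs (vicsek_edges n) v" if "v = (k, k) \<and> k \<noteq> 0"
  proof -
    have "v \<in> block (k - 1)" "v \<notin> slots (k - 1)"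
      using that by (auto simp: block_def slots_def)
    moreover have "k - 1 < 3 ^ n"
      using k by linarith
    ultimately show ?thesis
      using block_nbrs[of "k - 1" n v] by (auto simp: block_slots)
  qed
  moreover have "slots (k - 1) \<subseteq> spine"
    using block_spine by (auto simp: block_slots)
  ultimately show "(block k - {v}) \<union> ?prev \<subseteq> nbrs (vicsek_edges n) v \<inter> spine"
    using block_nbrs[OF k vk] block_spine[of k] by auto
qed

text \<open>The net number of particles that enter block \<open>k\<close> from block \<open>k - 1\<close> under the toppling vector \<open>f\<close>;
  for \<open>k = 0\<close> it is the particle added at the origin.\<close>

definition inflow :: "(vertex \<Rightarrow> int) \<Rightarrow> nat \<Rightarrow> int" where
  "inflow f k = (if k = 0 then 1 else \<Sum>w\<in>slots (k - 1). f w - f (k, k))"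

text \<open>The Laplacian at a vertex of block \<open>k\<close> splits into the contributions of block \<open>k\<close>, of the
  preceding block (for the entrance only) and of the branches hanging off there.  At the origin the
  term \<open>inflow f 0 = 1\<close> has to be compensated, since it comes from no edge.\<close>

lemma lap_at_slot:
  assumes k: "k < 3 ^ n" and v: "v \<in> slots k"
  shows "lap (vicsek_edges n) f v =
    (\<Sum>w\<in>slots k. f v - f w) + (f v - f (Suc k, Suc k))
    - (of_bool (v = (k, k)) * inflow f k - of_bool (v = (0, 0)))
    + (\<Sum>w\<in>nbrs (vicsek_edges n) v - spine. f v - f w)"
proof -
  let ?N = "nbrs (vicsek_edges n) v"
  let ?g = "\<lambda>w. f v - f w"
  let ?prev = "if v = (k, k) \<and> k \<noteq> 0 then slots (k - 1) else {}"
  have fin: "finite (slots j)" for j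
    by (simp add: slots_def)
  have "lap (vicsek_edges n) f v = sum ?g (?N \<inter> spine) + sum ?g (?N - spine)"
    unfolding lap_def by (rule sum.Int_Diff) (rule VG.finite_nbrs)
  also have "sum ?g (?N \<inter> spine) = sum ?g (block k - {v}) + sum ?g ?prev"
    unfolding nbrs_of_slot[OF k v]
    by (rule sum.union_disjoint) (auto simp: card_block fin block_def slots_def)
  also have "sum ?g (block k - {v}) = sum ?g (block k)"
    by (rule sum.mono_neutral_left) (auto simp: card_block)
  also have "\<dots> = (\<Sum>w\<in>slots k. f v - f w) + (f v - f (Suc k, Suc k))"
    unfolding block_slots(1) using block_slots(2)[of k] fin by simp
  also have "sum ?g ?prev = - (of_bool (v = (k, k)) * inflow f k - of_bool (v = (0, 0)))"
  proof (cases "v = (k, k) \<and> k \<noteq> 0")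
    case True
    then have "sum ?g ?prev = (\<Sum>w\<in>slots (k - 1). - (f w - f (k, k)))"
      by simp
    also have "\<dots> = - inflow f k"
      using True by (simp only: sum_negf inflow_def if_False)
    finally show ?thesis
      using True by simp
  next
    case False
    moreover have "v = (k, k) \<or> v \<noteq> (0, 0)"
      using v by (auto simp: slots_def)
    ultimately consider "v \<noteq> (k, k)" "v \<noteq> (0, 0)" | "v = (0, 0)" "k = 0"
      by blast
    then show ?thesis
      by cases (simp_all add: inflow_def)
  qed
  finally show ?thesis
    by (simp only: add_uminus_conv_diff)
qed

text \<open>A branch never returns more particles than it receives.  Otherwise \<open>f\<close> would be smaller somewhere
  in a branch than at its attachment vertex, and the set where the deficit is maximal would be a
  forbidden subconfiguration.\<close>

lemma branch_no_inflow:
  assumes \<pi>: "spine_retraction n \<pi>"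
    and al: "allowed (vicsek_edges n) (vicsek_nonsink n) \<sigma>"
    and st: "\<And>v. v \<in> vicsek_nonsink n - spine \<Longrightarrow>
      int (\<sigma> v) - lap (vicsek_edges n) f v < int (deg (vicsek_edges n) v)"
    and v: "v \<in> vicsek_verts n"
  shows "f (\<pi> v) \<le> f v"
proof (rule ccontr)
  assume "\<not> f (\<pi> v) \<le> f v"
  define g where "g w = f (\<pi> w) - f w" for w
  define D where "D = vicsek_nonsink n - spine"
  have D: "w \<in> D" if "w \<in> vicsek_verts n" "w \<notin> spine" for w
    using that sink_spine[of n] unfolding D_def vicsek_nonsink_def by blast
  have g_spine: "g w = 0" if "w \<in> spine" "w \<in> vicsek_verts n" for w
  proof -
    have "\<pi> w = w"
      using \<pi> that unfolding spine_retraction_def by blast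
    then show ?thesis
      by (simp add: g_def)
  qed
  have "0 < g v"
    using \<open>\<not> f (\<pi> v) \<le> f v\<close> by (simp add: g_def)
  then have vD: "v \<in> D"
    using g_spine[OF _ v] D[OF v] by fastforce
  have finD: "finite D"
    using VS.finite_W by (simp add: D_def)
  define M where "M = Max (g ` D)"
  have le: "g w \<le> M" if "w \<in> D" for w
    unfolding M_def using that finD by simp
  have "M \<in> g ` D"
    unfolding M_def using finD vD by (intro Max_in) auto
  have "0 < M"
    using \<open>0 < g v\<close> le[OF vD] by simp
  define F where "F = {w \<in> D. g w = M}"
  have "finite F \<and> F \<noteq> {} \<and> F \<subseteq> vicsek_nonsink n"
  proof (intro conjI)
    show "finite F"
      using finD by (simp add: F_def)
    show "F \<noteq> {}"
      using \<open>M \<in> g ` D\<close> unfolding F_def by blast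
    show "F \<subseteq> vicsek_nonsink n"
      unfolding F_def D_def by blast
  qed
  then obtain x where x: "x \<in> F" "card (nbrs (vicsek_edges n) x \<inter> F) \<le> \<sigma> x"
    using al unfolding allowed_def by blast
  then have xD: "x \<in> vicsek_nonsink n - spine"
    by (auto simp: F_def D_def)
  have nb: "g w \<le> M \<and> (w \<notin> F \<longrightarrow> g w < M)" if "w \<in> nbrs (vicsek_edges n) x" for w
  proof -
    have "w \<in> vicsek_verts n"
      using that nbrs_vicsek_edges_subset by blast
    then show ?thesis
      using D[of w] le[of w] g_spine[of w] \<open>0 < M\<close> by (cases "w \<in> spine") (auto simp: F_def)
  qed
  have "lap (vicsek_edges n) f x = - lap (vicsek_edges n) g x"
    unfolding lap_def sum_negf[symmetric]
    using xD nbrs_off_spine[OF \<pi>] by (intro sum.cong refl) (simp add: g_def)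
  moreover have "int (deg (vicsek_edges n) x) - int (card (nbrs (vicsek_edges n) x \<inter> F)) \<le> lap (vicsek_edges n) g x"
    using x(1) nb by (intro VG.lap_ge_at_max[of g x M]) (auto simp: F_def)
  ultimately show False
    using st[OF xD] x(2) by linarith
qed

text \<open>The properties that \<open>\<mu>\<close>-almost every sandpile inherits from the recurrent sandpiles of the
  finite graphs.\<close>

definition good :: "(vertex \<Rightarrow> nat) \<Rightarrow> bool" where
  "good \<eta> \<longleftrightarrow> stable vicsek_E vicsek_V \<eta> \<and> (\<forall>k. block_triple \<eta> k \<in> k4_recurrent) \<and>
     allowed vicsek_E vicsek_V \<eta>"

lemma allowed_restrict:
  assumes "allowed vicsek_E vicsek_V \<eta>"
  shows "allowed (vicsek_edges n) (vicsek_nonsink n) \<eta>"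
  unfolding allowed_def
proof (intro allI impI)
  fix F assume F: "finite F \<and> F \<noteq> {} \<and> F \<subseteq> vicsek_nonsink n"
  then have "F \<subseteq> vicsek_V"
    by (auto simp: vicsek_V_eq)
  then obtain v where "v \<in> F" "card (nbrs vicsek_E v \<inter> F) \<le> \<eta> v"
    using assms F unfolding allowed_def by blast
  then show "\<exists>v\<in>F. card (nbrs (vicsek_edges n) v \<inter> F) \<le> \<eta> v"
    using nbrs_vicsek_E[of v n] F by auto
qed

lemma sum_slots: "(\<Sum>w\<in>slots k. h w) = h (k, k) + h (Suc k, k) + h (k, Suc k)"
  by (simp add: slots_def add.assoc)

text \<open>Any stabilizing vector moves at least \<open>carry \<eta> k\<close> particles into block \<open>k\<close>.  Relative to the exit of the
  block it is a stabilizing vector for \<open>K\<^sub>4\<close> with the inflow as input, and the least one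
  of these already sends that many particles to the exit.\<close>

lemma stabilizing_inflow:
  assumes good: "good \<eta>"
    and u: "stabilizing vicsek_E vicsek_V (add_particle vicsek_V (0, 0) \<eta>) u"
    and f: "f = (\<lambda>v. int (u v))"
  shows "k \<le> 3 ^ n \<Longrightarrow> carry \<eta> k \<le> inflow f k"
proof (induction k)
  case 0
  then show ?case
    by (simp add: inflow_def)
next
  case (Suc k)
  have k: "k < 3 ^ n" and IH: "carry \<eta> k \<le> inflow f k"
    using Suc by auto
  have st: "int (\<eta> v) + of_bool (v = (0, 0)) - lap (vicsek_edges n) f v < int (deg (vicsek_edges n) v)"
    if "v \<in> vicsek_nonsink n" for v
  proof -
    have "v \<in> vicsek_V"
      using that by (auto simp: vicsek_V_eq)
    then show ?thesis
      using u that unfolding stabilizing_def f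
      by (auto simp: add_particle_eq add_particles_def lap_vicsek_E deg_vicsek_E)
  qed
  obtain \<pi> where \<pi>: "spine_retraction n \<pi>"
    using spine_retraction_exists by blast
  have origin: "(0, 0) \<in> spine"
    by (simp add: spine_def)
  have branch: "(\<Sum>w\<in>nbrs (vicsek_edges n) v - spine. f v - f w) \<le> 0" if "v \<in> slots k" for v
  proof (intro sum_nonpos)
    fix w assume w: "w \<in> nbrs (vicsek_edges n) v - spine"
    have "v \<in> spine" "v \<in> vicsek_verts n"
      using that block_spine[of k] block_in_verts[OF k] by (auto simp: block_slots)
    then have "\<pi> w = v"
      using nbrs_off_spine[OF \<pi>, of w v] w \<pi> unfolding spine_retraction_def by auto
    moreover have "f (\<pi> w) \<le> f w"
    proof (rule branch_no_inflow[OF \<pi>])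
      show "allowed (vicsek_edges n) (vicsek_nonsink n) \<eta>"
        using good by (auto simp: good_def intro: allowed_restrict)
      show "int (\<eta> x) - lap (vicsek_edges n) f x < int (deg (vicsek_edges n) x)"
        if "x \<in> vicsek_nonsink n - spine" for x
      proof -
        have "x \<noteq> (0, 0)"
          using that origin by blast
        then show ?thesis
          using st[of x] that by simp
      qed
      show "w \<in> vicsek_verts n"
        using w nbrs_vicsek_edges_subset by blast
    qed
    ultimately show "f v - f w \<le> 0"
      by simp
  qed
  have local: "reduced_height \<eta> v + of_bool (v = (k, k)) * inflow f k
      - ((\<Sum>w\<in>slots k. f v - f w) + (f v - f (Suc k, Suc k))) \<le> 2" if v: "v \<in> slots k" for v
  proof -
    have "v \<in> vicsek_nonsink n"
      using slots_nonsink[OF k] v by blast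
    then show ?thesis
      using st[of v] branch[OF v] deg_vicsek_E[of v n] unfolding lap_at_slot[OF k v] reduced_height_def
      by linarith
  qed
  let ?r = "f (Suc k, Suc k)"
  have "k4_stable (k4_residual (block_triple \<eta> k) (inflow f k)
      (f (k, k) - ?r, f (Suc k, k) - ?r, f (k, Suc k) - ?r))"
    using local[of "(k, k)"] local[of "(Suc k, k)"] local[of "(k, Suc k)"]
    unfolding block_triple_def sum_slots by (simp add: slots_def)
  then have "k4_out (block_triple \<eta> k) (carry \<eta> k) \<le> (f (k, k) - ?r) + (f (Suc k, k) - ?r) + (f (k, Suc k) - ?r)"
    using good IH carry_range[of \<eta> k] unfolding block_triple_def good_def
    by (intro k4_out_le[where m' = "inflow f k"]) auto
  then show ?case
    by (simp add: inflow_def sum_slots)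
qed

text \<open>A finitely supported vector has no flow far away.\<close>

lemma stabilizes_imp_extinct:
  assumes good: "good \<eta>" and st: "stabilizes vicsek_E vicsek_V (add_particle vicsek_V (0, 0) \<eta>)"
  shows "\<exists>K. carry \<eta> K = 0"
proof -
  obtain u where u: "stabilizing vicsek_E vicsek_V (add_particle vicsek_V (0, 0) \<eta>) u"
    using st by (auto simp: VI.stabilizes_iff)
  then have supp: "finite {v. u v \<noteq> 0}" "{v. u v \<noteq> 0} \<subseteq> vicsek_V"
    by (simp_all add: stabilizing_def)
  obtain N where N: "{v. u v \<noteq> 0} \<subseteq> vicsek_nonsink N"
  proof (rule finite_subset_nonsink[OF supp])
    show thesis if "\<And>n. N \<le> n \<Longrightarrow> {v. u v \<noteq> 0} \<subseteq> vicsek_nonsink n" for N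
      using that[OF order_refl] by (rule \<open>\<And>N. {v. u v \<noteq> 0} \<subseteq> vicsek_nonsink N \<Longrightarrow> thesis\<close>)
  qed
  let ?k = "3 ^ N :: nat"
  have zero: "u v = 0" if "v \<in> block ?k" for v
  proof -
    have "v \<notin> vicsek_nonsink N"
    proof
      assume v: "v \<in> vicsek_nonsink N"
      then have "fst v \<le> ?k" "snd v \<le> ?k"
        using vicsek_verts_le[of "fst v" "snd v" N] by (simp_all add: vicsek_nonsink_def)
      then have "v = (?k, ?k)"
        using block_ge[OF that] by (intro prod_eqI) simp_all
      then show False
        using v by (simp add: vicsek_nonsink_def vicsek_sink_def)
    qed
    then show ?thesis
      using N by blast
  qed
  have "Suc ?k \<le> 3 ^ Suc N"
    using one_le_power[of "3::nat" N] by simp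
  from stabilizing_inflow[OF good u refl this] have "carry \<eta> (Suc ?k) \<le> 0"
    using zero by (simp add: inflow_def block_slots)
  then have "carry \<eta> (Suc ?k) = 0"
    using carry_range[of \<eta> "Suc ?k"] by auto
  then show ?thesis
    by blast
qed

text \<open>A stabilizing vector is assembled from the \<open>K\<^sub>4\<close> odometers: moving backwards from block \<open>K\<close>, add the
  odometer of the block to the value at its exit, and extend the result to the branches as
  a constant.  A constant shift changes no flow, so the flow from block to block is exactly \<open>carry\<close>.\<close>

lemma extinct_imp_stabilizes:
  assumes good: "good \<eta>" and K: "carry \<eta> K = 0"
  shows "stabilizes vicsek_E vicsek_V (add_particle vicsek_V (0, 0) \<eta>)"
proof -
  let ?w = "\<lambda>k. k4_odometer (block_triple \<eta> k) (carry \<eta> k)"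
  define X where "X k = fst (?w k)" for k
  define Y where "Y k = fst (snd (?w k))" for k
  define Z where "Z k = snd (snd (?w k))" for k
  have w: "?w k = (X k, Y k, Z k)" for k
    by (simp add: X_def Y_def Z_def)
  have T: "block_triple \<eta> k \<in> k4_recurrent" for k
    using good by (simp add: good_def)
  note table = k4_odometer_table[OF T carry_range]
  have nonneg: "0 \<le> X k" "0 \<le> Y k" "0 \<le> Z k" for k
    using table(2)[of k \<eta> k] by (simp_all add: w)
  have out: "X k + Y k + Z k = carry \<eta> (Suc k)" for k
    using T[of k] by (simp add: k4_out_def w)
  have resid: "k4_stable (k4_residual (block_triple \<eta> k) (carry \<eta> k) (X k, Y k, Z k))" for k
    using table(1)[of k \<eta> k] by (simp add: w)
  have extinct: "carry \<eta> (K + j) = 0" for j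
    by (induction j) (simp_all add: K k4_out_zero)
  have XYZ0: "X k = 0" "Y k = 0" "Z k = 0" if "K \<le> k" for k
  proof -
    have "carry \<eta> (Suc k) = 0"
      using extinct[of "Suc k - K"] that by simp
    then show "X k = 0" "Y k = 0" "Z k = 0"
      using out[of k] nonneg[of k] by linarith+
  qed
  define A where "A k = (\<Sum>j\<in>{k..<K}. X j)" for k
  have A0: "A k = 0" if "K \<le> k" for k
    using that by (simp add: A_def)
  have A_step: "A k = X k + A (Suc k)" for k
  proof (cases "k < K")
    case True
    then show ?thesis by (simp add: A_def sum.atLeast_Suc_lessThan)
  next
    case False
    then show ?thesis by (simp add: A0 XYZ0)
  qed
  have A_nonneg: "0 \<le> A k" for k
    unfolding A_def by (intro sum_nonneg nonneg)
  define h :: "vertex \<Rightarrow> int" where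
    "h = (\<lambda>(x, y). if x = y then A x else if y < x then A x + Y y else A y + Z x)"
  have h: "h (k, k) = A k" "h (Suc k, k) = A (Suc k) + Y k" "h (k, Suc k) = A (Suc k) + Z k" for k
    by (simp_all add: h_def)
  have h_nonneg: "0 \<le> h v" for v
    using A_nonneg nonneg by (auto simp: h_def split: prod.split)
  define n where "n = K"
  have Kn: "K < 3 ^ n"
    unfolding n_def by (rule power_gt_expt) simp
  obtain \<pi> where \<pi>: "spine_retraction n \<pi>"
    using spine_retraction_exists by blast
  define f where "f v = (if v \<in> vicsek_verts n then h (\<pi> v) else 0)" for v
  define u where "u v = nat (f v)" for v
  have f_nonneg: "0 \<le> f v" for v
    by (simp add: f_def h_nonneg)
  have fu: "(\<lambda>v. int (u v)) = f"
    using f_nonneg by (simp add: u_def fun_eq_iff)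
  have f_sink: "f (vicsek_sink n) = 0"
    using \<pi> sink_spine[of n] vicsek_sink_vert[of n] Kn
    by (simp add: f_def spine_retraction_def vicsek_sink_def h A0)
  have supp: "f v = 0" if "v \<notin> vicsek_nonsink n" for v
    using that f_sink by (cases "v = vicsek_sink n") (auto simp: f_def vicsek_nonsink_def)
  have f_block: "f v = h v" if "v \<in> block k" "k < 3 ^ n" for v k
  proof -
    have "v \<in> spine" "v \<in> vicsek_verts n"
      using that block_spine block_in_verts by blast+
    then show ?thesis
      using \<pi> by (simp add: f_def spine_retraction_def)
  qed
  have f_off: "f v = f w" if "w \<in> nbrs (vicsek_edges n) v" "v \<notin> spine \<or> w \<notin> spine" for v w
  proof -
    have "v \<in> vicsek_verts n" "w \<in> vicsek_verts n"
      using that(1) vicsek_edge_ends(2,3) by (auto simp: nbrs_def)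
    then show ?thesis
      using nbrs_off_spine[OF \<pi> that] by (simp add: f_def)
  qed
  have infl: "inflow f k = carry \<eta> k" if "k < 3 ^ n" for k
  proof (cases k)
    case 0
    then show ?thesis by (simp add: inflow_def)
  next
    case (Suc j)
    then have "f v = h v" if "v \<in> block j" for v
      using f_block[OF that] \<open>k < 3 ^ n\<close> by simp
    then show ?thesis
      using out[of j] A_step[of j] unfolding Suc by (simp add: inflow_def sum_slots block_def h)
  qed
  have origin: "(0, 0) \<in> spine"
    by (simp add: spine_def)
  have stab: "int (\<eta> v) + of_bool (v = (0, 0)) - lap vicsek_E f v < int (deg vicsek_E v)"
    if v: "v \<in> vicsek_V" for v
  proof -
    have st: "\<eta> v < deg vicsek_E v"
      using good v by (simp add: good_def stable_def)
    show ?thesis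
    proof (cases "v \<in> vicsek_nonsink n")
      case False
      \<comment> \<open>Outside \<open>V\<^sub>n\<close> nothing topples, and next to the sink of \<open>V\<^sub>n\<close> neither, because \<open>K < 3\<^sup>n\<close>.\<close>
      have "f w = 0" if w: "w \<in> nbrs vicsek_E v" for w
      proof (rule ccontr)
        assume nz: "f w \<noteq> 0"
        then have wn: "w \<in> vicsek_nonsink n"
          using supp by blast
        then have e: "v \<in> nbrs (vicsek_edges n) w"
          using w nbrs_sym nbrs_vicsek_E[OF wn] by blast
        then have "v \<in> vicsek_verts n"
          using nbrs_vicsek_edges_subset by blast
        then have vs: "v = vicsek_sink n"
          using False by (simp add: vicsek_nonsink_def)
        then have "f v = 0"
          by (simp add: f_sink)
        then have ws: "w \<in> spine"
          using f_off[OF e] nz by auto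
        obtain k where k: "k < 3 ^ n" "w \<in> slots k"
          using spine_nonsink[OF wn ws] by blast
        have "v \<in> spine"
          using vs sink_spine by simp
        then have "v \<in> (block k - {w}) \<union> (if w = (k, k) \<and> k \<noteq> 0 then slots (k - 1) else {})"
          using nbrs_of_slot[OF k] e by blast
        then have "3 ^ n \<le> Suc k"
          using vs k(1) by (auto simp: vicsek_sink_def block_def slots_def split: if_splits)
        then have "K \<le> k"
          using Kn by simp
        then have "h w = 0"
          using k(2) by (auto simp: slots_def h A0 XYZ0)
        then show False
          using nz f_block[OF _ k(1), of w] k(2) by (simp add: block_slots)
      qed
      then have "lap vicsek_E f v = 0"
        using supp[OF False] by (simp add: lap_def)
      moreover have "v \<noteq> (0, 0)"
        using False vicsek_nonsink_origin by blast
      ultimately show ?thesis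
        using st by simp
    next
      case True
      note eqs = lap_vicsek_E[OF True] deg_vicsek_E[OF True]
      show ?thesis
      proof (cases "v \<in> spine")
        case False
        then have "lap (vicsek_edges n) f v = 0"
          unfolding lap_def using f_off by (intro sum.neutral) auto
        then show ?thesis
          using st False origin by (auto simp: eqs)
      next
        case sp: True
        obtain k where k: "k < 3 ^ n" "v \<in> slots k"
          using spine_nonsink[OF True sp] by blast
        have "(\<Sum>w\<in>nbrs (vicsek_edges n) v - spine. f v - f w) = 0"
          using f_off by (intro sum.neutral) auto
        then have lap: "lap vicsek_E f v = (\<Sum>w\<in>slots k. f v - f w) + (f v - f (Suc k, Suc k))
            - (of_bool (v = (k, k)) * carry \<eta> k - of_bool (v = (0, 0)))"
          using lap_at_slot[OF k, of f] infl[OF k(1)] by (simp add: eqs)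
        have fb: "f x = h x" if "x \<in> block k" for x
          using f_block[OF that k(1)] .
        have "reduced_height \<eta> v + of_bool (v = (k, k)) * carry \<eta> k
            - ((\<Sum>w\<in>slots k. f v - f w) + (f v - f (Suc k, Suc k))) \<le> 2"
          using k(2) resid[of k] A_step[of k] unfolding sum_slots block_triple_def
          by (auto simp: slots_def fb block_def h)
        then show ?thesis
          unfolding lap reduced_height_def by linarith
      qed
    qed
  qed
  have supp_u: "{v. u v \<noteq> 0} \<subseteq> vicsek_nonsink n"
    by (rule support_subset) (simp add: u_def supp)
  then have "finite {v. u v \<noteq> 0}"
    using VS.finite_W by (rule finite_subset)
  moreover have "{v. u v \<noteq> 0} \<subseteq> vicsek_V"
    using supp_u by (auto simp: vicsek_V_eq)
  ultimately have "stabilizing vicsek_E vicsek_V (add_particle vicsek_V (0, 0) \<eta>) u"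
    using stab unfolding stabilizing_def fu by (simp add: add_particle_eq add_particles_def)
  then show ?thesis
    by (rule VI.least_action)
qed

section \<open>Passing to the infinite volume limit\<close>

lemma carry_dep:
  assumes "\<And>v. v \<in> (\<Union>k<K. slots k) \<Longrightarrow> \<eta> v = \<eta>' v"
  shows "carry \<eta> K = carry \<eta>' K"
  using assms by (intro carry_cong) (auto simp: block_triple_def reduced_height_def slots_def)

lemma slots_subset_V: "slots k \<subseteq> vicsek_V"
proof -
  have "k < 3 ^ k"
    by (rule power_gt_expt) simp
  from slots_nonsink[OF this] show ?thesis
    by (auto simp: vicsek_V_eq)
qed

lemma prob_recurrent_1:
  assumes "\<And>\<eta>. \<eta> \<in> recurrent_sandpiles n \<Longrightarrow> P \<eta>"
  shows "measure_pmf.prob (vicsek_mu n) {\<eta>. P \<eta>} = 1"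
proof -
  have "AE \<eta> in measure_pmf (vicsek_mu n). \<eta> \<in> {\<eta>. P \<eta>}"
    using assms by (simp add: AE_measure_pmf_iff vicsek_mu_def finite_recurrent recurrent_nonempty)
  then show ?thesis
    by (subst measure_pmf.prob_eq_1) auto
qed

locale vicsek_limit =
  fixes \<mu> :: "(vertex \<Rightarrow> nat) measure"
  assumes limit: "infinite_volume_limit \<mu>"
begin

sublocale prob_space \<mu>
  using limit by (simp add: infinite_volume_limit_def)

lemma sets_mu: "sets \<mu> = sets (PiM vicsek_V (\<lambda>_. count_space UNIV))"
  using limit by (simp add: infinite_volume_limit_def)

lemma pred_coordinate:
  assumes "v \<in> vicsek_V"
  shows "Measurable.pred \<mu> (\<lambda>\<eta>. R (\<eta> v))"
proof -
  have "(\<lambda>\<eta>. \<eta> v) \<in> \<mu> \<rightarrow>\<^sub>M count_space UNIV"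
    using measurable_component_singleton[OF assms, of "\<lambda>_. count_space UNIV"]
    by (simp add: measurable_cong_sets[OF sets_mu refl])
  then show ?thesis
    by (rule measurable_compose) simp
qed

lemma sets_cylinder:
  assumes "finite A" "A \<subseteq> vicsek_V"
  shows "{\<eta> \<in> space \<mu>. \<forall>v\<in>A. \<eta> v = \<xi> v} \<in> sets \<mu>"
proof -
  have "Measurable.pred \<mu> (\<lambda>\<eta>. \<forall>v\<in>A. \<eta> v = \<xi> v)"
    using assms by (intro pred_intros_finite pred_coordinate) auto
  then show ?thesis
    by (simp add: pred_def)
qed

text \<open>Heights are unbounded in the product space, so an event that depends on \<open>A\<close> is a countable union of
  cylinders and convergence could fail by loss of mass.  Restricted to stable heights it is a finite
  union, and the finite measures do not see the restriction.\<close>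

lemma cylinder_limit:
  assumes A: "finite A" "A \<subseteq> vicsek_V"
    and dep: "\<And>\<eta> \<eta>'. (\<And>v. v \<in> A \<Longrightarrow> \<eta> v = \<eta>' v) \<Longrightarrow> Q \<eta> = Q \<eta>'"
    and B: "B = (\<Pi>\<^sub>E v\<in>A. {..<deg vicsek_E v})"
  shows "{\<eta> \<in> space \<mu>. restrict \<eta> A \<in> B \<and> Q \<eta>} \<in> sets \<mu>"
    and "(\<lambda>n. measure_pmf.prob (vicsek_mu n) {\<eta>. Q \<eta>})
           \<longlonglongrightarrow> measure \<mu> {\<eta> \<in> space \<mu>. restrict \<eta> A \<in> B \<and> Q \<eta>}"
proof -
  let ?X = "{\<xi> \<in> B. Q \<xi>}"
  let ?cyl = "\<lambda>\<xi>. {\<eta> \<in> space \<mu>. \<forall>v\<in>A. \<eta> v = \<xi> v}"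
  let ?cyl' = "\<lambda>\<xi>. {\<eta>. \<forall>v\<in>A. \<eta> v = \<xi> v}"
  have finB: "finite ?X"
    unfolding B using A(1) by (intro finite_subset[OF _ finite_PiE[of A "\<lambda>v. {..<deg vicsek_E v}"]]) auto
  have ext: "\<xi> \<in> extensional A" if "\<xi> \<in> B" for \<xi>
    using that by (simp add: B PiE_def)
  have eq_restrict: "restrict \<eta> A = \<xi>" if "\<forall>v\<in>A. \<eta> v = \<xi> v" "\<xi> \<in> B" for \<eta> \<xi> :: "vertex \<Rightarrow> nat"
    using that ext by (intro extensionalityI[of _ A]) auto
  have Q_restrict: "Q (restrict \<eta> A) = Q \<eta>" for \<eta>
    by (rule dep) simp
  have union: "restrict \<eta> A \<in> B \<and> Q \<eta> \<longleftrightarrow> (\<exists>\<xi>\<in>?X. \<forall>v\<in>A. \<eta> v = \<xi> v)" for \<eta>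
  proof
    assume "restrict \<eta> A \<in> B \<and> Q \<eta>"
    then show "\<exists>\<xi>\<in>?X. \<forall>v\<in>A. \<eta> v = \<xi> v"
      using Q_restrict by (intro bexI[of _ "restrict \<eta> A"]) auto
  next
    assume "\<exists>\<xi>\<in>?X. \<forall>v\<in>A. \<eta> v = \<xi> v"
    then obtain \<xi> where "\<xi> \<in> B" "Q \<xi>" "\<forall>v\<in>A. \<eta> v = \<xi> v"
      by blast
    then show "restrict \<eta> A \<in> B \<and> Q \<eta>"
      using eq_restrict[of \<eta> \<xi>] Q_restrict[of \<eta>] by simp
  qed
  have inter: "?cyl' \<xi> \<inter> ?cyl' \<xi>' = {}" if X: "\<xi> \<in> ?X" "\<xi>' \<in> ?X" and ne: "\<xi> \<noteq> \<xi>'" for \<xi> \<xi>'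
  proof (rule ccontr)
    assume "?cyl' \<xi> \<inter> ?cyl' \<xi>' \<noteq> {}"
    then obtain \<eta> where "\<forall>v\<in>A. \<eta> v = \<xi> v" "\<forall>v\<in>A. \<eta> v = \<xi>' v"
      by blast
    from this[THEN eq_restrict] have "restrict \<eta> A = \<xi>" "restrict \<eta> A = \<xi>'"
      using X by simp_all
    with ne show False
      by (elim notE) (rule trans[OF sym])
  qed
  have disj': "disjoint_family_on ?cyl' ?X"
    unfolding disjoint_family_on_def by (intro ballI impI inter)
  have disj: "disjoint_family_on ?cyl ?X"
    unfolding disjoint_family_on_def
  proof (intro ballI impI)
    show "?cyl \<xi> \<inter> ?cyl \<xi>' = {}" if "\<xi> \<in> ?X" "\<xi>' \<in> ?X" "\<xi> \<noteq> \<xi>'" for \<xi> \<xi>'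
      using inter[OF that] by blast
  qed
  have set_eq: "{\<eta> \<in> space \<mu>. restrict \<eta> A \<in> B \<and> Q \<eta>} = (\<Union>\<xi>\<in>?X. ?cyl \<xi>)"
    unfolding union by blast
  show "{\<eta> \<in> space \<mu>. restrict \<eta> A \<in> B \<and> Q \<eta>} \<in> sets \<mu>"
    unfolding set_eq using finB sets_cylinder[OF A] by (intro sets.finite_UN) auto
  have sum: "measure \<mu> {\<eta> \<in> space \<mu>. restrict \<eta> A \<in> B \<and> Q \<eta>} = (\<Sum>\<xi>\<in>?X. measure \<mu> (?cyl \<xi>))"
    unfolding set_eq using finB disj sets_cylinder[OF A] by (intro finite_measure_finite_Union) auto
  have lim: "(\<lambda>n. \<Sum>\<xi>\<in>?X. measure_pmf.prob (vicsek_mu n) (?cyl' \<xi>)) \<longlonglongrightarrow> (\<Sum>\<xi>\<in>?X. measure \<mu> (?cyl \<xi>))"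
    using limit A unfolding infinite_volume_limit_def by (intro tendsto_sum) blast
  have "\<forall>\<^sub>F n in sequentially.
      (\<Sum>\<xi>\<in>?X. measure_pmf.prob (vicsek_mu n) (?cyl' \<xi>)) = measure_pmf.prob (vicsek_mu n) {\<eta>. Q \<eta>}"
  proof (rule finite_subset_nonsink[OF A])
    fix N assume N: "\<And>n. N \<le> n \<Longrightarrow> A \<subseteq> vicsek_nonsink n"
    show ?thesis
    proof (rule eventually_sequentiallyI)
      fix n assume "N \<le> n"
      then have An: "A \<subseteq> vicsek_nonsink n"
        by (rule N)
      have "(\<Sum>\<xi>\<in>?X. measure_pmf.prob (vicsek_mu n) (?cyl' \<xi>)) = measure_pmf.prob (vicsek_mu n) (\<Union>\<xi>\<in>?X. ?cyl' \<xi>)"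
        using finB disj' by (intro measure_pmf.finite_measure_finite_Union[symmetric]) auto
      also have "(\<Union>\<xi>\<in>?X. ?cyl' \<xi>) = {\<eta>. restrict \<eta> A \<in> B \<and> Q \<eta>}"
        unfolding union by blast
      \<comment> \<open>Recurrent sandpiles are stable, so the restriction to \<open>B\<close> costs nothing.\<close>
      also have "measure_pmf.prob (vicsek_mu n) \<dots> = measure_pmf.prob (vicsek_mu n) {\<eta>. Q \<eta>}"
      proof (rule measure_pmf.finite_measure_eq_AE)
        have "restrict \<eta> A \<in> B" if \<eta>: "\<eta> \<in> recurrent_sandpiles n" for \<eta>
        proof -
          have "\<eta> v < deg vicsek_E v" if "v \<in> A" for v
            using \<eta> that An deg_vicsek_E[of v n] by (auto simp: recurrent_sandpiles_eq stable_def)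
          then show ?thesis
            unfolding B by (simp add: restrict_PiE_iff)
        qed
        then show "AE \<eta> in measure_pmf (vicsek_mu n). \<eta> \<in> {\<eta>. restrict \<eta> A \<in> B \<and> Q \<eta>} \<longleftrightarrow> \<eta> \<in> {\<eta>. Q \<eta>}"
          by (simp add: AE_measure_pmf_iff vicsek_mu_def finite_recurrent recurrent_nonempty)
      qed auto
      finally show "(\<Sum>\<xi>\<in>?X. measure_pmf.prob (vicsek_mu n) (?cyl' \<xi>)) = measure_pmf.prob (vicsek_mu n) {\<eta>. Q \<eta>}" .
    qed
  qed
  from Lim_transform_eventually[OF lim this] show "(\<lambda>n. measure_pmf.prob (vicsek_mu n) {\<eta>. Q \<eta>})
      \<longlonglongrightarrow> measure \<mu> {\<eta> \<in> space \<mu>. restrict \<eta> A \<in> B \<and> Q \<eta>}"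
    unfolding sum .
qed

text \<open>The restriction to stable heights in the preceding lemma is harmless in the limit as well, as that
  lemma shows when applied to the sure event.\<close>

lemma local_event:
  assumes A: "finite A" "A \<subseteq> vicsek_V"
    and dep: "\<And>\<eta> \<eta>'. (\<And>v. v \<in> A \<Longrightarrow> \<eta> v = \<eta>' v) \<Longrightarrow> Q \<eta> = Q \<eta>'"
    and const: "\<forall>\<^sub>F n in sequentially. measure_pmf.prob (vicsek_mu n) {\<eta>. Q \<eta>} = c"
  shows "{\<eta> \<in> space \<mu>. Q \<eta>} \<in> events" "prob {\<eta> \<in> space \<mu>. Q \<eta>} = c"
proof -
  define B where "B = (\<Pi>\<^sub>E v\<in>A. {..<deg vicsek_E v})"
  have "{\<eta> \<in> space \<mu>. Q \<eta>} = (\<Union>\<xi>\<in>{\<xi> \<in> A \<rightarrow>\<^sub>E UNIV. Q \<xi>}. {\<eta> \<in> space \<mu>. \<forall>v\<in>A. \<eta> v = \<xi> v})"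
  proof -
    have "Q \<eta> \<longleftrightarrow> (\<exists>\<xi>\<in>{\<xi> \<in> A \<rightarrow>\<^sub>E UNIV. Q \<xi>}. \<forall>v\<in>A. \<eta> v = \<xi> v)" for \<eta>
    proof
      assume "Q \<eta>"
      moreover have "Q (restrict \<eta> A) = Q \<eta>"
        by (rule dep) simp
      ultimately show "\<exists>\<xi>\<in>{\<xi> \<in> A \<rightarrow>\<^sub>E UNIV. Q \<xi>}. \<forall>v\<in>A. \<eta> v = \<xi> v"
        by (intro bexI[of _ "restrict \<eta> A"]) auto
    next
      assume "\<exists>\<xi>\<in>{\<xi> \<in> A \<rightarrow>\<^sub>E UNIV. Q \<xi>}. \<forall>v\<in>A. \<eta> v = \<xi> v"
      then obtain \<xi> where "Q \<xi>" "\<forall>v\<in>A. \<eta> v = \<xi> v"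
        by blast
      then show "Q \<eta>"
        using dep[of \<eta> \<xi>] by blast
    qed
    then show ?thesis
      by blast
  qed
  moreover have "countable (A \<rightarrow>\<^sub>E (UNIV :: nat set))"
    using A(1) by (intro countable_PiE) auto
  ultimately show ev: "{\<eta> \<in> space \<mu>. Q \<eta>} \<in> events"
    using sets_cylinder[OF A] by (auto intro!: sets.countable_UN' countable_subset[of "{\<xi> \<in> A \<rightarrow>\<^sub>E UNIV. Q \<xi>}"])
  note lim = cylinder_limit[OF A _ B_def]
  let ?S = "{\<eta> \<in> space \<mu>. restrict \<eta> A \<in> B \<and> True}"
  have S: "?S \<in> events"
    by (rule lim(1)) simp
  have "(\<lambda>n. measure_pmf.prob (vicsek_mu n) {\<eta>. True}) \<longlonglongrightarrow> prob ?S"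
    by (rule lim(2)) simp
  moreover have "(\<lambda>n. measure_pmf.prob (vicsek_mu n) {\<eta>. True}) \<longlonglongrightarrow> 1"
    by simp
  ultimately have 1: "prob ?S = 1"
    by (rule LIMSEQ_unique)
  have c: "prob {\<eta> \<in> space \<mu>. restrict \<eta> A \<in> B \<and> Q \<eta>} = c"
    using LIMSEQ_unique[OF lim(2)[OF dep] tendsto_eventually[OF const]] .
  have "AE \<eta> in \<mu>. restrict \<eta> A \<in> B"
  proof -
    have "AE \<eta> in \<mu>. \<eta> \<in> ?S"
      using 1 prob_eq_1[OF S] by simp
    then show ?thesis
      by (rule eventually_mono) simp
  qed
  then have "prob {\<eta> \<in> space \<mu>. Q \<eta>} = prob {\<eta> \<in> space \<mu>. restrict \<eta> A \<in> B \<and> Q \<eta>}"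
    using ev lim(1)[OF dep] by (intro finite_measure_eq_AE) auto
  then show "prob {\<eta> \<in> space \<mu>. Q \<eta>} = c"
    using c by simp
qed

lemma AE_local:
  assumes A: "finite A" "A \<subseteq> vicsek_V"
    and dep: "\<And>\<eta> \<eta>'. (\<And>v. v \<in> A \<Longrightarrow> \<eta> v = \<eta>' v) \<Longrightarrow> Q \<eta> = Q \<eta>'"
    and rec: "\<And>n \<eta>. A \<subseteq> vicsek_nonsink n \<Longrightarrow> \<eta> \<in> recurrent_sandpiles n \<Longrightarrow> Q \<eta>"
  shows "AE \<eta> in \<mu>. Q \<eta>"
proof (rule finite_subset_nonsink[OF A])
  fix N assume N: "\<And>n. N \<le> n \<Longrightarrow> A \<subseteq> vicsek_nonsink n"
  have "\<forall>\<^sub>F n in sequentially. measure_pmf.prob (vicsek_mu n) {\<eta>. Q \<eta>} = 1"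
    using N rec by (intro eventually_sequentiallyI[of N] prob_recurrent_1) blast
  note ev = local_event[OF A dep this]
  have "AE \<eta> in \<mu>. \<eta> \<in> {\<eta> \<in> space \<mu>. Q \<eta>}"
    using ev(2) prob_eq_1[OF ev(1)] by simp
  then show ?thesis
    by (rule eventually_mono) simp
qed

lemma AE_good: "AE \<eta> in \<mu>. good \<eta>"
proof -
  have "AE \<eta> in \<mu>. \<forall>v\<in>vicsek_V. \<eta> v < deg vicsek_E v"
  proof (subst AE_ball_countable)
    show "\<forall>v\<in>vicsek_V. AE \<eta> in \<mu>. \<eta> v < deg vicsek_E v"
    proof
      fix v assume v: "v \<in> vicsek_V"
      show "AE \<eta> in \<mu>. \<eta> v < deg vicsek_E v"
      proof (rule AE_local[of "{v}"])
        show "\<eta> v < deg vicsek_E v" if "{v} \<subseteq> vicsek_nonsink n" "\<eta> \<in> recurrent_sandpiles n" for n \<eta>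
          using that deg_vicsek_E[of v n] by (auto simp: recurrent_sandpiles_eq stable_def)
      qed (use v in auto)
    qed
  qed (rule countableI_type)
  moreover have "AE \<eta> in \<mu>. \<forall>k. block_triple \<eta> k \<in> k4_recurrent"
  proof (subst AE_all_countable, rule allI)
    fix k
    show "AE \<eta> in \<mu>. block_triple \<eta> k \<in> k4_recurrent"
    proof (rule AE_local[of "slots k"])
      show "block_triple \<eta> k \<in> k4_recurrent" if "slots k \<subseteq> vicsek_nonsink n" "\<eta> \<in> recurrent_sandpiles n" for n \<eta>
      proof -
        have "(k, k) \<in> vicsek_nonsink n"
          using that(1) by (auto simp: slots_def)
        then have "k \<le> 3 ^ n" "k \<noteq> 3 ^ n"
          using vicsek_verts_le[of k k n] by (auto simp: vicsek_nonsink_def vicsek_sink_def)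
        then show ?thesis
          using recurrent_block_triple[OF that(2)] by simp
      qed
      show "(block_triple \<eta> k \<in> k4_recurrent) = (block_triple \<eta>' k \<in> k4_recurrent)"
        if "\<And>v. v \<in> slots k \<Longrightarrow> \<eta> v = \<eta>' v" for \<eta> \<eta>'
        using that by (simp add: block_triple_def reduced_height_def slots_def)
    qed (use slots_subset_V in \<open>simp_all add: slots_def\<close>)
  qed
  moreover have "AE \<eta> in \<mu>. \<forall>F\<in>{F. finite F \<and> F \<noteq> {} \<and> F \<subseteq> vicsek_V}. \<exists>v\<in>F. card (nbrs vicsek_E v \<inter> F) \<le> \<eta> v"
  proof (subst AE_ball_countable)
    show "countable {F. finite F \<and> F \<noteq> {} \<and> F \<subseteq> vicsek_V}"
      by (rule countable_subset[OF _ countable_Collect_finite]) auto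
    show "\<forall>F\<in>{F. finite F \<and> F \<noteq> {} \<and> F \<subseteq> vicsek_V}. AE \<eta> in \<mu>. \<exists>v\<in>F. card (nbrs vicsek_E v \<inter> F) \<le> \<eta> v"
    proof
      fix F assume F: "F \<in> {F. finite F \<and> F \<noteq> {} \<and> F \<subseteq> vicsek_V}"
      show "AE \<eta> in \<mu>. \<exists>v\<in>F. card (nbrs vicsek_E v \<inter> F) \<le> \<eta> v"
      proof (rule AE_local[of F])
        show "\<exists>v\<in>F. card (nbrs vicsek_E v \<inter> F) \<le> \<eta> v"
          if "F \<subseteq> vicsek_nonsink n" "\<eta> \<in> recurrent_sandpiles n" for n \<eta>
        proof -
          have "allowed (vicsek_edges n) (vicsek_nonsink n) \<eta>"
            using that(2) by (simp add: recurrent_sandpiles_eq)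
          moreover have "finite F \<and> F \<noteq> {} \<and> F \<subseteq> vicsek_nonsink n"
            using F that(1) by blast
          ultimately obtain v where v: "v \<in> F" "card (nbrs (vicsek_edges n) v \<inter> F) \<le> \<eta> v"
            unfolding allowed_def by blast
          then have "nbrs vicsek_E v = nbrs (vicsek_edges n) v"
            using that(1) by (intro nbrs_vicsek_E) auto
          with v show ?thesis
            by (intro bexI[of _ v]) simp_all
        qed
      qed (use F in auto)
    qed
  qed
  ultimately show ?thesis
  proof eventually_elim
    case (elim \<eta>)
    then show ?case
      unfolding good_def stable_def allowed_def by blast
  qed
qed

lemma prob_extinct: "{\<eta> \<in> space \<mu>. carry \<eta> K = 0} \<in> events" "prob {\<eta> \<in> space \<mu>. carry \<eta> K = 0} = carry_law K 0"
proof -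
  let ?A = "\<Union>k<K. slots k"
  have A: "finite ?A" "?A \<subseteq> vicsek_V"
    using slots_subset_V by (auto simp: slots_def)
  have dep: "(carry \<eta> K = 0) = (carry \<eta>' K = 0)" if "\<And>v. v \<in> ?A \<Longrightarrow> \<eta> v = \<eta>' v" for \<eta> \<eta>'
    using carry_dep[OF that] by simp
  have "\<forall>\<^sub>F n in sequentially. measure_pmf.prob (vicsek_mu n) {\<eta>. carry \<eta> K = 0} = carry_law K 0"
  proof (rule eventually_sequentiallyI)
    fix n assume "K \<le> n"
    also have "n < 3 ^ n"
      by (rule power_gt_expt) simp
    finally show "measure_pmf.prob (vicsek_mu n) {\<eta>. carry \<eta> K = 0} = carry_law K 0"
      by (intro prob_carry) simp
  qed
  note ev = local_event[OF A dep this]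
  from ev show "{\<eta> \<in> space \<mu>. carry \<eta> K = 0} \<in> events" "prob {\<eta> \<in> space \<mu>. carry \<eta> K = 0} = carry_law K 0"
    by auto
qed

text \<open>By the least action principle, stabilization means the existence of a finitely supported toppling
  vector, and such a vector is the count function of one of countably many lists.\<close>

lemma stabilizes_event:
  "{\<eta> \<in> space \<mu>. stabilizes vicsek_E vicsek_V (add_particle vicsek_V (0, 0) \<eta>)} \<in> events"
proof -
  let ?R = "\<lambda>l v h. int (h + of_bool (v = (0, 0))) - lap vicsek_E (\<lambda>w. int (count_list l w)) v < int (deg vicsek_E v)"
  have "stabilizes vicsek_E vicsek_V (add_particle vicsek_V (0, 0) \<eta>) \<longleftrightarrow>
      (\<exists>l. set l \<subseteq> vicsek_V \<and> (\<forall>v. v \<in> vicsek_V \<longrightarrow> ?R l v (\<eta> v)))" for \<eta>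
  proof
    assume "stabilizes vicsek_E vicsek_V (add_particle vicsek_V (0, 0) \<eta>)"
    then obtain u where u: "stabilizing vicsek_E vicsek_V (add_particle vicsek_V (0, 0) \<eta>) u"
      by (auto simp: VI.stabilizes_iff)
    then have supp: "finite {v. u v \<noteq> 0}" "{v. u v \<noteq> 0} \<subseteq> vicsek_V"
      by (simp_all add: stabilizing_def)
    obtain l where "set l \<subseteq> {v. u v \<noteq> 0}" "count_list l = u"
      using word_with_counts[OF supp(1), of u] by auto
    then show "\<exists>l. set l \<subseteq> vicsek_V \<and> (\<forall>v. v \<in> vicsek_V \<longrightarrow> ?R l v (\<eta> v))"
      using u supp(2) unfolding stabilizing_def
      by (intro exI[of _ l]) (auto simp: add_particle_eq add_particles_def)
  next
    assume "\<exists>l. set l \<subseteq> vicsek_V \<and> (\<forall>v. v \<in> vicsek_V \<longrightarrow> ?R l v (\<eta> v))"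
    then obtain l where l: "set l \<subseteq> vicsek_V" "\<And>v. v \<in> vicsek_V \<Longrightarrow> ?R l v (\<eta> v)"
      by blast
    have "{v. count_list l v \<noteq> 0} = set l"
      by (auto simp: count_list_0_iff)
    then have "stabilizing vicsek_E vicsek_V (add_particle vicsek_V (0, 0) \<eta>) (count_list l)"
      using l unfolding stabilizing_def by (simp add: add_particle_eq add_particles_def)
    then show "stabilizes vicsek_E vicsek_V (add_particle vicsek_V (0, 0) \<eta>)"
      by (rule VI.least_action)
  qed
  moreover have "Measurable.pred \<mu> (\<lambda>\<eta>. \<exists>l. set l \<subseteq> vicsek_V \<and> (\<forall>v. v \<in> vicsek_V \<longrightarrow> ?R l v (\<eta> v)))"
  proof (intro pred_intros_countable)
    fix l
    have "Measurable.pred \<mu> (\<lambda>\<eta>. v \<in> vicsek_V \<longrightarrow> ?R l v (\<eta> v))" for v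
      using pred_coordinate[of v "?R l v"] by (cases "v \<in> vicsek_V") simp_all
    then have "Measurable.pred \<mu> (\<lambda>\<eta>. \<forall>v. v \<in> vicsek_V \<longrightarrow> ?R l v (\<eta> v))"
      by (rule pred_intros_countable)
    then show "Measurable.pred \<mu> (\<lambda>\<eta>. set l \<subseteq> vicsek_V \<and> (\<forall>v. v \<in> vicsek_V \<longrightarrow> ?R l v (\<eta> v)))"
      by (cases "set l \<subseteq> vicsek_V") simp_all
  qed
  ultimately show ?thesis
    by (simp add: pred_def)
qed

lemma prob_stabilizes:
  "prob {\<eta> \<in> space \<mu>. stabilizes vicsek_E vicsek_V (add_particle vicsek_V (0, 0) \<eta>)} = 3 / 4"
proof -
  let ?E = "\<lambda>K. {\<eta> \<in> space \<mu>. carry \<eta> K = 0}"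
  have E: "range ?E \<subseteq> events"
    using prob_extinct(1) by blast
  have "incseq ?E"
    by (rule incseq_SucI) (auto simp: k4_out_zero)
  with E have "(\<lambda>K. prob (?E K)) \<longlonglongrightarrow> prob (\<Union>K. ?E K)"
    by (rule finite_Lim_measure_incseq)
  then have "prob (\<Union>K. ?E K) = 3 / 4"
    using LIMSEQ_unique carry_law_extinct unfolding prob_extinct(2) by blast
  moreover have "prob {\<eta> \<in> space \<mu>. stabilizes vicsek_E vicsek_V (add_particle vicsek_V (0, 0) \<eta>)} = prob (\<Union>K. ?E K)"
  proof (rule finite_measure_eq_AE)
    show "AE \<eta> in \<mu>. (\<eta> \<in> {\<eta> \<in> space \<mu>. stabilizes vicsek_E vicsek_V (add_particle vicsek_V (0, 0) \<eta>)})
        \<longleftrightarrow> (\<eta> \<in> (\<Union>K. ?E K))"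
      using AE_good
    proof (rule eventually_mono)
      fix \<eta> assume "good \<eta>"
      then have "stabilizes vicsek_E vicsek_V (add_particle vicsek_V (0, 0) \<eta>) \<longleftrightarrow> (\<exists>K. carry \<eta> K = 0)"
        using stabilizes_imp_extinct extinct_imp_stabilizes by blast
      then show "(\<eta> \<in> {\<eta> \<in> space \<mu>. stabilizes vicsek_E vicsek_V (add_particle vicsek_V (0, 0) \<eta>)})
          \<longleftrightarrow> (\<eta> \<in> (\<Union>K. ?E K))"
        by simp
    qed
    show "(\<Union>K. ?E K) \<in> events"
      using E by (intro sets.countable_UN) auto
  qed (rule stabilizes_event)
  ultimately show ?thesis
    by simp
qed

end

theorem theorem1p1:
  fixes \<mu> :: "(vertex \<Rightarrow> nat) measure"
  assumes "infinite_volume_limit \<mu>"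
  shows "measure \<mu> {\<eta> \<in> space \<mu>.
           stabilizes vicsek_E vicsek_V (add_particle vicsek_V (0, 0) \<eta>)} = 3 / 4"
proof -
  interpret vicsek_limit \<mu>
    by unfold_locales fact
  show ?thesis
    by (rule prob_stabilizes)
qed

end
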